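(* Let $G$ be a prosoluble group with PIG and $N$ a closed pronilpotent normal subgroup of $G$. If $G/\overline{N'}$ has finite rank then $G$ has finite rank.
   Context: A prosoluble (resp. pronilpotent) group is an inverse limit of finite soluble (resp. finite nilpotent) groups. A profinite group $G$ has PIG if there is a constant $\alpha$ such that for every continuous finite quotient $Q$ of $G$ one has $|Q/Q^{n}|\le n^{\alpha}$ for all $n\in\mathbb{N}$, where $Q^{n}$ denotes the subgroup generated by all $n$-th powers. $\overline{N'}$ denotes the closure of the derived group $N'$ of $N$. The rank of a profinite group $G$ is $\sup\{\mathrm{d}(H)\mid H \text{ a closed subgroup of } G,\ \mathrm{d}(H)<\infty\}$, where $\mathrm{d}(H)$ is the minimal cardinality of a topological generating set of $H$ (equivalently one may let $H$ range over open subgroups). *)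

theory Defs
  imports "HOL-Analysis.Analysis" "HOL-Algebra.Solvable_Groups" "HOL-Algebra.Product_Groups"
begin

section \<open>Topological groups and their quotients\<close>

definition topological_group :: "('a, 'b) monoid_scheme \<Rightarrow> 'a topology \<Rightarrow> bool" where
  "topological_group G T \<longleftrightarrow>
     group G \<and> topspace T = carrier G \<and>
     continuous_map (prod_topology T T) T (\<lambda>(x, y). x \<otimes>\<^bsub>G\<^esub> y) \<and>
     continuous_map T T (\<lambda>x. inv\<^bsub>G\<^esub> x)"

definition quotient_topology :: "'a topology \<Rightarrow> ('a \<Rightarrow> 'c) \<Rightarrow> 'c topology" where
  "quotient_topology T f =
     topology (\<lambda>U. U \<subseteq> f ` topspace T \<and> openin T {x \<in> topspace T. f x \<in> U})"

lemma openin_quotient_topology: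
  "openin (quotient_topology T f) U \<longleftrightarrow>
     U \<subseteq> f ` topspace T \<and> openin T {x \<in> topspace T. f x \<in> U}"
proof -
  have "istopology (\<lambda>U. U \<subseteq> f ` topspace T \<and> openin T {x \<in> topspace T. f x \<in> U})"
    unfolding istopology_def
  proof (intro conjI allI impI)
    fix S U
    assume "S \<subseteq> f ` topspace T \<and> openin T {x \<in> topspace T. f x \<in> S}"
      and "U \<subseteq> f ` topspace T \<and> openin T {x \<in> topspace T. f x \<in> U}"
    moreover have "{x \<in> topspace T. f x \<in> S \<inter> U} =
        {x \<in> topspace T. f x \<in> S} \<inter> {x \<in> topspace T. f x \<in> U}"
      by auto
    ultimately show "S \<inter> U \<subseteq> f ` topspace T" "openin T {x \<in> topspace T. f x \<in> S \<inter> U}"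
      by (blast, simp only: openin_Int)
  next
    fix \<U>
    assume *: "\<forall>U\<in>\<U>. U \<subseteq> f ` topspace T \<and> openin T {x \<in> topspace T. f x \<in> U}"
    then show "\<Union>\<U> \<subseteq> f ` topspace T" by blast
    have "{x \<in> topspace T. f x \<in> \<Union>\<U>} = (\<Union>U\<in>\<U>. {x \<in> topspace T. f x \<in> U})"
      by auto
    moreover have "openin T (\<Union>U\<in>\<U>. {x \<in> topspace T. f x \<in> U})"
      by (rule openin_Union) (use * in blast)
    ultimately show "openin T {x \<in> topspace T. f x \<in> \<Union>\<U>}" by (simp only:)
  qed
  then show ?thesis
    by (simp only: quotient_topology_def topology_inverse')
qed

lemma topspace_quotient_topology: "topspace (quotient_topology T f) = f ` topspace T"
proof (rule antisym)
  show "topspace (quotient_topology T f) \<subseteq> f ` topspace T"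
    using openin_topspace[of "quotient_topology T f"] unfolding openin_quotient_topology by (rule conjunct1)
  have "{x \<in> topspace T. f x \<in> f ` topspace T} = topspace T" by auto
  then have "openin (quotient_topology T f) (f ` topspace T)"
    by (simp only: openin_quotient_topology openin_topspace subset_refl simp_thms)
  then show "f ` topspace T \<subseteq> topspace (quotient_topology T f)"
    by (rule openin_subset)
qed

lemma quotient_map_quotient_topology: "quotient_map T (quotient_topology T f) f"
  by (simp add: quotient_map_def topspace_quotient_topology openin_quotient_topology)

definition quotient_group_topology ::
    "('a, 'b) monoid_scheme \<Rightarrow> 'a topology \<Rightarrow> 'a set \<Rightarrow> 'a set topology" where
  "quotient_group_topology G T K = quotient_topology T (\<lambda>x. K #>\<^bsub>G\<^esub> x)"


section \<open>Inverse limits of finite groups\<close>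

text \<open>
  A pair \<open>(i, j) \<in> R\<close> means \<open>i \<le> j\<close>, and \<open>\<phi> i j\<close> is the transition map from \<open>H j\<close> to \<open>H i\<close>.
\<close>

definition inverse_system ::
    "'i set \<Rightarrow> ('i \<times> 'i) set \<Rightarrow> ('i \<Rightarrow> 'c monoid) \<Rightarrow> ('i \<Rightarrow> 'i \<Rightarrow> 'c \<Rightarrow> 'c) \<Rightarrow> bool" where
  "inverse_system I R H \<phi> \<longleftrightarrow>
     I \<noteq> {} \<and> partial_order_on I R \<and>
     (\<forall>i\<in>I. \<forall>j\<in>I. \<exists>k\<in>I. (i, k) \<in> R \<and> (j, k) \<in> R) \<and>
     (\<forall>i\<in>I. group (H i)) \<and>
     (\<forall>i j. (i, j) \<in> R \<longrightarrow> \<phi> i j \<in> hom (H j) (H i)) \<and>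
     (\<forall>i\<in>I. \<forall>x\<in>carrier (H i). \<phi> i i x = x) \<and>
     (\<forall>i j k. (i, j) \<in> R \<longrightarrow> (j, k) \<in> R \<longrightarrow>
        (\<forall>x\<in>carrier (H k). \<phi> i j (\<phi> j k x) = \<phi> i k x))"

definition inverse_limit ::
    "'i set \<Rightarrow> ('i \<times> 'i) set \<Rightarrow> ('i \<Rightarrow> 'c monoid) \<Rightarrow> ('i \<Rightarrow> 'i \<Rightarrow> 'c \<Rightarrow> 'c) \<Rightarrow> ('i \<Rightarrow> 'c) monoid" where
  "inverse_limit I R H \<phi> =
     (product_group I H)
       \<lparr>carrier := {x \<in> carrier (product_group I H). \<forall>i j. (i, j) \<in> R \<longrightarrow> \<phi> i j (x j) = x i}\<rparr>"

definition inverse_limit_topology ::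
    "'i set \<Rightarrow> ('i \<times> 'i) set \<Rightarrow> ('i \<Rightarrow> 'c monoid) \<Rightarrow> ('i \<Rightarrow> 'i \<Rightarrow> 'c \<Rightarrow> 'c) \<Rightarrow> ('i \<Rightarrow> 'c) topology" where
  "inverse_limit_topology I R H \<phi> =
     subtopology (product_topology (\<lambda>i. discrete_topology (carrier (H i))) I)
       (carrier (inverse_limit I R H \<phi>))"

text \<open>
  The topological group \<open>G\<close> is an inverse limit of finite groups with property \<open>P\<close>.

  HOL cannot quantify over the types of the index set and of the finite groups, so these are
  fixed; no generality is lost for a property \<open>P\<close> that is invariant under isomorphism and inherited
  by subgroups. Every finite group is isomorphic to one with carrier in \<^typ>\<open>nat\<close>. If \<open>G\<close> is an
  inverse limit of finite groups \<open>H i\<close> over any directed set, let \<open>K i\<close> be the kernel of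
  the projection to \<open>H i\<close>: then \<open>G / K i\<close> embeds in \<open>H i\<close>, the set of all \<open>K i\<close> is directed under
  reverse inclusion, and by compactness \<open>G\<close> is the inverse limit of the \<open>G / K i\<close>. So index
  sets of subsets of \<open>G\<close> suffice.
\<close>

definition inverse_limit_of_finite ::
    "(nat monoid \<Rightarrow> bool) \<Rightarrow> ('a, 'b) monoid_scheme \<Rightarrow> 'a topology \<Rightarrow> bool" where
  "inverse_limit_of_finite P G T \<longleftrightarrow>
     topological_group G T \<and>
     (\<exists>(I :: 'a set set) R (H :: 'a set \<Rightarrow> nat monoid) \<phi>.
        inverse_system I R H \<phi> \<and>
        (\<forall>i\<in>I. finite (carrier (H i)) \<and> P (H i)) \<and>
        (\<exists>f. f \<in> iso G (inverse_limit I R H \<phi>) \<and>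
             homeomorphic_map T (inverse_limit_topology I R H \<phi>) f))"

primrec lower_central_series :: "('a, 'b) monoid_scheme \<Rightarrow> nat \<Rightarrow> 'a set" where
  "lower_central_series G 0 = carrier G"
| "lower_central_series G (Suc n) =
     generate G (\<Union>x \<in> lower_central_series G n. \<Union>y \<in> carrier G.
       {x \<otimes>\<^bsub>G\<^esub> y \<otimes>\<^bsub>G\<^esub> inv\<^bsub>G\<^esub> x \<otimes>\<^bsub>G\<^esub> inv\<^bsub>G\<^esub> y})"

definition nilpotent_group :: "('a, 'b) monoid_scheme \<Rightarrow> bool" where
  "nilpotent_group G \<longleftrightarrow> (\<exists>n. lower_central_series G n = {\<one>\<^bsub>G\<^esub>})"

definition prosoluble :: "('a, 'b) monoid_scheme \<Rightarrow> 'a topology \<Rightarrow> bool" where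
  "prosoluble G T \<longleftrightarrow> inverse_limit_of_finite solvable G T"

definition pronilpotent :: "('a, 'b) monoid_scheme \<Rightarrow> 'a topology \<Rightarrow> bool" where
  "pronilpotent G T \<longleftrightarrow> inverse_limit_of_finite nilpotent_group G T"


section \<open>Polynomial index growth\<close>

definition power_subgroup :: "('a, 'b) monoid_scheme \<Rightarrow> nat \<Rightarrow> 'a set" where
  "power_subgroup Q n = generate Q {x [^]\<^bsub>Q\<^esub> n | x. x \<in> carrier Q}"

text \<open>
  The continuous finite quotients of \<open>G\<close> are the finite \<open>G / K\<close> with \<open>K\<close> an open normal subgroup.
  The exponent \<open>n\<close> is positive: for \<open>n = 0\<close> the bound would be
  \<open>card Q \<le> 0 powr \<alpha> = 0\<close>.
\<close>

definition has_PIG :: "('a, 'b) monoid_scheme \<Rightarrow> 'a topology \<Rightarrow> bool" where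
  "has_PIG G T \<longleftrightarrow>
     (\<exists>\<alpha>::real. \<forall>K. K \<lhd> G \<longrightarrow> openin T K \<longrightarrow> finite (carrier (G Mod K)) \<longrightarrow>
        (\<forall>n\<ge>1. real (card (carrier ((G Mod K) Mod power_subgroup (G Mod K) n))) \<le> real n powr \<alpha>))"


section \<open>Rank\<close>

text \<open>
  Infinite values of \<open>d(H)\<close> are not distinguished: they are all \<open>\<infinity>\<close>, the infimum of the empty set.
\<close>

definition top_gen_number :: "('a, 'b) monoid_scheme \<Rightarrow> 'a topology \<Rightarrow> 'a set \<Rightarrow> enat" where
  "top_gen_number G T H =
     (INF X \<in> {X. finite X \<and> X \<subseteq> H \<and> (subtopology T H) closure_of (generate G X) = H}. enat (card X))"

definition profinite_rank :: "('a, 'b) monoid_scheme \<Rightarrow> 'a topology \<Rightarrow> enat" where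
  "profinite_rank G T =
     (SUP H \<in> {H. subgroup H G \<and> closedin T H \<and> top_gen_number G T H < \<infinity>}. top_gen_number G T H)"

end

theory Submission
  imports Defs "HOL-Algebra.Sylow" "HOL-Algebra.Multiplicative_Group" "HOL-Number_Theory.Cong"
begin

text \<open>
  Dividing out an open normal subgroup leaves a finite soluble group \<open>Q\<close> whose order is at most
  \<open>n ^ a\<close> times that of its subgroup \<open>Q ^ n\<close> generated by the \<open>n\<close>-th powers, for all \<open>n\<close>, and a
  nilpotent normal subgroup \<open>M\<close> such that every subgroup of \<open>Q\<close> is contained in the group generated
  by \<open>r\<close> of its elements and the derived group \<open>M'\<close>. The point is to bound the number of generators
  of the subgroups of \<open>Q\<close> in terms of \<open>a\<close> and \<open>r\<close> alone (\<open>solvable_PIG_pair_rank\<close>). By compactness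
  such a bound passes to topological generators of the closed subgroups (\<open>profinite_rank_le\<close>).

  As every subgroup is generated by \<open>r\<close> elements modulo \<open>M\<close>, only subgroups of \<open>M\<close> matter. These are
  products of groups of prime power order, and generators for different primes can be multiplied
  together (\<open>coprime_commuting_generators\<close>). So fix a prime \<open>p\<close>, and divide out the largest normal
  subgroup of order prime to \<open>p\<close>. Then \<open>M\<close> is a \<open>p\<close>-group, contained in a largest normal \<open>p\<close>-subgroup
  \<open>F\<close>. Since \<open>M'\<close> lies in the Frattini subgroup \<open>\<Phi>\<close> of \<open>F\<close>, the group \<open>F\<close> is generated by \<open>r\<close> elements
  and \<open>F / \<Phi>\<close> has order at most \<open>p ^ r\<close>. As \<open>Q\<close> is soluble and has no nontrivial
  normal subgroup of order prime to \<open>p\<close> left, only the elements of \<open>F\<close> act trivially on \<open>F / \<Phi>\<close>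
  (\<open>solvable_frattini_centralizer_le\<close>). So the index of \<open>F\<close> in \<open>Q\<close> is at most \<open>p ^ (r * r)\<close>,
  and the growth hypothesis for \<open>Q\<close> shows that the index of \<open>F ^ (p ^ k)\<close> in \<open>F\<close> is at most
  \<open>p ^ ((r * r + k) * a)\<close> (\<open>normal_subgroup_power_index\<close>).

  It remains to see that a \<open>p\<close>-group \<open>F\<close> with such indices has bounded rank (\<open>p_group_rank_le\<close>). Put
  \<open>F\<^sub>k = F ^ (p ^ k)\<close>. The exponent \<open>(r * r + k) * a\<close> grows linearly in \<open>k\<close>, so from some \<open>k\<close> on, which does
  not depend on \<open>p\<close>, it is below \<open>p ^ k\<close>. Then commutators with a fixed element \<open>x\<close> vanish modulo
  \<open>F\<^sub>k\<^sub>+\<^sub>3\<close> after at most \<open>p ^ k\<close> iterations, and expanding the conjugation by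
  \<open>x [^] (p ^ (k + 1))\<close> with the binomial theorem shows that \<open>F\<^sub>k\<^sub>+\<^sub>1\<close> is abelian modulo \<open>F\<^sub>k\<^sub>+\<^sub>3\<close>
  (\<open>derived_power_subgroup_le\<close>). As in powerful \<open>p\<close>-groups, the \<open>p\<close>-th power map therefore is a
  surjective homomorphism from each \<open>F\<^sub>j / F\<^sub>j\<^sub>+\<^sub>1\<close> with \<open>j > k\<close> to \<open>F\<^sub>j\<^sub>+\<^sub>1 / F\<^sub>j\<^sub>+\<^sub>2\<close>. Counting along this chain
  bounds the index of the Frattini subgroup in a subgroup of \<open>F\<^sub>k\<^sub>+\<^sub>1\<close> by the index of
  \<open>F\<^sub>k\<^sub>+\<^sub>2\<close> in \<open>F\<^sub>k\<^sub>+\<^sub>1\<close> (\<open>power_chain_count\<close>), and the number of generators is at most the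
  logarithm of the index of the Frattini subgroup to base \<open>p\<close>.
\<close>

section \<open>Finite \<open>p\<close>-groups\<close>

definition p_subgroup :: "('a, 'b) monoid_scheme \<Rightarrow> nat \<Rightarrow> 'a set \<Rightarrow> bool" where
  "p_subgroup G p H \<longleftrightarrow> prime p \<and> subgroup H G \<and> (\<exists>n. card H = p ^ n)"

context group begin

lemma inv_cancel_left [simp]:
  assumes "x \<in> carrier G" "y \<in> carrier G"
  shows "x \<otimes> (inv x \<otimes> y) = y" "inv x \<otimes> (x \<otimes> y) = y"
  using assms by (simp_all flip: m_assoc)

lemma card_subgroup_dvd:
  assumes "subgroup B G" "subgroup H G" "B \<subseteq> H"
  shows "card B dvd card H"
proof -
  have "subgroup B (G\<lparr>carrier := H\<rparr>)" using assms subgroup_incl by blast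
  then have "card (rcosets\<^bsub>G\<lparr>carrier := H\<rparr>\<^esub> B) * card B = order (G\<lparr>carrier := H\<rparr>)"
    using group.lagrange subgroup_imp_group[OF assms(2)] by blast
  then have "card H = card (rcosets\<^bsub>G\<lparr>carrier := H\<rparr>\<^esub> B) * card B"
    by (simp add: order_def)
  then show ?thesis by simp
qed

lemma pow_card_subgroup:
  assumes "subgroup H G" "x \<in> H"
  shows "x [^] card H = \<one>"
proof -
  interpret H: group "G\<lparr>carrier := H\<rparr>" using assms(1) by (rule subgroup_imp_group)
  have "x [^]\<^bsub>G\<lparr>carrier := H\<rparr>\<^esub> order (G\<lparr>carrier := H\<rparr>) = \<one>"
    using H.pow_order_eq_1[of x] assms by simp
  then show ?thesis by (simp add: order_def flip: nat_pow_consistent)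
qed

lemma generate_subgroup_eq: "subgroup H G \<Longrightarrow> generate G H = H"
  using generate_subgroup_incl[of H H] by (auto intro: generate.incl)

lemma subgroup_pow_closed: "subgroup H G \<Longrightarrow> x \<in> H \<Longrightarrow> x [^] (n::nat) \<in> H"
  by (induction n) (auto simp: subgroup.one_closed subgroup.m_closed)

lemma conj_pow:
  assumes "x \<in> carrier G" "g \<in> carrier G"
  shows "(g \<otimes> x \<otimes> inv g) [^] (n::nat) = g \<otimes> x [^] n \<otimes> inv g"
  using assms by (induction n) (simp_all add: m_assoc)

lemma pow_coprime_one:
  assumes "x \<in> carrier G" "x [^] (m::nat) = \<one>" "x [^] (n::nat) = \<one>" "coprime m n"
  shows "x = \<one>"
  using assms by (metis coprime_iff_gcd_eq_1 gcd_greatest nat_dvd_1_iff_1 ord_eq_1 pow_eq_id coprime_common_divisor_nat)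

lemma p_subgroupD:
  assumes "p_subgroup G p H"
  shows "prime p" "subgroup H G" "finite H" "H \<subseteq> carrier G" "card H > 0"
proof -
  show "prime p" "subgroup H G" "H \<subseteq> carrier G"
    using assms by (auto simp: p_subgroup_def subgroup.subset)
  show "card H > 0"
    using assms by (auto simp: p_subgroup_def prime_gt_0_nat)
  then show "finite H" by (simp add: card_gt_0_iff)
qed

lemma p_subgroup_mono:
  assumes "p_subgroup G p H" "subgroup B G" "B \<subseteq> H"
  shows "p_subgroup G p B"
  using assms card_subgroup_dvd[OF assms(2) _ assms(3)] divides_primepow_nat
  unfolding p_subgroup_def by metis

lemma p_subgroup_elem:
  assumes "p_subgroup G p H" "x \<in> H"
  obtains n where "x [^] (p ^ n :: nat) = \<one>"
  using assms pow_card_subgroup unfolding p_subgroup_def by metis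

text \<open>The orbits of a \<open>p\<close>-group that are not single points have size divisible by \<open>p\<close>.\<close>

lemma p_subgroup_fixed_points:
  fixes act :: "'a \<Rightarrow> 'c \<Rightarrow> 'c"
  assumes H: "p_subgroup G p H" and "finite E"
    and closed: "\<And>g x. g \<in> H \<Longrightarrow> x \<in> E \<Longrightarrow> act g x \<in> E"
    and one: "\<And>x. x \<in> E \<Longrightarrow> act \<one> x = x"
    and mult: "\<And>g h x. g \<in> H \<Longrightarrow> h \<in> H \<Longrightarrow> x \<in> E \<Longrightarrow> act (g \<otimes> h) x = act g (act h x)"
  shows "card {x \<in> E. \<forall>g\<in>H. act g x = x} mod p = card E mod p"
  using assms(2) closed one mult
proof (induction "card E" arbitrary: E rule: less_induct)
  case (less E)
  note HD = p_subgroupD[OF H]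
  let ?fix = "\<lambda>E. {x \<in> E. \<forall>g\<in>H. act g x = x}"
  show ?case
  proof (cases "\<exists>x\<in>E. \<exists>g\<in>H. act g x \<noteq> x")
    case False
    then have "?fix E = E" by auto
    then show ?thesis by simp
  next
    case True
    then obtain x where x: "x \<in> E" "\<exists>g\<in>H. act g x \<noteq> x" by blast
    define Orb where "Orb = (\<lambda>g. act g x) ` H"
    define S where "S = {g \<in> H. act g x = x}"
    have inv_act: "act (inv g) (act g y) = y" if "g \<in> H" "y \<in> E" for g y
      using that less.prems(4)[of "inv g" g y] less.prems(3) HD(2,4)
      by (metis l_inv subgroup.m_inv_closed subgroup.mem_carrier)
    have inv_act': "act g (act (inv g) y) = y" if "g \<in> H" "y \<in> E" for g y
      using inv_act[of "inv g" y] that HD(2,4)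
      by (metis inv_inv subgroup.m_inv_closed subgroup.mem_carrier)
    have S: "subgroup S G"
    proof (rule subgroupI)
      show "S \<subseteq> carrier G" using HD(4) by (auto simp: S_def)
      show "S \<noteq> {}" using HD(2) subgroup.one_closed less.prems(3) x unfolding S_def by blast
      show "inv a \<in> S" if "a \<in> S" for a
        using that inv_act[of a x] x(1) subgroup.m_inv_closed[OF HD(2)] unfolding S_def by force
      show "a \<otimes> b \<in> S" if "a \<in> S" "b \<in> S" for a b
        using that less.prems(4)[of a b x] x(1) subgroup.m_closed[OF HD(2)] unfolding S_def by force
    qed
    have SH: "S \<subseteq> H" "S \<noteq> H" using x by (auto simp: S_def)
    have "card H = card Orb * card S"
    proof -
      have fib: "card {g \<in> H. act g x = y} = card S" if yO: "y \<in> Orb" for y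
      proof -
        obtain k where k: "k \<in> H" "y = act k x" using yO by (auto simp: Orb_def)
        have "bij_betw (\<lambda>s. k \<otimes> s) S {g \<in> H. act g x = y}"
        proof (rule bij_betwI[where g="\<lambda>g. inv k \<otimes> g"])
          show "(\<lambda>s. k \<otimes> s) \<in> S \<rightarrow> {g \<in> H. act g x = y}"
            using k x(1) less.prems(4) subgroup.m_closed[OF HD(2)] by (auto simp: S_def)
          show "(\<lambda>g. inv k \<otimes> g) \<in> {g \<in> H. act g x = y} \<rightarrow> S"
            using k x(1) less.prems(4)[OF subgroup.m_inv_closed[OF HD(2)]] subgroup.m_closed[OF HD(2)] subgroup.m_inv_closed[OF HD(2)]
            by (auto simp: S_def inv_act)
          show "inv k \<otimes> (k \<otimes> s) = s" if "s \<in> S" for s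
            using that k HD(4) SH by (simp add: subset_iff)
          show "k \<otimes> (inv k \<otimes> s) = s" if "s \<in> {g \<in> H. act g x = y}" for s
            using that k HD(4) by (simp add: subset_iff)
        qed
        then show ?thesis by (simp add: bij_betw_same_card)
      qed
      have "card H = (\<Sum>y\<in>Orb. card {g \<in> H. act g x = y})"
        using sum.group[of H Orb "\<lambda>g. act g x" "\<lambda>_. 1::nat"] HD(3) by (simp add: Orb_def)
      then show ?thesis using fib by simp
    qed
    moreover have "card S < card H" using HD(3) SH by (intro psubset_card_mono) auto
    ultimately have "card Orb dvd card H" "card Orb \<noteq> 1" by auto
    then obtain j where "card Orb = p ^ j" "j \<noteq> 0"
      using H divides_primepow_nat[OF HD(1)] unfolding p_subgroup_def by (metis power_0)
    then have "p dvd card Orb" by simp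
    have OE: "Orb \<subseteq> E" using less.prems(2) x(1) by (auto simp: Orb_def)
    have xO: "x \<in> Orb"
      using less.prems(3)[OF x(1)] HD(2) unfolding Orb_def by (metis image_eqI subgroup.one_closed)
    have stable: "act g y \<in> E - Orb" if g: "g \<in> H" and y: "y \<in> E - Orb" for g y
    proof -
      have "act g y \<notin> Orb"
      proof
        assume "act g y \<in> Orb"
        then obtain k where k: "k \<in> H" "act g y = act k x" by (auto simp: Orb_def)
        then have "y = act (inv g \<otimes> k) x"
          using g y inv_act[of g y] less.prems(4)[of "inv g" k x] x(1) subgroup.m_inv_closed[OF HD(2)] by simp
        then have "y \<in> Orb"
          using g k subgroup.m_closed[OF HD(2)] subgroup.m_inv_closed[OF HD(2)] unfolding Orb_def by blast
        then show False using y by blast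
      qed
      then show ?thesis using less.prems(2) g y by blast
    qed
    have "?fix E = ?fix (E - Orb)"
    proof -
      have "y \<notin> Orb" if y: "y \<in> ?fix E" for y
      proof
        assume "y \<in> Orb"
        then obtain k where k: "k \<in> H" "y = act k x" by (auto simp: Orb_def)
        then have "y = x" using inv_act[of k x] x(1) y subgroup.m_inv_closed[OF HD(2), of k] by auto
        then show False using x y by blast
      qed
      then show ?thesis by blast
    qed
    moreover have "card (?fix (E - Orb)) mod p = card (E - Orb) mod p"
    proof (rule less.hyps)
      show "card (E - Orb) < card E" using less.prems(1) xO x(1) by (intro psubset_card_mono) auto
    qed (use less.prems stable in auto)
    moreover have "card E = card (E - Orb) + card Orb"
      using OE less.prems(1) by (metis card_Diff_subset card_mono finite_subset le_add_diff_inverse2)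
    ultimately show ?thesis using \<open>p dvd card Orb\<close> by auto
  qed
qed

corollary p_subgroup_second_fixed_point:
  fixes act :: "'a \<Rightarrow> 'c \<Rightarrow> 'c"
  assumes H: "p_subgroup G p H" and "finite E"
    and "\<And>g x. g \<in> H \<Longrightarrow> x \<in> E \<Longrightarrow> act g x \<in> E"
    and "\<And>x. x \<in> E \<Longrightarrow> act \<one> x = x"
    and "\<And>g h x. g \<in> H \<Longrightarrow> h \<in> H \<Longrightarrow> x \<in> E \<Longrightarrow> act (g \<otimes> h) x = act g (act h x)"
    and pE: "p dvd card E" and e: "e \<in> E" "\<And>g. g \<in> H \<Longrightarrow> act g e = e"
  obtains x where "x \<in> E" "x \<noteq> e" "\<And>g. g \<in> H \<Longrightarrow> act g x = x"
proof -
  let ?F = "{x \<in> E. \<forall>g\<in>H. act g x = x}"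
  have "card ?F mod p = card E mod p"
    using assms by (intro p_subgroup_fixed_points)
  then have "p dvd card ?F" using pE by (simp add: dvd_eq_mod_eq_0)
  moreover have "p \<noteq> 1" using p_subgroupD(1)[OF H] by auto
  ultimately have "card ?F \<noteq> 1" by auto
  then have "?F \<noteq> {e}" by (metis is_singletonI is_singleton_altdef)
  moreover have "e \<in> ?F" using e by blast
  ultimately obtain x where "x \<in> ?F" "x \<noteq> e" by blast
  then show ?thesis using that by blast
qed

lemma p_subgroup_card_step:
  assumes "p_subgroup G p H" "subgroup B G" "B \<subset> H"
  shows "p * card B dvd card H"
proof -
  note HD = p_subgroupD[OF assms(1)]
  obtain n m where nm: "card H = p ^ n" "card B = p ^ m"
    using assms p_subgroup_mono[OF assms(1,2)] unfolding p_subgroup_def by blast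
  have "card B < card H" using assms(3) HD(3) by (rule psubset_card_mono[rotated])
  then have "m < n" using nm prime_gt_1_nat[OF HD(1)] by simp
  then have "p ^ Suc m dvd p ^ n" by (intro le_imp_power_dvd) simp
  then show ?thesis using nm by simp
qed

text \<open>A proper subgroup of a \<open>p\<close>-group is smaller than its normalizer: it acts on its cosets,
  whose number is divisible by \<open>p\<close>, and fixes the trivial coset, hence also another one.\<close>

lemma p_subgroup_normalizer:
  assumes H: "p_subgroup G p H" and B: "subgroup B G" "B \<subset> H"
  obtains h where "h \<in> H - B" "\<And>b. b \<in> B \<Longrightarrow> h \<otimes> b \<otimes> inv h \<in> B"
proof -
  note HD = p_subgroupD[OF H]
  have pB: "p_subgroup G p B" using p_subgroup_mono[OF H B(1)] B(2) by blast
  define E where "E = (\<lambda>h. B #> h) ` H"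
  have BG: "B \<subseteq> carrier G" using B(1) by (rule subgroup.subset)
  have EG: "x \<subseteq> carrier G" if "x \<in> E" for x
    using that BG HD(4) by (auto simp: E_def r_coset_def)
  have finE: "finite E" using HD(3) by (simp add: E_def)
  have "card E * card B = card H"
  proof -
    have "subgroup B (G\<lparr>carrier := H\<rparr>)" using B HD(2) subgroup_incl by blast
    then have "card (rcosets\<^bsub>G\<lparr>carrier := H\<rparr>\<^esub> B) * card B = order (G\<lparr>carrier := H\<rparr>)"
      using group.lagrange subgroup_imp_group[OF HD(2)] by blast
    moreover have "rcosets\<^bsub>G\<lparr>carrier := H\<rparr>\<^esub> B = E" by (auto simp: RCOSETS_def E_def)
    ultimately show ?thesis by (simp add: order_def)
  qed
  then have "p dvd card E"
    using p_subgroup_card_step[OF H B] p_subgroupD(5)[OF pB] by (metis dvd_times_right_cancel_iff less_not_refl)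
  obtain C where C: "C \<in> E" "C \<noteq> B" "\<And>g. g \<in> B \<Longrightarrow> C #> inv g = C"
  proof (rule p_subgroup_second_fixed_point[OF pB finE, of "\<lambda>g C. C #> inv g" B])
    fix g x assume gx: "g \<in> B" "x \<in> E"
    then obtain h where h: "h \<in> H" "x = B #> h" by (auto simp: E_def)
    have "x #> inv g = B #> (h \<otimes> inv g)" using h gx BG HD(4) by (simp add: coset_mult_assoc subset_iff)
    moreover have "h \<otimes> inv g \<in> H" using gx h B HD(2) subgroup.m_closed subgroup.m_inv_closed by (metis psubsetD)
    ultimately show "x #> inv g \<in> E" by (auto simp: E_def)
  next
    fix x assume "x \<in> E"
    then show "x #> inv \<one> = x" using EG by simp
  next
    fix g h x assume "g \<in> B" "h \<in> B" "x \<in> E"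
    then show "x #> inv (g \<otimes> h) = x #> inv h #> inv g"
      using BG EG[of x] by (simp add: inv_mult_group coset_mult_assoc subset_iff)
  next
    show "p dvd card E" by fact
  next
    have "B #> \<one> \<in> E" using HD(2) unfolding E_def by (metis image_eqI subgroup.one_closed)
    then show "B \<in> E" using BG by simp
    show "B #> inv g = B" if "g \<in> B" for g
      using coset_join2[of "inv g" B] that B(1) BG subgroup.m_inv_closed[OF B(1)] by blast
  qed blast
  then obtain h where h: "h \<in> H" "C = B #> h" by (auto simp: E_def)
  have hG: "h \<in> carrier G" using h HD(4) by blast
  have hB: "h \<notin> B" using C h coset_join2[OF hG B(1)] by blast
  have "h \<otimes> b \<otimes> inv h \<in> B" if b: "b \<in> B" for b
  proof -
    have "C #> inv (inv b) = C" using C(3) subgroup.m_inv_closed[OF B(1) b] by blast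
    then have "B #> (h \<otimes> b) = B #> h" using h b BG hG by (simp add: coset_mult_assoc subset_iff)
    then have "h \<otimes> b \<in> B #> h" using rcos_self[of "h \<otimes> b" B] B(1) b BG hG by auto
    then obtain c where "c \<in> B" "h \<otimes> b = c \<otimes> h" by (auto simp: r_coset_def)
    then show ?thesis using hG BG b by (metis inv_solve_right m_closed subsetD)
  qed
  then show ?thesis using that h hB by blast
qed

text \<open>\<open>H\<close> acts on \<open>N\<close> by conjugation and fixes \<open>\<one>\<close>, hence also another element.\<close>

lemma p_subgroup_central_element:
  assumes H: "p_subgroup G p H" and N: "subgroup N G" "finite N" "p dvd card N"
    and conj: "\<And>h x. h \<in> H \<Longrightarrow> x \<in> N \<Longrightarrow> h \<otimes> x \<otimes> inv h \<in> N"
  obtains z where "z \<in> N" "z \<noteq> \<one>" "\<And>h. h \<in> H \<Longrightarrow> h \<otimes> z = z \<otimes> h"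
proof -
  note HD = p_subgroupD[OF H]
  have NG: "N \<subseteq> carrier G" using N(1) by (rule subgroup.subset)
  obtain z where z: "z \<in> N" "z \<noteq> \<one>" "\<And>h. h \<in> H \<Longrightarrow> h \<otimes> z \<otimes> inv h = z"
  proof (rule p_subgroup_second_fixed_point[OF H N(2), of "\<lambda>h x. h \<otimes> x \<otimes> inv h" \<one>])
    show "g \<otimes> h \<otimes> x \<otimes> inv (g \<otimes> h) = g \<otimes> (h \<otimes> x \<otimes> inv h) \<otimes> inv g" if "g \<in> H" "h \<in> H" "x \<in> N" for g h x
      using that NG HD(4) by (simp add: subset_iff m_assoc inv_mult_group)
    show "\<one> \<in> N" using N(1) by (rule subgroup.one_closed)
    show "g \<otimes> \<one> \<otimes> inv g = \<one>" if "g \<in> H" for g using that HD(4) by (simp add: subset_iff)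
    show "\<one> \<otimes> x \<otimes> inv \<one> = x" if "x \<in> N" for x using that NG by (simp add: subset_iff)
  qed (use conj N in blast)+
  have "h \<otimes> z = z \<otimes> h" if "h \<in> H" for h
    using z(1) z(3)[OF that] that NG HD(4) by (metis inv_solve_right' m_closed subsetD)
  then show ?thesis using z(1,2) that by blast
qed

text \<open>Every subgroup of a \<open>p\<close>-group is completed by few generators: each new one multiplies
  the order by at least \<open>p\<close>.\<close>

lemma p_subgroup_complete_generators:
  assumes H: "p_subgroup G p H" and B: "subgroup B G" "B \<subseteq> H"
  shows "\<exists>X. X \<subseteq> H \<and> finite X \<and> generate G (B \<union> X) = H \<and> p ^ card X * card B \<le> card H"
  using B
proof (induction "card H - card B" arbitrary: B rule: less_induct)
  case (less B)
  note HD = p_subgroupD[OF H]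
  show ?case
  proof (cases "B = H")
    case True
    then have "generate G (B \<union> {}) = H" using generate_subgroup_eq[OF HD(2)] by simp
    then show ?thesis using True by (intro exI[of _ "{}"]) auto
  next
    case False
    then obtain x where x: "x \<in> H" "x \<notin> B" using less.prems by blast
    define C where "C = generate G (insert x B)"
    have xB: "insert x B \<subseteq> H" using x less.prems by blast
    have C: "subgroup C G" "C \<subseteq> H" "B \<subset> C"
      using generate_is_subgroup[of "insert x B"] xB HD(4) generate_subgroup_incl[OF xB HD(2)] x generate.incl[of _ "insert x B" G]
      unfolding C_def by blast+
    have pC: "p_subgroup G p C" using p_subgroup_mono[OF H C(1,2)] .
    have step: "p * card B \<le> card C"
      using p_subgroup_card_step[OF pC less.prems(1) C(3)] p_subgroupD(5)[OF pC] by (rule dvd_imp_le)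
    have "card B < card C" using psubset_card_mono[OF p_subgroupD(3)[OF pC] C(3)] .
    moreover have "card C \<le> card H" using C(2) HD(3) card_mono by blast
    ultimately have "card H - card C < card H - card B" by linarith
    then obtain X where X: "X \<subseteq> H" "finite X" "generate G (C \<union> X) = H" "p ^ card X * card C \<le> card H"
      using less.hyps[OF _ C(1,2)] by blast
    have "generate G (B \<union> insert x X) = H"
    proof
      show "generate G (B \<union> insert x X) \<subseteq> H"
        using xB X(1) by (intro generate_subgroup_incl HD(2)) auto
      have sub: "subgroup (generate G (B \<union> insert x X)) G" using xB X(1) HD(4) by (intro generate_is_subgroup) auto
      have "C \<subseteq> generate G (B \<union> insert x X)" unfolding C_def by (rule mono_generate) auto
      moreover have "X \<subseteq> generate G (B \<union> insert x X)" by (auto intro: generate.incl)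
      ultimately show "H \<subseteq> generate G (B \<union> insert x X)"
        unfolding X(3)[symmetric] by (intro generate_subgroup_incl sub) auto
    qed
    moreover have "p ^ card (insert x X) * card B \<le> card H"
    proof -
      have "p ^ card (insert x X) \<le> p ^ Suc (card X)"
        using prime_gt_0_nat[OF HD(1)] by (intro power_increasing) (auto simp: card_insert_if X(2))
      then have "p ^ card (insert x X) * card B \<le> p ^ card X * (p * card B)"
        using mult_le_mono1[of _ _ "card B"] by (simp add: mult.assoc mult.left_commute)
      also have "\<dots> \<le> p ^ card X * card C" using step by (rule mult_le_mono2)
      finally show ?thesis using X(4) by simp
    qed
    ultimately show ?thesis using X x by (intro exI[of _ "insert x X"]) auto
  qed
qed

end

section \<open>The Frattini subgroup of a \<open>p\<close>-group\<close>

text \<open>On a finite \<open>p\<close>-group this is the Frattini subgroup, the intersection of all maximal subgroups.\<close>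

definition p_frattini :: "('a, 'b) monoid_scheme \<Rightarrow> nat \<Rightarrow> 'a set \<Rightarrow> 'a set" where
  "p_frattini G p H = generate G ({x [^]\<^bsub>G\<^esub> p | x. x \<in> H} \<union> derived_set G H)"

context group begin

lemma p_frattini_subset:
  assumes "subgroup H G"
  shows "p_frattini G p H \<subseteq> H"
  unfolding p_frattini_def
  using derived_set_incl[OF subset_refl assms] subgroup_pow_closed[OF assms]
  by (intro generate_subgroup_incl assms) auto

lemma p_frattini_subgroup:
  assumes "subgroup H G"
  shows "subgroup (p_frattini G p H) G"
  unfolding p_frattini_def
  using derived_set_incl[OF subset_refl assms] subgroup_pow_closed[OF assms] subgroup.subset[OF assms]
  by (intro generate_is_subgroup) blast

lemma normalized_times_power_mult:
  assumes U: "subgroup U G" and x: "x \<in> carrier G"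
    and conj: "\<And>u. u \<in> U \<Longrightarrow> x \<otimes> u \<otimes> inv x \<in> U"
    and uv: "u \<in> U" "v \<in> U"
  obtains w where "w \<in> U" "(u \<otimes> x [^] (k::nat)) \<otimes> (v \<otimes> x [^] (l::nat)) = w \<otimes> x [^] (k + l)"
proof -
  have UG: "u \<in> carrier G" if "u \<in> U" for u using U that by (rule subgroup.mem_carrier)
  have "x [^] k \<otimes> v \<otimes> inv (x [^] k) \<in> U"
    using uv(2)
  proof (induction k arbitrary: v)
    case (Suc k)
    have "x [^] Suc k \<otimes> v \<otimes> inv (x [^] Suc k) = x [^] k \<otimes> (x \<otimes> v \<otimes> inv x) \<otimes> inv (x [^] k)"
      using x Suc.prems UG by (simp add: m_assoc inv_mult_group)
    then show ?case using Suc conj by simp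
  qed (use UG in auto)
  then have "u \<otimes> (x [^] k \<otimes> v \<otimes> inv (x [^] k)) \<in> U" using uv U by (simp add: subgroup.m_closed)
  moreover have "(u \<otimes> x [^] k) \<otimes> (v \<otimes> x [^] l) = u \<otimes> (x [^] k \<otimes> v \<otimes> inv (x [^] k)) \<otimes> x [^] (k + l)"
    using uv x UG by (simp add: m_assoc flip: nat_pow_mult)
  ultimately show ?thesis using that by blast
qed

text \<open>Natural exponents suffice: in a finite group inverses are powers.\<close>

lemma subgroup_normalized_times_powers:
  assumes U: "subgroup U G" "finite (carrier G)" and x: "x \<in> carrier G"
    and conj: "\<And>u. u \<in> U \<Longrightarrow> x \<otimes> u \<otimes> inv x \<in> U"
  shows "subgroup {u \<otimes> x [^] (k::nat) | u k. u \<in> U} G" (is "subgroup ?V G")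
proof -
  have UG: "U \<subseteq> carrier G" using U(1) by (rule subgroup.subset)
  have closed: "v \<otimes> w \<in> ?V" if "v \<in> ?V" "w \<in> ?V" for v w
  proof -
    from that obtain u k u' l where *: "v = u \<otimes> x [^] (k::nat)" "w = u' \<otimes> x [^] (l::nat)" "u \<in> U" "u' \<in> U" by blast
    then show ?thesis using normalized_times_power_mult[OF U(1) x conj *(3,4), of k l] by blast
  qed
  have sub: "?V \<subseteq> carrier G" using UG x by auto
  have "\<one> \<otimes> x [^] (0::nat) \<in> ?V" using subgroup.one_closed[OF U(1)] by blast
  then have one: "\<one> \<in> ?V" using x by simp
  have pow: "v [^] (n::nat) \<in> ?V" if "v \<in> ?V" for v n
  proof (induction n)
    case 0
    show ?case using one by (simp only: nat_pow_0)
  next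
    case (Suc n)
    then show ?case using closed[OF Suc that] by (simp only: nat_pow_Suc)
  qed
  show ?thesis
  proof (rule subgroupI[OF sub])
    show "?V \<noteq> {}" using one by blast
    show "inv a \<in> ?V" if a: "a \<in> ?V" for a
    proof -
      have aG: "a \<in> carrier G" using a sub by blast
      have "order G > 0" using U(2) by (simp add: order_gt_0_iff_finite)
      then have "a [^] (order G - 1) \<otimes> a = \<one>"
        using pow_order_eq_1[OF aG] nat_pow_Suc[of a "order G - 1"] by simp
      then have "inv a = a [^] (order G - 1)"
        using aG by (intro inv_equality) auto
      show ?thesis unfolding \<open>inv a = _\<close> by (rule pow[OF a])
    qed
    show "a \<otimes> b \<in> ?V" if "a \<in> ?V" "b \<in> ?V" for a b using closed that .
  qed
qed

text \<open>A maximal subgroup \<open>U\<close> of a \<open>p\<close>-group is normalized by some \<open>x \<notin> U\<close>, and a suitable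
  power of \<open>x\<close> even has \<open>x [^] p \<in> U\<close>. By maximality all elements have the form
  \<open>u \<otimes> x [^] k\<close> with \<open>u \<in> U\<close>, and such elements multiply modulo \<open>U\<close> like the powers of \<open>x\<close>.
  So \<open>U\<close> contains all \<open>p\<close>-th powers and all commutators.\<close>

lemma p_frattini_nongenerators:
  assumes fin: "finite (carrier G)" and H: "p_subgroup G p H" and B: "subgroup B G" "B \<subseteq> H"
    and gen: "H \<subseteq> generate G (B \<union> p_frattini G p H)"
  shows "B = H"
proof (rule ccontr)
  assume "B \<noteq> H"
  note HD = p_subgroupD[OF H]
  define \<U> where "\<U> = {U. subgroup U G \<and> B \<subseteq> U \<and> U \<subset> H}"
  have "finite \<U>" using HD(3) by (intro finite_subset[of \<U> "Pow H"]) (auto simp: \<U>_def)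
  moreover have "B \<in> \<U>" using B \<open>B \<noteq> H\<close> by (auto simp: \<U>_def)
  ultimately obtain U where U: "U \<in> \<U>" and max: "\<And>V. V \<in> \<U> \<Longrightarrow> U \<subseteq> V \<Longrightarrow> U = V"
    using finite_has_maximal[of \<U>] by blast
  have US: "subgroup U G" "B \<subseteq> U" "U \<subseteq> H" "U \<subset> H" using U by (auto simp: \<U>_def)
  have UG: "u \<in> carrier G" if "u \<in> U" for u using US(1) that by (rule subgroup.mem_carrier)
  obtain h where h: "h \<in> H - U" "\<And>u. u \<in> U \<Longrightarrow> h \<otimes> u \<otimes> inv h \<in> U"
    using p_subgroup_normalizer[OF H US(1,4)] by blast
  have hG: "h \<in> carrier G" using h HD(4) by blast
  obtain n where "h [^] (p ^ n) = \<one>" using p_subgroup_elem[OF H, of h] h by blast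
  then have ex: "\<exists>n. h [^] (p ^ n) \<in> U" using subgroup.one_closed[OF US(1)] by metis
  \<comment> \<open>The last power of the form \<open>h [^] (p ^ n)\<close> outside \<open>U\<close> has its \<open>p\<close>-th power in \<open>U\<close>.\<close>
  define j where "j = (LEAST n. h [^] (p ^ n) \<in> U)"
  have j: "h [^] (p ^ j) \<in> U" unfolding j_def using ex by (rule LeastI_ex)
  have "j \<noteq> 0"
  proof
    assume "j = 0"
    then show False using j h(1) hG by simp
  qed
  define x where "x = h [^] (p ^ (j - 1))"
  have xU: "x \<notin> U" using not_less_Least[of "j - 1" "\<lambda>n. h [^] (p ^ n) \<in> U"] \<open>j \<noteq> 0\<close>
    unfolding x_def j_def by simp
  have xp: "x [^] p \<in> U"
  proof -
    have "p ^ (j - 1) * p = p ^ j" using \<open>j \<noteq> 0\<close> by (metis power_minus_mult neq0_conv)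
    then show ?thesis using j hG by (simp add: x_def nat_pow_pow)
  qed
  have xH: "x \<in> H" using h subgroup_pow_closed[OF HD(2)] by (auto simp: x_def)
  have xG: "x \<in> carrier G" using xH HD(4) by blast
  have conj: "x \<otimes> u \<otimes> inv x \<in> U" if "u \<in> U" for u
  proof -
    have "(\<one> \<otimes> h [^] (k::nat)) \<otimes> (u \<otimes> h [^] (0::nat)) \<otimes> inv (h [^] k) \<in> U" for k
      using normalized_times_power_mult[OF US(1) hG h(2) subgroup.one_closed[OF US(1)] that, of k 0]
      by (metis UG add_0_right hG inv_solve_right m_closed nat_pow_closed)
    then show ?thesis using UG that hG by (simp add: x_def)
  qed
  define V where "V = {u \<otimes> x [^] (k::nat) | u k. u \<in> U}"
  have "V = H"
  proof (rule ccontr)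
    assume "V \<noteq> H"
    have "U \<subseteq> V"
    proof
      fix u assume "u \<in> U"
      then have "u \<otimes> x [^] (0::nat) \<in> V" unfolding V_def by blast
      then show "u \<in> V" using UG \<open>u \<in> U\<close> by simp
    qed
    moreover have "V \<subseteq> H"
      unfolding V_def using xH US(3) subgroup_pow_closed[OF HD(2)] subgroup.m_closed[OF HD(2)] by blast
    moreover have "subgroup V G"
      unfolding V_def using US(1) fin xG conj by (rule subgroup_normalized_times_powers)
    ultimately have "V \<in> \<U>" using US(2) \<open>V \<noteq> H\<close> by (auto simp: \<U>_def)
    then have "U = V" using max \<open>U \<subseteq> V\<close> by blast
    moreover have "\<one> \<otimes> x [^] (1::nat) \<in> V" using subgroup.one_closed[OF US(1)] unfolding V_def by blast
    ultimately show False using xU xG by simp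
  qed
  then have form: "\<exists>u\<in>U. \<exists>k::nat. g = u \<otimes> x [^] k" if "g \<in> H" for g
    using that unfolding V_def by blast
  have pU: "g [^] p \<in> U" if g: "g \<in> H" for g
  proof -
    obtain u k where uk: "u \<in> U" "g = u \<otimes> x [^] (k::nat)" using form[OF g] by blast
    have "\<exists>w\<in>U. g [^] n = w \<otimes> x [^] (n * k)" for n :: nat
    proof (induction n)
      case 0
      show ?case using subgroup.one_closed[OF US(1)] by (intro bexI[of _ \<one>]) auto
    next
      case (Suc n)
      then obtain w where "w \<in> U" "g [^] n = w \<otimes> x [^] (n * k)" by blast
      then show ?case
        using normalized_times_power_mult[OF US(1) xG conj \<open>w \<in> U\<close> uk(1), of "n * k" k] uk(2)
        by (metis add.commute mult_Suc nat_pow_Suc)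
    qed
    then obtain w where w: "w \<in> U" "g [^] p = w \<otimes> x [^] (p * k)" by blast
    moreover have "x [^] (p * k) \<in> U" using subgroup_pow_closed[OF US(1) xp, of k] xG by (simp add: nat_pow_pow)
    ultimately show ?thesis using subgroup.m_closed[OF US(1)] by simp
  qed
  have dU: "f \<otimes> g \<otimes> inv f \<otimes> inv g \<in> U" if fg: "f \<in> H" "g \<in> H" for f g
  proof -
    obtain u k where uk: "u \<in> U" "f = u \<otimes> x [^] (k::nat)" using form fg by blast
    obtain v l where vl: "v \<in> U" "g = v \<otimes> x [^] (l::nat)" using form fg by blast
    obtain w where w: "w \<in> U" "f \<otimes> g = w \<otimes> x [^] (k + l)"
      using normalized_times_power_mult[OF US(1) xG conj uk(1) vl(1)] uk(2) vl(2) by metis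
    obtain w' where w': "w' \<in> U" "g \<otimes> f = w' \<otimes> x [^] (l + k)"
      using normalized_times_power_mult[OF US(1) xG conj vl(1) uk(1)] uk(2) vl(2) by metis
    have fgG: "f \<in> carrier G" "g \<in> carrier G" using fg HD(4) by auto
    have "f \<otimes> g \<otimes> inv f \<otimes> inv g = f \<otimes> g \<otimes> inv (g \<otimes> f)"
      using fgG by (simp add: m_assoc inv_mult_group)
    also have "\<dots> = w \<otimes> inv w'"
      using w w' UG xG by (simp add: m_assoc inv_mult_group add.commute)
    finally show ?thesis using w w' US(1) by (simp add: subgroup.m_closed subgroup.m_inv_closed)
  qed
  have "p_frattini G p H \<subseteq> U"
    unfolding p_frattini_def using pU dU by (intro generate_subgroup_incl US(1)) auto
  then have "generate G (B \<union> p_frattini G p H) \<subseteq> U"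
    using US by (intro generate_subgroup_incl) auto
  then show False using gen US(4) by blast
qed

lemma p_frattini_generate_eq:
  assumes fin: "finite (carrier G)" and F: "p_subgroup G p F" and X: "X \<subseteq> F"
    and gen: "F \<subseteq> generate G (X \<union> p_frattini G p F)"
  shows "generate G X = F"
proof (rule p_frattini_nongenerators[OF fin F])
  note FD = p_subgroupD[OF F]
  show "subgroup (generate G X) G" using X FD(4) by (intro generate_is_subgroup) blast
  show "generate G X \<subseteq> F" using X FD(2) by (rule generate_subgroup_incl)
  have "generate G (X \<union> p_frattini G p F) \<subseteq> generate G (generate G X \<union> p_frattini G p F)"
    by (intro mono_generate) (auto intro: generate.incl)
  then show "F \<subseteq> generate G (generate G X \<union> p_frattini G p F)" using gen by blast
qed

corollary p_subgroup_generators_bound: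
  assumes fin: "finite (carrier G)" and H: "p_subgroup G p H"
    and le: "card H \<le> p ^ t * card (p_frattini G p H)"
  shows "\<exists>X. X \<subseteq> H \<and> finite X \<and> card X \<le> t \<and> generate G X = H"
proof -
  note HD = p_subgroupD[OF H]
  obtain X where X: "X \<subseteq> H" "finite X" "generate G (p_frattini G p H \<union> X) = H"
    "p ^ card X * card (p_frattini G p H) \<le> card H"
    using p_subgroup_complete_generators[OF H p_frattini_subgroup[OF HD(2)] p_frattini_subset[OF HD(2)]]
    by blast
  have "card (p_frattini G p H) > 0"
    using p_subgroupD(5)[OF p_subgroup_mono[OF H p_frattini_subgroup[OF HD(2)] p_frattini_subset[OF HD(2)]]] .
  then have "p ^ card X \<le> p ^ t" using X(4) le by (metis le_trans mult_le_cancel2)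
  then have "card X \<le> t" using prime_gt_1_nat[OF HD(1)] by simp
  moreover have "generate G X = H"
    using X(3) by (intro p_frattini_generate_eq[OF fin H X(1)]) (simp add: Un_commute)
  ultimately show ?thesis using X by blast
qed

end

section \<open>Images and quotients\<close>

lemma (in group_hom) card_subgroup_image:
  assumes S: "subgroup S G" "finite S"
  shows "card S = card (h ` S) * card {x \<in> S. h x = \<one>\<^bsub>H\<^esub>}"
proof -
  have SG: "x \<in> carrier G" if "x \<in> S" for x using S(1) that by (rule subgroup.mem_carrier)
  have fib: "card {x \<in> S. h x = y} = card {x \<in> S. h x = \<one>\<^bsub>H\<^esub>}" if y: "y \<in> h ` S" for y
  proof -
    obtain k where k: "k \<in> S" "y = h k" using y by blast
    have "bij_betw (\<lambda>s. k \<otimes> s) {x \<in> S. h x = \<one>\<^bsub>H\<^esub>} {x \<in> S. h x = y}"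
    proof (rule bij_betwI[where g="\<lambda>g. inv k \<otimes> g"])
      show "(\<lambda>s. k \<otimes> s) \<in> {x \<in> S. h x = \<one>\<^bsub>H\<^esub>} \<rightarrow> {x \<in> S. h x = y}"
        using k SG subgroup.m_closed[OF S(1)] by auto
      show "(\<lambda>g. inv k \<otimes> g) \<in> {x \<in> S. h x = y} \<rightarrow> {x \<in> S. h x = \<one>\<^bsub>H\<^esub>}"
        using k SG subgroup.m_closed[OF S(1)] subgroup.m_inv_closed[OF S(1)] by auto
    qed (use k SG in auto)
    then show ?thesis by (simp add: bij_betw_same_card)
  qed
  have "card S = (\<Sum>y\<in>h ` S. card {x \<in> S. h x = y})"
    using sum.group[of S "h ` S" h "\<lambda>_. 1::nat"] S(2) by simp
  then show ?thesis using fib by simp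
qed

lemma (in group_hom) power_subgroup_image:
  assumes "h ` carrier G = carrier H"
  shows "power_subgroup H n = h ` power_subgroup G n"
proof -
  have "{y [^]\<^bsub>H\<^esub> n | y. y \<in> carrier H} = h ` {x [^] n | x. x \<in> carrier G}"
    unfolding assms[symmetric] by (force simp: hom_nat_pow)
  then show ?thesis
    unfolding power_subgroup_def using generate_img[of "{x [^] n | x. x \<in> carrier G}"] by auto
qed

context group begin

lemma quotient_hom: "K \<lhd> G \<Longrightarrow> group_hom G (G Mod K) (\<lambda>x. K #> x)"
  by (intro group_hom.intro group_hom_axioms.intro is_group normal.factorgroup_is_group normal.r_coset_hom_Mod)

lemma quotient_one_iff:
  assumes "K \<lhd> G" "x \<in> carrier G"
  shows "K #> x = K \<longleftrightarrow> x \<in> K"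
  using assms coset_join1[of K x] coset_join2[of x K] normal_imp_subgroup[of K G] subgroup.subset[of K G] by blast

lemma quotient_eq_iff:
  assumes "K \<lhd> G" "x \<in> carrier G" "y \<in> carrier G"
  shows "K #> x = K #> y \<longleftrightarrow> x \<otimes> inv y \<in> K"
proof -
  interpret \<pi>: group_hom G "G Mod K" "\<lambda>x. K #> x" using assms(1) by (rule quotient_hom)
  have "x \<otimes> inv y \<in> K \<longleftrightarrow> K #> (x \<otimes> inv y) = \<one>\<^bsub>G Mod K\<^esub>"
    using quotient_one_iff[OF assms(1), of "x \<otimes> inv y"] assms by simp
  also have "\<dots> \<longleftrightarrow> \<one>\<^bsub>G Mod K\<^esub> = (K #> x) \<otimes>\<^bsub>G Mod K\<^esub> inv\<^bsub>G Mod K\<^esub> (K #> y)"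
    using assms \<pi>.hom_mult[of x "inv y"] \<pi>.hom_inv[of y] by (auto simp del: mult_FactGroup one_FactGroup)
  also have "\<dots> \<longleftrightarrow> K #> x = \<one>\<^bsub>G Mod K\<^esub> \<otimes>\<^bsub>G Mod K\<^esub> (K #> y)"
    using assms by (intro \<pi>.H.inv_solve_right \<pi>.H.one_closed \<pi>.hom_closed)
  also have "\<dots> \<longleftrightarrow> K #> x = K #> y"
    using assms by (subst \<pi>.H.l_one[OF \<pi>.hom_closed]) auto
  finally show ?thesis by simp
qed

lemma card_quotient:
  assumes "K \<lhd> G"
  shows "card (carrier (G Mod K)) * card K = card (carrier G)"
  using lagrange[OF normal_imp_subgroup[OF assms]] by (simp add: FactGroup_def order_def)

lemma quotient_image_carrier: "(\<lambda>x. K #> x) ` carrier G = carrier (G Mod K)"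
  by (simp add: carrier_FactGroup)

lemma card_subgroup_quotient_image:
  assumes "K \<lhd> G" "subgroup S G" "finite S"
  shows "card S = card ((\<lambda>x. K #> x) ` S) * card (S \<inter> K)"
proof -
  interpret \<pi>: group_hom G "G Mod K" "\<lambda>x. K #> x" using assms(1) by (rule quotient_hom)
  have "{x \<in> S. K #> x = \<one>\<^bsub>G Mod K\<^esub>} = S \<inter> K"
    using quotient_one_iff[OF assms(1)] subgroup.mem_carrier[OF assms(2)] by auto
  then show ?thesis using \<pi>.card_subgroup_image[OF assms(2,3)] by simp
qed

text \<open>\<open>(A \<inter> C) / (A \<inter> B)\<close> embeds into \<open>C / B\<close>.\<close>

lemma card_Int_mult_le:
  assumes B: "B \<lhd> G" "B \<subseteq> C" and A: "subgroup A G" and C: "subgroup C G" "finite C"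
  shows "card (A \<inter> C) * card B \<le> card (A \<inter> B) * card C"
proof -
  have "card (A \<inter> C) = card ((\<lambda>x. B #> x) ` (A \<inter> C)) * card (A \<inter> C \<inter> B)"
    using A C B(1) subgroups_Inter_pair by (intro card_subgroup_quotient_image) auto
  moreover have "card C = card ((\<lambda>x. B #> x) ` C) * card (C \<inter> B)"
    using B(1) C by (intro card_subgroup_quotient_image) auto
  moreover have "card ((\<lambda>x. B #> x) ` (A \<inter> C)) \<le> card ((\<lambda>x. B #> x) ` C)"
    using C by (intro card_mono) auto
  moreover have "A \<inter> C \<inter> B = A \<inter> B" "C \<inter> B = B" using B by auto
  ultimately show ?thesis by (simp add: mult.assoc mult.commute mult.left_commute)
qed

lemma subgroup_preimage_quotient:
  assumes "K \<lhd> G" "subgroup L (G Mod K)"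
  shows "subgroup {x \<in> carrier G. K #> x \<in> L} G"
proof -
  interpret \<pi>: group_hom G "G Mod K" "\<lambda>x. K #> x" using assms(1) by (rule quotient_hom)
  show ?thesis
    using assms(2) \<pi>.hom_one \<pi>.hom_mult \<pi>.hom_inv
    by (intro subgroupI) (auto simp del: one_FactGroup mult_FactGroup simp: subgroup.m_closed subgroup.m_inv_closed subgroup.one_closed intro!: exI[of _ \<one>])
qed

lemma normal_preimage_quotient:
  assumes "K \<lhd> G" "L \<lhd> G Mod K"
  shows "{x \<in> carrier G. K #> x \<in> L} \<lhd> G"
proof -
  interpret \<pi>: group_hom G "G Mod K" "\<lambda>x. K #> x" using assms(1) by (rule quotient_hom)
  have "K #> (x \<otimes> h \<otimes> inv x) \<in> L" if "x \<in> carrier G" "h \<in> carrier G" "K #> h \<in> L" for x h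
    using assms(2) that \<pi>.hom_mult \<pi>.hom_inv \<pi>.H.normal_inv_iff[of L] \<pi>.hom_closed[of x]
    by (simp del: mult_FactGroup)
  then show ?thesis
    using subgroup_preimage_quotient[OF assms(1) normal_imp_subgroup[OF assms(2)]]
    unfolding normal_inv_iff by auto
qed

lemma p_subgroup_quotient:
  assumes "p_subgroup G p (carrier G)" "K \<lhd> G"
  shows "p_subgroup (G Mod K) p (carrier (G Mod K))"
proof -
  interpret Q: group "G Mod K" using assms(2) by (rule normal.factorgroup_is_group)
  have "card (carrier (G Mod K)) dvd card (carrier G)"
    using card_quotient[OF assms(2)] by (metis dvd_triv_left)
  then show ?thesis
    using assms(1) divides_primepow_nat Q.subgroup_self unfolding p_subgroup_def by metis
qed

text \<open>The image of \<open>N\<close> in \<open>G / M\<close> is a nontrivial normal subgroup of a \<open>p\<close>-group, so it contains a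
  nontrivial central element.\<close>

lemma p_subgroup_relative_center:
  assumes G: "p_subgroup G p (carrier G)" and M: "M \<lhd> G" and N: "N \<lhd> G" "M \<subset> N"
  obtains z where "z \<in> N - M" "\<And>w. w \<in> carrier G \<Longrightarrow> w \<otimes> z \<otimes> inv w \<otimes> inv z \<in> M"
proof -
  interpret \<pi>: group_hom G "G Mod M" "\<lambda>x. M #> x" using M by (rule quotient_hom)
  note GD = p_subgroupD[OF G]
  have sN: "subgroup N G" using N(1) by (rule normal_imp_subgroup)
  have NG: "x \<in> carrier G" if "x \<in> N" for x using sN that by (rule subgroup.mem_carrier)
  have finN: "finite N" using GD(3) subgroup.subset[OF sN] finite_subset by blast
  let ?\<pi> = "\<lambda>x. M #> x"
  have subI: "subgroup (?\<pi> ` N) (G Mod M)" using sN by (rule \<pi>.subgroup_img_is_subgroup)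
  have Q: "p_subgroup (G Mod M) p (carrier (G Mod M))" using G M by (rule p_subgroup_quotient)
  have "p dvd card (?\<pi> ` N)"
  proof -
    have pI: "p_subgroup (G Mod M) p (?\<pi> ` N)"
      using \<pi>.H.p_subgroup_mono[OF Q subI] subgroup.subset[OF subI] by blast
    have "card N = card (?\<pi> ` N) * card M"
      using card_subgroup_quotient_image[OF M sN finN] N(2) by (simp add: Int_absorb1 psubset_imp_subset)
    moreover have "card M < card N" using psubset_card_mono[OF finN N(2)] .
    ultimately have "card (?\<pi> ` N) \<noteq> 1" by auto
    then show ?thesis using pI unfolding p_subgroup_def by (metis dvd_power neq0_conv power_0)
  qed
  moreover have "g \<otimes>\<^bsub>G Mod M\<^esub> x \<otimes>\<^bsub>G Mod M\<^esub> inv\<^bsub>G Mod M\<^esub> g \<in> ?\<pi> ` N"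
    if g: "g \<in> carrier (G Mod M)" and x: "x \<in> ?\<pi> ` N" for g x
  proof -
    obtain h n where hn: "h \<in> carrier G" "g = ?\<pi> h" "n \<in> N" "x = ?\<pi> n"
      using g x unfolding carrier_FactGroup by blast
    have "g \<otimes>\<^bsub>G Mod M\<^esub> x \<otimes>\<^bsub>G Mod M\<^esub> inv\<^bsub>G Mod M\<^esub> g = ?\<pi> (h \<otimes> n \<otimes> inv h)"
      using hn NG by (simp del: mult_FactGroup)
    moreover have "h \<otimes> n \<otimes> inv h \<in> N" using N(1) hn by (simp add: normal_inv_iff)
    ultimately show ?thesis by blast
  qed
  ultimately obtain y where y: "y \<in> ?\<pi> ` N" "y \<noteq> \<one>\<^bsub>G Mod M\<^esub>"
    "\<And>g. g \<in> carrier (G Mod M) \<Longrightarrow> g \<otimes>\<^bsub>G Mod M\<^esub> y = y \<otimes>\<^bsub>G Mod M\<^esub> g"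
    using \<pi>.H.p_subgroup_central_element[OF Q subI] finN by blast
  then obtain z where z: "z \<in> N" "y = ?\<pi> z" by blast
  have "z \<notin> M" using y(2) z quotient_one_iff[OF M NG] by simp
  moreover have "w \<otimes> z \<otimes> inv w \<otimes> inv z \<in> M" if w: "w \<in> carrier G" for w
  proof -
    have "?\<pi> (w \<otimes> z) = ?\<pi> (z \<otimes> w)"
      using y(3)[of "?\<pi> w"] w z NG \<pi>.hom_mult \<pi>.hom_closed by (simp del: mult_FactGroup)
    then have "w \<otimes> z \<otimes> inv (z \<otimes> w) \<in> M"
      using w z NG by (intro quotient_eq_iff[OF M, THEN iffD1]) auto
    then show ?thesis using w z NG by (simp add: inv_mult_group m_assoc)
  qed
  ultimately show ?thesis using z that by blast
qed

lemma centralizer_modulo_subgroup: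
  assumes M: "M \<lhd> G" and A: "A \<subseteq> carrier G"
  shows "subgroup {z \<in> carrier G. \<forall>w\<in>A. w \<otimes> z \<otimes> inv w \<otimes> inv z \<in> M} G" (is "subgroup ?Z G")
proof -
  have sM: "subgroup M G" using M by (rule normal_imp_subgroup)
  have MG: "x \<in> carrier G" if "x \<in> M" for x using sM that by (rule subgroup.mem_carrier)
  have AG: "x \<in> carrier G" if "x \<in> A" for x using A that by blast
  have conj: "x \<otimes> h \<otimes> inv x \<in> M" if "x \<in> carrier G" "h \<in> M" for x h
    using M that by (simp add: normal_inv_iff)
  show ?thesis
  proof (rule subgroupI)
    show "?Z \<noteq> {}" using AG subgroup.one_closed[OF sM] by (auto intro!: exI[of _ \<one>])
    show "inv a \<in> ?Z" if a: "a \<in> ?Z" for a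
    proof -
      have "w \<otimes> inv a \<otimes> inv w \<otimes> inv (inv a) \<in> M" if w: "w \<in> A" for w
      proof -
        have "inv a \<otimes> inv (w \<otimes> a \<otimes> inv w \<otimes> inv a) \<otimes> inv (inv a) \<in> M"
          using a w subgroup.m_inv_closed[OF sM] by (intro conj) auto
        then show ?thesis using a AG[OF w] by (simp add: inv_mult_group m_assoc)
      qed
      then show ?thesis using a by simp
    qed
    show "a \<otimes> b \<in> ?Z" if ab: "a \<in> ?Z" "b \<in> ?Z" for a b
    proof -
      have "w \<otimes> (a \<otimes> b) \<otimes> inv w \<otimes> inv (a \<otimes> b) \<in> M" if w: "w \<in> A" for w
      proof -
        have "(w \<otimes> a \<otimes> inv w \<otimes> inv a) \<otimes> (a \<otimes> (w \<otimes> b \<otimes> inv w \<otimes> inv b) \<otimes> inv a) \<in> M"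
          using conj[of a "w \<otimes> b \<otimes> inv w \<otimes> inv b"] ab w by (rule_tac subgroup.m_closed[OF sM]) simp_all
        then show ?thesis using ab AG[OF w] by (simp add: inv_mult_group m_assoc)
      qed
      then show ?thesis using ab by simp
    qed
  qed auto
qed

text \<open>A maximal proper \<open>G\<close>-invariant subgroup \<open>M\<close> of \<open>N\<close> works: the elements of \<open>N\<close> that are
  central modulo \<open>M\<close> form a normal subgroup that is larger than \<open>M\<close>.\<close>

lemma p_subgroup_commutators_descend:
  assumes G: "p_subgroup G p (carrier G)" and N: "N \<lhd> G" "N \<noteq> {\<one>}"
  obtains M where "M \<lhd> G" "M \<subset> N" "\<And>w n. w \<in> carrier G \<Longrightarrow> n \<in> N \<Longrightarrow> w \<otimes> n \<otimes> inv w \<otimes> inv n \<in> M"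
proof -
  note GD = p_subgroupD[OF G]
  have sN: "subgroup N G" using N(1) by (rule normal_imp_subgroup)
  have NG: "x \<in> carrier G" if "x \<in> N" for x using sN that by (rule subgroup.mem_carrier)
  have finN: "finite N" using GD(3) subgroup.subset[OF sN] finite_subset by blast
  define \<M> where "\<M> = {M. M \<lhd> G \<and> M \<subset> N}"
  have "finite \<M>" using finN by (intro finite_subset[of \<M> "Pow N"]) (auto simp: \<M>_def)
  moreover have "{\<one>} \<in> \<M>" using N(2) one_is_normal subgroup.one_closed[OF sN] by (auto simp: \<M>_def)
  ultimately obtain M where M: "M \<in> \<M>" and max: "\<And>L. L \<in> \<M> \<Longrightarrow> M \<subseteq> L \<Longrightarrow> M = L"
    using finite_has_maximal[of \<M>] by blast
  have M': "M \<lhd> G" "M \<subset> N" using M by (auto simp: \<M>_def)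
  have sM: "subgroup M G" using M'(1) by (rule normal_imp_subgroup)
  interpret \<pi>: group_hom G "G Mod M" "\<lambda>x. M #> x" using M'(1) by (rule quotient_hom)
  define Z where "Z = N \<inter> {z \<in> carrier G. \<forall>w\<in>carrier G. w \<otimes> z \<otimes> inv w \<otimes> inv z \<in> M}"
  have Z_iff: "n \<in> Z \<longleftrightarrow> (\<forall>w\<in>carrier G. w \<otimes> n \<otimes> inv w \<otimes> inv n \<in> M)" if "n \<in> N" for n
    using that NG by (auto simp: Z_def)
  obtain z where z: "z \<in> N - M" "\<And>w. w \<in> carrier G \<Longrightarrow> w \<otimes> z \<otimes> inv w \<otimes> inv z \<in> M"
    using p_subgroup_relative_center[OF G M'(1) N(1) M'(2)] by blast
  have sZ: "subgroup Z G"
    unfolding Z_def using M'(1) sN centralizer_modulo_subgroup subgroups_Inter_pair by blast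
  have MZ: "M \<subseteq> Z"
  proof
    fix m assume m: "m \<in> M"
    have "w \<otimes> m \<otimes> inv w \<otimes> inv m \<in> M" if "w \<in> carrier G" for w
      using m that M'(1) subgroup.m_closed[OF sM] subgroup.m_inv_closed[OF sM] by (simp add: normal_inv_iff)
    then show "m \<in> Z" using Z_iff m M'(2) by blast
  qed
  have "Z \<lhd> G"
    unfolding normal_inv_iff
  proof (intro conjI ballI sZ)
    fix x h assume xh: "x \<in> carrier G" "h \<in> Z"
    then have hN: "h \<in> N" "h \<in> carrier G" using NG by (auto simp: Z_def)
    have "x \<otimes> h \<otimes> inv x \<otimes> inv h \<in> M" using xh hN Z_iff by blast
    then have "(x \<otimes> h \<otimes> inv x \<otimes> inv h) \<otimes> h \<in> Z" using MZ xh subgroup.m_closed[OF sZ] by blast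
    then show "x \<otimes> h \<otimes> inv x \<in> Z" using xh hN by (simp add: m_assoc)
  qed
  moreover have "M \<noteq> Z" using z Z_iff by blast
  moreover have "Z \<subseteq> N" by (auto simp: Z_def)
  ultimately have "Z = N" using max[of Z] MZ by (auto simp: \<M>_def)
  then show ?thesis using that[OF M'] Z_iff by blast
qed

end

section \<open>Power subgroups of \<open>p\<close>-groups with slowly growing index\<close>

text \<open>With \<open>q = p ^ Suc k\<close> one has \<open>i * (q choose i) = q * (q - 1 choose (i - 1))\<close>, and \<open>i\<close> contains
  fewer than \<open>k\<close> factors \<open>p\<close>.\<close>

lemma prime_square_dvd_binomial:
  fixes p :: nat
  assumes p: "prime p" and i: "0 < i" "i < p ^ k"
  shows "p ^ 2 dvd (p ^ Suc k choose i)"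
proof -
  have "i * (p ^ Suc k choose i) = p ^ Suc k * (p ^ Suc k - 1 choose (i - 1))"
    using i times_binomial_minus1_eq[of i "p ^ Suc k"] by simp
  then have dvd: "p ^ Suc k dvd i * (p ^ Suc k choose i)" by simp
  obtain u where u: "i = p ^ multiplicity p i * u" "\<not> p dvd u"
    using i p by (metis multiplicity_decompose' neq0_conv not_prime_unit)
  define v where "v = multiplicity p i"
  have "p ^ v \<le> i" using u i unfolding v_def[symmetric] by (metis dvd_imp_le dvd_triv_left)
  then have "p ^ v < p ^ k" using i by simp
  then have "v < k" using prime_gt_1_nat[OF p] by simp
  then have "p ^ Suc k = p ^ v * p ^ (Suc k - v)" by (simp flip: power_add)
  then have "p ^ v * p ^ (Suc k - v) dvd p ^ v * (u * (p ^ Suc k choose i))"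
    using dvd u(1) unfolding v_def[symmetric] by (metis mult.assoc)
  then have "p ^ (Suc k - v) dvd u * (p ^ Suc k choose i)"
    using prime_gt_0_nat[OF p] dvd_times_left_cancel_iff[of "p ^ v"] by simp
  then have "p ^ (Suc k - v) dvd (p ^ Suc k choose i)"
    by (rule prime_power_dvd_multD[of p "Suc k - v" u, rotated]) (use p u(2) \<open>v < k\<close> in simp_all)
  moreover have "p ^ 2 dvd p ^ (Suc k - v)" using \<open>v < k\<close> by (intro le_imp_power_dvd) simp
  ultimately show ?thesis by (rule dvd_trans[rotated])
qed

lemma prime_dvd_choose_two:
  fixes p :: nat
  assumes "prime p"
  shows "p dvd (p ^ 2 choose 2)"
proof -
  have *: "2 * (p ^ 2 choose 2) = p * (p * (p ^ 2 - 1))"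
    using times_binomial_minus1_eq[of 2 "p ^ 2"] by (simp add: power2_eq_square)
  show ?thesis
  proof (cases "p = 2")
    case True
    then show ?thesis by (simp add: choose_two)
  next
    case False
    then have "\<not> p dvd 2" using assms prime_ge_2_nat[of p] dvd_imp_le[of p 2] by linarith
    moreover have "p dvd 2 * (p ^ 2 choose 2)" unfolding * by simp
    ultimately show ?thesis using assms by (simp only: prime_dvd_mult_iff) simp
  qed
qed

context group begin

lemma commutator_eq_one_iff:
  assumes "x \<in> carrier G" "y \<in> carrier G"
  shows "x \<otimes> y \<otimes> inv x \<otimes> inv y = \<one> \<longleftrightarrow> x \<otimes> y = y \<otimes> x"
proof -
  have "x \<otimes> y \<otimes> inv x \<otimes> inv y = x \<otimes> y \<otimes> inv (y \<otimes> x)"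
    using assms by (simp add: m_assoc inv_mult_group)
  moreover have "\<one> = x \<otimes> y \<otimes> inv (y \<otimes> x) \<longleftrightarrow> x \<otimes> y = \<one> \<otimes> (y \<otimes> x)"
    using assms by (intro inv_solve_right) auto
  ultimately show ?thesis using assms by (metis l_one m_closed)
qed

text \<open>Moving \<open>u\<close> past \<open>v [^] n\<close> produces \<open>c [^] n\<close>, and \<open>0 + 1 + \<dots> + (n - 1) = n choose 2\<close>.\<close>

lemma pow_mult_central_commutator:
  assumes uvc: "u \<in> carrier G" "v \<in> carrier G" "c \<in> carrier G"
    and c: "c \<otimes> u = u \<otimes> c" "c \<otimes> v = v \<otimes> c" and vu: "v \<otimes> u = u \<otimes> v \<otimes> c"
  shows "(u \<otimes> v) [^] (n::nat) = u [^] n \<otimes> v [^] n \<otimes> c [^] (n choose 2)"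
proof -
  have cu: "c [^] m \<otimes> u = u \<otimes> c [^] m" and cv: "c [^] m \<otimes> v = v \<otimes> c [^] m" for m :: nat
    using group_commutes_pow[OF c(1)] group_commutes_pow[OF c(2)] uvc by auto
  have cv': "c [^] m \<otimes> (v \<otimes> y) = v \<otimes> (c [^] m \<otimes> y)" if "y \<in> carrier G" for m :: nat and y
    using cv[of m] uvc that by (simp flip: m_assoc)
  have vnu: "v [^] n \<otimes> u = u \<otimes> v [^] n \<otimes> c [^] n" for n :: nat
  proof (induction n)
    case (Suc n)
    have "v [^] Suc n \<otimes> u = v [^] n \<otimes> (v \<otimes> u)" using uvc by (simp add: m_assoc)
    also have "\<dots> = (v [^] n \<otimes> u) \<otimes> v \<otimes> c" using uvc by (simp add: vu m_assoc)
    also have "\<dots> = u \<otimes> v [^] n \<otimes> (c [^] n \<otimes> v) \<otimes> c" using uvc by (simp add: Suc m_assoc)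
    also have "\<dots> = u \<otimes> v [^] Suc n \<otimes> c [^] Suc n" using uvc by (simp add: cv m_assoc)
    finally show ?case .
  qed (use uvc in simp)
  show ?thesis
  proof (induction n)
    case (Suc n)
    have "(u \<otimes> v) [^] Suc n = u [^] n \<otimes> v [^] n \<otimes> (c [^] (n choose 2) \<otimes> u) \<otimes> v"
      using uvc by (simp add: Suc m_assoc)
    also have "\<dots> = u [^] n \<otimes> (v [^] n \<otimes> u) \<otimes> (c [^] (n choose 2) \<otimes> v)"
      using uvc by (simp add: cu m_assoc)
    also have "\<dots> = u [^] n \<otimes> u \<otimes> v [^] n \<otimes> (c [^] n \<otimes> v) \<otimes> c [^] (n choose 2)"
      using uvc by (simp add: vnu cv cv' m_assoc)
    also have "\<dots> = u [^] Suc n \<otimes> v [^] Suc n \<otimes> (c [^] n \<otimes> c [^] (n choose 2))"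
      using uvc by (simp add: cv cv' m_assoc)
    also have "c [^] n \<otimes> c [^] (n choose 2) = c [^] (Suc n choose 2)"
      using uvc by (simp add: nat_pow_mult numeral_2_eq_2)
    finally show ?case .
  qed (use uvc in \<open>simp add: numeral_2_eq_2\<close>)
qed

lemma comm_group_subgroup:
  assumes "subgroup A G" "\<And>y z. y \<in> A \<Longrightarrow> z \<in> A \<Longrightarrow> y \<otimes> z = z \<otimes> y"
  shows "comm_group (G\<lparr>carrier := A\<rparr>)"
proof (rule group.group_comm_groupI[OF subgroup_imp_group[OF assms(1)]])
  fix y z assume "y \<in> carrier (G\<lparr>carrier := A\<rparr>)" "z \<in> carrier (G\<lparr>carrier := A\<rparr>)"
  then have "y \<in> A" "z \<in> A" by simp_all
  then have "y \<otimes> z = z \<otimes> y" by (rule assms(2))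
  moreover have "y \<otimes>\<^bsub>G\<lparr>carrier := A\<rparr>\<^esub> z = y \<otimes> z" "z \<otimes>\<^bsub>G\<lparr>carrier := A\<rparr>\<^esub> y = z \<otimes> y" by simp_all
  ultimately show "y \<otimes>\<^bsub>G\<lparr>carrier := A\<rparr>\<^esub> z = z \<otimes>\<^bsub>G\<lparr>carrier := A\<rparr>\<^esub> y" by argo
qed

text \<open>If the \<open>b i\<close> commute, conjugation by \<open>x\<close> acts on them like \<open>1 + s\<close>, where \<open>s\<close> is the
  shift \<open>b i \<mapsto> b (i + 1)\<close>. So conjugation by \<open>x [^] n\<close> is given by the binomial theorem.\<close>

lemma conj_pow_finprod:
  assumes A: "subgroup A G" and comm: "\<And>y z. y \<in> A \<Longrightarrow> z \<in> A \<Longrightarrow> y \<otimes> z = z \<otimes> y"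
    and x: "x \<in> carrier G" and b: "\<And>i. b i \<in> A"
    and step: "\<And>i. x \<otimes> b i \<otimes> inv x = b i \<otimes> b (Suc i)"
  shows "x [^] (n::nat) \<otimes> b j \<otimes> inv (x [^] n)
    = finprod (G\<lparr>carrier := A\<rparr>) (\<lambda>i. b (i + j) [^] (n choose i)) {..n}"
proof -
  interpret A: comm_group "G\<lparr>carrier := A\<rparr>"
    using A comm by (rule comm_group_subgroup)
  have bG: "b i \<in> carrier G" for i using A b by (rule subgroup.mem_carrier)
  have cl: "b i [^] (m::nat) \<in> A" for i m using A b by (rule subgroup_pow_closed)
  show ?thesis
  proof (induction n arbitrary: j)
    case 0
    have "b (0 + j) [^] (0 choose 0 :: nat) \<in> A" using cl .
    then show ?case using bG by simp
  next
    case (Suc n)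
    let ?A = "G\<lparr>carrier := A\<rparr>"
    have "x [^] Suc n \<otimes> b j \<otimes> inv (x [^] Suc n) = x [^] n \<otimes> (x \<otimes> b j \<otimes> inv x) \<otimes> inv (x [^] n)"
      using x bG by (simp add: m_assoc inv_mult_group)
    also have "\<dots> = (x [^] n \<otimes> b j \<otimes> inv (x [^] n)) \<otimes> (x [^] n \<otimes> b (Suc j) \<otimes> inv (x [^] n))"
      using x bG by (simp add: step m_assoc)
    also have "\<dots> = finprod ?A (\<lambda>i. b (i + j) [^] (n choose i)) {..n} \<otimes> finprod ?A (\<lambda>i. b (i + Suc j) [^] (n choose i)) {..n}"
      by (simp only: Suc)
    also have "finprod ?A (\<lambda>i. b (i + j) [^] (n choose i)) {..n} = finprod ?A (\<lambda>i. b (i + j) [^] (n choose i)) {..Suc n}"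
    proof -
      have "finprod ?A (\<lambda>i. b (i + j) [^] (n choose i)) {..n} \<in> A"
        using A.finprod_closed[of "\<lambda>i. b (i + j) [^] (n choose i)" "{..n}"] cl by auto
      then show ?thesis
        using A.finprod_Suc[of "\<lambda>i. b (i + j) [^] (n choose i)" n] cl A.l_one by (simp add: binomial_eq_0)
    qed
    also have "\<dots> = finprod ?A (\<lambda>i. b (i + Suc j) [^] (n choose Suc i)) {..n} \<otimes> b j"
      using A.finprod_Suc2[of "\<lambda>i. b (i + j) [^] (n choose i)" n] cl bG by simp
    also have "finprod ?A (\<lambda>i. b (i + Suc j) [^] (n choose Suc i)) {..n} \<otimes> b j \<otimes> finprod ?A (\<lambda>i. b (i + Suc j) [^] (n choose i)) {..n}
        = finprod ?A (\<lambda>i. b (i + Suc j) [^] (n choose i) \<otimes> b (i + Suc j) [^] (n choose Suc i)) {..n} \<otimes> b j"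
    proof -
      let ?f = "finprod ?A (\<lambda>i. b (i + Suc j) [^] (n choose i)) {..n}"
      let ?g = "finprod ?A (\<lambda>i. b (i + Suc j) [^] (n choose Suc i)) {..n}"
      have fg: "?f \<in> A" "?g \<in> A"
        using A.finprod_closed[of "\<lambda>i. b (i + Suc j) [^] (n choose i)" "{..n}"]
          A.finprod_closed[of "\<lambda>i. b (i + Suc j) [^] (n choose Suc i)" "{..n}"] cl by auto
      have "finprod ?A (\<lambda>i. b (i + Suc j) [^] (n choose i) \<otimes> b (i + Suc j) [^] (n choose Suc i)) {..n} = ?f \<otimes> ?g"
        using A.finprod_multf[of "\<lambda>i. b (i + Suc j) [^] (n choose i)" "{..n}" "\<lambda>i. b (i + Suc j) [^] (n choose Suc i)"] cl by simp
      then show ?thesis using A.m_ac fg b by simp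
    qed
    also have "\<dots> = finprod ?A (\<lambda>i. b (i + j) [^] (Suc n choose i)) {..Suc n}"
      using A.finprod_Suc2[of "\<lambda>i. b (i + j) [^] (Suc n choose i)" n] cl bG by (simp add: nat_pow_mult)
    finally show ?case .
  qed
qed

lemma power_subgroup_normal: "power_subgroup G n \<lhd> G"
  unfolding power_subgroup_def
proof (rule normal_generateI)
  show "g \<otimes> h \<otimes> inv g \<in> {x [^] n |x. x \<in> carrier G}"
    if "h \<in> {x [^] n |x. x \<in> carrier G}" "g \<in> carrier G" for h g
    using that by (auto simp: conj_pow[symmetric])
qed auto

lemma power_in_power_subgroup: "x \<in> carrier G \<Longrightarrow> x [^] n \<in> power_subgroup G n"
  unfolding power_subgroup_def by (auto intro: generate.incl)

lemma power_subgroup_subset: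
  assumes "subgroup S G" "\<And>x. x \<in> carrier G \<Longrightarrow> x [^] n \<in> S"
  shows "power_subgroup G n \<subseteq> S"
  unfolding power_subgroup_def using assms by (intro generate_subgroup_incl) auto

text \<open>The \<open>b i\<close> are iterated commutators with \<open>x\<close>. By \<open>p_subgroup_commutators_descend\<close> each step leads
  from a normal subgroup to a smaller one, whose order is less by a factor of at least \<open>p\<close>.\<close>

lemma iterated_commutator_trivial:
  assumes G: "p_subgroup G p (carrier G)" and card: "card (carrier G) \<le> p ^ t"
    and x: "x \<in> carrier G" and b: "\<And>i. b i \<in> carrier G"
    and step: "\<And>i. x \<otimes> b i \<otimes> inv x = b i \<otimes> b (Suc i)"
  shows "b t = \<one>"
proof -
  note GD = p_subgroupD[OF G]
  have descend: "b i = \<one> \<or> (\<exists>N. N \<lhd> G \<and> b i \<in> N \<and> p ^ i * card N \<le> card (carrier G))" for i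
  proof (induction i)
    case 0
    show ?case using b normal_self by auto
  next
    case (Suc i)
    have bS: "b (Suc i) = inv (b i) \<otimes> (x \<otimes> b i \<otimes> inv x)" using step b by simp
    show ?case
    proof (cases "b i = \<one>")
      case True
      then show ?thesis using bS x by simp
    next
      case False
      then obtain N where N: "N \<lhd> G" "b i \<in> N" "p ^ i * card N \<le> card (carrier G)" using Suc by blast
      have "N \<noteq> {\<one>}" using N False by blast
      then obtain M where M: "M \<lhd> G" "M \<subset> N" "\<And>w n. w \<in> carrier G \<Longrightarrow> n \<in> N \<Longrightarrow> w \<otimes> n \<otimes> inv w \<otimes> inv n \<in> M"
        using p_subgroup_commutators_descend[OF G N(1)] by blast
      have "inv (b i) \<otimes> (x \<otimes> b i \<otimes> inv x \<otimes> inv (b i)) \<otimes> inv (inv (b i)) \<in> M"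
        using M(1) M(3)[OF x N(2)] b[of i] unfolding normal_inv_iff by blast
      moreover have "b (Suc i) = inv (b i) \<otimes> (x \<otimes> b i \<otimes> inv x \<otimes> inv (b i)) \<otimes> inv (inv (b i))"
        using b[of i] x unfolding bS by (simp add: m_assoc)
      ultimately have "b (Suc i) \<in> M" by (simp only:)
      have pN: "p_subgroup G p N"
        using p_subgroup_mono[OF G normal_imp_subgroup[OF N(1)]] subgroup.subset[OF normal_imp_subgroup[OF N(1)]] by blast
      have "p * card M \<le> card N"
        using p_subgroup_card_step[OF pN normal_imp_subgroup[OF M(1)] M(2)] p_subgroupD(5)[OF pN] by (rule dvd_imp_le)
      then have "p ^ i * (p * card M) \<le> p ^ i * card N" by (rule mult_le_mono2)
      moreover have "p ^ Suc i * card M = p ^ i * (p * card M)" by simp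
      ultimately have "p ^ Suc i * card M \<le> card (carrier G)" using N(3) by linarith
      then show ?thesis using M(1) \<open>b (Suc i) \<in> M\<close> by blast
    qed
  qed
  show ?thesis
  proof (rule ccontr)
    assume "b t \<noteq> \<one>"
    then obtain N where N: "N \<lhd> G" "b t \<in> N" "p ^ t * card N \<le> card (carrier G)" using descend by blast
    then have "p ^ t * card N \<le> p ^ t * 1" using card by linarith
    then have "card N \<le> 1" using prime_gt_0_nat[OF GD(1)] by (metis mult_le_cancel1 zero_less_power)
    moreover have "{\<one>, b t} \<subseteq> N" using N subgroup.one_closed[OF normal_imp_subgroup[OF N(1)]] by blast
    moreover have "finite N" using finite_subset[OF subgroup.subset[OF normal_imp_subgroup[OF N(1)]] GD(3)] .
    ultimately have "card {\<one>, b t} \<le> 1" by (meson card_mono le_trans)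
    then show False using \<open>b t \<noteq> \<one>\<close> by simp
  qed
qed

text \<open>The crucial special case, to which \<open>derived_power_subgroup_le\<close> reduces: the commutators of
  \<open>P = power_subgroup G (p ^ Suc k)\<close> are central and have order at most \<open>p\<close>. Then \<open>P\<close> has exponent
  dividing \<open>p ^ 2\<close>, as its generators have. Let \<open>Z\<close> be the centre of \<open>P\<close>. If \<open>P\<close> were not abelian, it would contain some
  \<open>a \<notin> Z\<close> that is central modulo \<open>Z\<close>. The iterated commutators of \<open>a\<close> with \<open>x\<close> are trivial from
  the \<open>t\<close>-th on, and for \<open>0 < i < t \<le> p ^ k\<close> the binomial coefficients of \<open>p ^ Suc k\<close> are divisible
  by \<open>p ^ 2\<close>. So by \<open>conj_pow_finprod\<close> all \<open>x [^] (p ^ Suc k)\<close> commute with \<open>a\<close>, and these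
  generate \<open>P\<close>.\<close>

lemma power_subgroup_abelian_minimal:
  assumes G: "p_subgroup G p (carrier G)" and card: "card (carrier G) \<le> p ^ t" and t: "t \<le> p ^ k"
    and expo: "\<And>x. x \<in> carrier G \<Longrightarrow> x [^] (p ^ (k + 3)) = \<one>"
    and comm_p: "\<And>u v. u \<in> power_subgroup G (p ^ Suc k) \<Longrightarrow> v \<in> power_subgroup G (p ^ Suc k) \<Longrightarrow>
      (u \<otimes> v \<otimes> inv u \<otimes> inv v) [^] p = \<one>"
    and comm_central: "\<And>u v w. u \<in> power_subgroup G (p ^ Suc k) \<Longrightarrow> v \<in> power_subgroup G (p ^ Suc k) \<Longrightarrow>
      w \<in> carrier G \<Longrightarrow> (u \<otimes> v \<otimes> inv u \<otimes> inv v) \<otimes> w = w \<otimes> (u \<otimes> v \<otimes> inv u \<otimes> inv v)"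
    and uv: "u \<in> power_subgroup G (p ^ Suc k)" "v \<in> power_subgroup G (p ^ Suc k)"
  shows "u \<otimes> v = v \<otimes> u"
proof -
  note GD = p_subgroupD[OF G]
  define P where "P = power_subgroup G (p ^ Suc k)"
  have nP: "P \<lhd> G" unfolding P_def by (rule power_subgroup_normal)
  have sP: "subgroup P G" using nP by (rule normal_imp_subgroup)
  have PG: "x \<in> carrier G" if "x \<in> P" for x using sP that by (rule subgroup.mem_carrier)
  have expP: "y [^] (p ^ 2) = \<one>" if y: "y \<in> P" for y
  proof -
    have "subgroup {y \<in> P. y [^] (p ^ 2) = \<one>} G" (is "subgroup ?S G")
    proof (rule subgroupI)
      show "?S \<subseteq> carrier G" using PG by auto
      show "?S \<noteq> {}" using subgroup.one_closed[OF sP] by auto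
      show "inv a \<in> ?S" if "a \<in> ?S" for a
        using that PG subgroup.m_inv_closed[OF sP] by (simp add: nat_pow_inv)
      show "a \<otimes> b \<in> ?S" if ab: "a \<in> ?S" "b \<in> ?S" for a b
      proof -
        define c where "c = inv a \<otimes> inv b \<otimes> inv (inv a) \<otimes> inv (inv b)"
        have ab': "a \<in> P" "b \<in> P" "a \<in> carrier G" "b \<in> carrier G" using ab PG by auto
        have inv: "inv a \<in> P" "inv b \<in> P" using ab' subgroup.m_inv_closed[OF sP] by auto
        have cP: "c [^] p = \<one>" and cc: "\<And>w. w \<in> carrier G \<Longrightarrow> c \<otimes> w = w \<otimes> c"
          using comm_p[of "inv a" "inv b"] comm_central[of "inv a" "inv b"] inv unfolding P_def c_def by auto
        have cG: "c \<in> carrier G" using ab' by (simp add: c_def)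
        have ba: "b \<otimes> a = a \<otimes> b \<otimes> inv c"
          using ab' by (simp add: c_def m_assoc inv_mult_group)
        have "inv c \<otimes> w = w \<otimes> inv c" if "w \<in> carrier G" for w
          using cc[OF that] cG that by (metis inv_solve_left inv_solve_right inv_closed m_assoc m_closed)
        then have "(a \<otimes> b) [^] (p ^ 2) = a [^] (p ^ 2) \<otimes> b [^] (p ^ 2) \<otimes> (inv c) [^] (p ^ 2 choose 2)"
          using ab' cG ba by (intro pow_mult_central_commutator) auto
        moreover have "(inv c) [^] (p ^ 2 choose 2) = \<one>"
        proof -
          obtain m where "p ^ 2 choose 2 = p * m" using prime_dvd_choose_two[OF GD(1)] by (auto elim: dvdE)
          then show ?thesis using cP cG by (simp add: nat_pow_inv flip: nat_pow_pow)
        qed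
        ultimately show ?thesis using ab subgroup.m_closed[OF sP] by simp
      qed
    qed
    moreover have "x [^] (p ^ Suc k) \<in> ?S" if x: "x \<in> carrier G" for x
    proof -
      have "p ^ Suc k * p ^ 2 = p ^ (k + 3)" by (simp add: power_add numeral_3_eq_3 power2_eq_square)
      then have "(x [^] (p ^ Suc k)) [^] (p ^ 2) = \<one>" using expo[OF x] x nat_pow_pow by metis
      then show ?thesis using power_in_power_subgroup[OF x] unfolding P_def by simp
    qed
    ultimately have "P \<subseteq> ?S" unfolding P_def by (intro power_subgroup_subset)
    then show ?thesis using y by blast
  qed
  define Z where "Z = P \<inter> {z \<in> carrier G. \<forall>w\<in>P. w \<otimes> z \<otimes> inv w \<otimes> inv z \<in> {\<one>}}"
  have sZ: "subgroup Z G"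
    unfolding Z_def using sP PG one_is_normal by (intro subgroups_Inter_pair centralizer_modulo_subgroup) auto
  have Z_iff: "z \<in> Z \<longleftrightarrow> z \<in> P \<and> (\<forall>w\<in>P. w \<otimes> z = z \<otimes> w)" for z
    using PG commutator_eq_one_iff by (auto simp: Z_def)
  have ZG: "z \<in> carrier G" if "z \<in> Z" for z using that PG Z_iff by blast
  have nZ: "Z \<lhd> G"
    unfolding normal_inv_iff
  proof (intro conjI sZ ballI)
    fix x h assume x: "x \<in> carrier G" and h: "h \<in> Z"
    have hP: "h \<in> P" "h \<in> carrier G" using h Z_iff ZG by blast+
    have "w \<otimes> (x \<otimes> h \<otimes> inv x) = (x \<otimes> h \<otimes> inv x) \<otimes> w" if w: "w \<in> P" for w
    proof -
      have "inv x \<otimes> w \<otimes> inv (inv x) \<in> P" using nP x w unfolding normal_inv_iff by blast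
      then have "(inv x \<otimes> w \<otimes> x) \<otimes> h = h \<otimes> (inv x \<otimes> w \<otimes> x)" using h Z_iff x by simp
      then have "x \<otimes> ((inv x \<otimes> w \<otimes> x) \<otimes> h) \<otimes> inv x = x \<otimes> (h \<otimes> (inv x \<otimes> w \<otimes> x)) \<otimes> inv x" by simp
      then show ?thesis using x hP PG[OF w] by (simp add: m_assoc)
    qed
    moreover have "x \<otimes> h \<otimes> inv x \<in> P" using nP x hP unfolding normal_inv_iff by blast
    ultimately show "x \<otimes> h \<otimes> inv x \<in> Z" using Z_iff by blast
  qed
  have "Z = P"
  proof (rule ccontr)
    assume "Z \<noteq> P"
    then have "Z \<subset> P" using Z_iff by blast
    then obtain a where a: "a \<in> P - Z" "\<And>w. w \<in> carrier G \<Longrightarrow> w \<otimes> a \<otimes> inv w \<otimes> inv a \<in> Z"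
      using p_subgroup_relative_center[OF G nZ nP] by blast
    have aG: "a \<in> carrier G" using a PG by blast
    have "x [^] (p ^ Suc k) \<otimes> a = a \<otimes> x [^] (p ^ Suc k)" if x: "x \<in> carrier G" for x
    proof -
      \<comment> \<open>The iterated commutators of \<open>a\<close> with \<open>x\<close>; all but \<open>b 0 = a\<close> lie in \<open>Z\<close>.\<close>
      define b where "b = rec_nat a (\<lambda>_ y. inv y \<otimes> (x \<otimes> y \<otimes> inv x))"
      have b0: "b 0 = a" and bS: "b (Suc i) = inv (b i) \<otimes> (x \<otimes> b i \<otimes> inv x)" for i
        by (simp_all add: b_def)
      have bZ: "b (Suc i) \<in> Z" for i
      proof (induction i)
        case 0
        have "inv a \<otimes> (x \<otimes> a \<otimes> inv x \<otimes> inv a) \<otimes> inv (inv a) \<in> Z"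
          using nZ a(2)[OF x] aG unfolding normal_inv_iff by blast
        then show ?case using aG x by (simp add: bS b0 m_assoc)
      next
        case (Suc i)
        then have "x \<otimes> b (Suc i) \<otimes> inv x \<in> Z" using nZ x unfolding normal_inv_iff by blast
        then show ?case using Suc subgroup.m_closed[OF sZ] subgroup.m_inv_closed[OF sZ] by (simp add: bS[of "Suc i"])
      qed
      have bP: "b i \<in> P" for i using bZ b0 a(1) Z_iff by (cases i) (metis DiffD1, blast)
      have bG: "b i \<in> carrier G" for i using bP PG by blast
      have step: "x \<otimes> b i \<otimes> inv x = b i \<otimes> b (Suc i)" for i using bG x by (simp add: bS)
      \<comment> \<open>The \<open>b i\<close> lie in the abelian group \<open>A\<close>, the centre of the centralizer of \<open>a\<close> in \<open>P\<close>.\<close>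
      define C where "C = P \<inter> {z \<in> carrier G. \<forall>w\<in>{a}. w \<otimes> z \<otimes> inv w \<otimes> inv z \<in> {\<one>}}"
      define A where "A = C \<inter> {z \<in> carrier G. \<forall>w\<in>C. w \<otimes> z \<otimes> inv w \<otimes> inv z \<in> {\<one>}}"
      have sC: "subgroup C G"
        unfolding C_def using sP aG one_is_normal by (intro subgroups_Inter_pair centralizer_modulo_subgroup) auto
      have CP: "C \<subseteq> P" by (auto simp: C_def)
      have sA: "subgroup A G"
        unfolding A_def using sC one_is_normal subgroup.subset[OF sC]
        by (intro subgroups_Inter_pair centralizer_modulo_subgroup)
      have C_iff: "z \<in> C \<longleftrightarrow> z \<in> P \<and> a \<otimes> z = z \<otimes> a" for z
        using PG aG commutator_eq_one_iff by (auto simp: C_def)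
      have A_iff: "z \<in> A \<longleftrightarrow> z \<in> C \<and> (\<forall>w\<in>C. w \<otimes> z = z \<otimes> w)" for z
      proof -
        have CG: "x \<in> carrier G" if "x \<in> C" for x using that CP PG by blast
        have "z \<in> A \<longleftrightarrow> z \<in> C \<and> (\<forall>w\<in>C. w \<otimes> z \<otimes> inv w \<otimes> inv z = \<one>)"
          using CG by (auto simp: A_def)
        then show ?thesis using commutator_eq_one_iff CG by metis
      qed
      have commA: "y \<otimes> z = z \<otimes> y" if "y \<in> A" "z \<in> A" for y z
        using that A_iff by blast
      have aP: "a \<in> P" using a(1) by blast
      then have "a \<in> A" using A_iff C_iff by metis
      moreover have "z \<in> A" if "z \<in> Z" for z
      proof -
        have "z \<in> C" using that Z_iff C_iff aP by metis
        moreover have "w \<otimes> z = z \<otimes> w" if "w \<in> C" for w using that \<open>z \<in> Z\<close> Z_iff CP by blast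
        ultimately show ?thesis using A_iff by blast
      qed
      ultimately have bA: "b i \<in> A" for i using bZ b0 by (cases i) auto
      have b_triv: "b i = \<one>" if "i \<ge> t" for i
        using that
      proof (induction i rule: dec_induct)
        case base
        show ?case using iterated_commutator_trivial[of p t x b, OF G card x bG step] .
      next
        case (step i)
        then show ?case using x by (simp add: bS)
      qed
      interpret A: comm_group "G\<lparr>carrier := A\<rparr>"
        using sA commA by (rule comm_group_subgroup)
      let ?q = "p ^ Suc k"
      have "x [^] ?q \<otimes> b 0 \<otimes> inv (x [^] ?q) = finprod (G\<lparr>carrier := A\<rparr>) (\<lambda>i. b (i + 0) [^] (?q choose i)) {..?q}"
        using sA commA x bA step by (rule conj_pow_finprod)
      also have "\<dots> = finprod (G\<lparr>carrier := A\<rparr>) (\<lambda>i. if i = 0 then a else \<one>\<^bsub>G\<lparr>carrier := A\<rparr>\<^esub>) {..?q}"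
      proof (rule A.finprod_cong')
        fix i
        show "b (i + 0) [^] (?q choose i) = (if i = 0 then a else \<one>\<^bsub>G\<lparr>carrier := A\<rparr>\<^esub>)"
        proof (cases "i = 0")
          case True
          then show ?thesis using b0 aG by simp
        next
          case False
          have "b i [^] (?q choose i) = \<one>"
          proof (cases "i < t")
            case True
            then have "p ^ 2 dvd (?q choose i)"
              using False t by (intro prime_square_dvd_binomial[OF GD(1)]) auto
            then obtain m where "?q choose i = p ^ 2 * m" by (auto elim: dvdE)
            then show ?thesis using expP[OF bP] bG by (simp flip: nat_pow_pow)
          next
            case False
            then show ?thesis using b_triv[of i] by simp
          qed
          then show ?thesis using False by simp
        qed
      qed (use \<open>a \<in> A\<close> subgroup.one_closed[OF sA] in auto)
      also have "\<dots> = a"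
        using A.finprod_singleton_swap[of 0 "{..?q}" "\<lambda>_. a"] \<open>a \<in> A\<close> by simp
      finally show ?thesis using x aG by (simp add: b0 inv_solve_right')
    qed
    then have "power_subgroup G (p ^ Suc k) \<subseteq> {z \<in> carrier G. \<forall>w\<in>{a}. w \<otimes> z \<otimes> inv w \<otimes> inv z \<in> {\<one>}}"
      using aG commutator_eq_one_iff[OF aG] one_is_normal
      by (intro power_subgroup_subset centralizer_modulo_subgroup) auto
    then have "a \<otimes> w = w \<otimes> a" if "w \<in> P" for w
      using that aG commutator_eq_one_iff[OF aG] unfolding P_def[symmetric] by blast
    then have "a \<in> Z" using a(1) Z_iff by (metis DiffD1)
    then show False using a(1) by blast
  qed
  then show ?thesis using uv Z_iff unfolding P_def by blast
qed

lemma central_torsion_normal: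
  "{c \<in> carrier G. (\<forall>w\<in>carrier G. w \<otimes> c = c \<otimes> w) \<and> c [^] (n::nat) = \<one>} \<lhd> G" (is "?S \<lhd> G")
proof -
  have central: "subgroup {c \<in> carrier G. \<forall>w\<in>carrier G. w \<otimes> c \<otimes> inv w \<otimes> inv c \<in> {\<one>}} G" (is "subgroup ?C G")
    using one_is_normal by (intro centralizer_modulo_subgroup) auto
  have S_iff: "c \<in> ?S \<longleftrightarrow> c \<in> ?C \<and> c [^] n = \<one>" for c
    using commutator_eq_one_iff by auto
  have comm: "w \<otimes> c = c \<otimes> w" if "c \<in> ?S" "w \<in> carrier G" for c w using that by blast
  have "subgroup ?S G"
  proof (rule subgroupI)
    show "?S \<noteq> {}" by (auto intro!: exI[of _ \<one>])
    show "inv a \<in> ?S" if "a \<in> ?S" for a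
    proof -
      have "a \<in> ?C" "a [^] n = \<one>" "a \<in> carrier G" using that S_iff by blast+
      then have "inv a \<in> ?C" "inv a [^] n = \<one>"
        using subgroup.m_inv_closed[OF central] by (simp_all add: nat_pow_inv)
      then show ?thesis using S_iff by blast
    qed
    show "a \<otimes> b \<in> ?S" if ab: "a \<in> ?S" "b \<in> ?S" for a b
    proof -
      have abG: "a \<in> carrier G" "b \<in> carrier G" using ab by auto
      have "(a \<otimes> b) [^] n = a [^] n \<otimes> b [^] n"
        using comm[OF ab(2) abG(1)] abG by (rule pow_mult_distrib)
      moreover have "a [^] n = \<one>" "b [^] n = \<one>" using ab by blast+
      ultimately have "(a \<otimes> b) [^] n = \<one>" by simp
      moreover have "a \<in> ?C" "b \<in> ?C" using ab S_iff by blast+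
      then have "a \<otimes> b \<in> ?C" by (rule subgroup.m_closed[OF central])
      ultimately show ?thesis using S_iff by blast
    qed
  qed auto
  moreover have "x \<otimes> c \<otimes> inv x \<in> ?S" if x: "x \<in> carrier G" and c: "c \<in> ?S" for x c
  proof -
    have cG: "c \<in> carrier G" using c by blast
    have "x \<otimes> c \<otimes> inv x = c \<otimes> x \<otimes> inv x" by (subst comm[OF c x]) (rule refl)
    also have "\<dots> = c" using x cG by (simp add: m_assoc)
    finally show ?thesis using c by (rule ssubst)
  qed
  ultimately show ?thesis unfolding normal_inv_iff by blast
qed

lemma p_group_central_torsion_nontrivial:
  assumes G: "p_subgroup G p (carrier G)" and "carrier G \<noteq> {\<one>}"
  obtains c where "c \<in> carrier G" "c \<noteq> \<one>" "\<And>w. w \<in> carrier G \<Longrightarrow> w \<otimes> c = c \<otimes> w" "c [^] p = \<one>"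
proof -
  note GD = p_subgroupD[OF G]
  obtain m where m: "card (carrier G) = p ^ m" using G by (auto simp: p_subgroup_def)
  have "card (carrier G) \<noteq> 1" using assms(2) one_closed by (metis card_1_singletonE singletonD)
  then have "p dvd card (carrier G)" using m by (cases m) auto
  then obtain z where z: "z \<in> carrier G" "z \<noteq> \<one>" "\<And>h. h \<in> carrier G \<Longrightarrow> h \<otimes> z = z \<otimes> h"
    using p_subgroup_central_element[OF G GD(2,3)] by (metis inv_closed m_closed)
  define j where "j = (LEAST n. z [^] (p ^ n) = \<one>)"
  obtain n where "z [^] (p ^ n) = \<one>" using p_subgroup_elem[OF G z(1)] by blast
  then have j: "z [^] (p ^ j) = \<one>" unfolding j_def by (rule LeastI)
  have "j \<noteq> 0"
  proof
    assume "j = 0"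
    then show False using j z(1,2) by simp
  qed
  define c where "c = z [^] (p ^ (j - 1))"
  have "c \<noteq> \<one>"
    using not_less_Least[of "j - 1" "\<lambda>n. z [^] (p ^ n) = \<one>"] \<open>j \<noteq> 0\<close> unfolding c_def j_def by simp
  moreover have "c [^] p = \<one>"
  proof -
    have "p ^ (j - 1) * p = p ^ j" using \<open>j \<noteq> 0\<close> by (metis power_minus_mult neq0_conv)
    then show ?thesis using j z(1) by (simp add: c_def nat_pow_pow)
  qed
  moreover have "w \<otimes> c = c \<otimes> w" if "w \<in> carrier G" for w
    using group_commutes_pow[OF z(3)[OF that, symmetric] z(1) that] by (simp add: c_def)
  ultimately show ?thesis using z(1) that[of c] by (simp add: c_def)
qed

lemma power_subgroup_mono_dvd:
  assumes "m dvd n"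
  shows "power_subgroup G n \<subseteq> power_subgroup G m"
proof (rule power_subgroup_subset)
  obtain d where "n = m * d" using assms by (rule dvdE)
  then show "x [^] n \<in> power_subgroup G m" if "x \<in> carrier G" for x
    using that power_in_power_subgroup[of "x [^] d" m] by (simp add: nat_pow_pow mult.commute)
qed (rule normal_imp_subgroup[OF power_subgroup_normal])

text \<open>Otherwise let \<open>E\<close> be maximal among the normal subgroups that contain the second power subgroup
  but not all commutators of the first. The elements that are central of order at most \<open>p\<close> modulo
  \<open>E\<close> form a larger normal subgroup, which by maximality contains the commutators. This is the
  situation of \<open>power_subgroup_abelian_minimal\<close> in the quotient by \<open>E\<close>.\<close>

lemma derived_power_subgroup_le:
  assumes G: "p_subgroup G p (carrier G)"
    and card: "card (carrier G) \<le> p ^ t * card (power_subgroup G (p ^ (k + 3)))" and t: "t \<le> p ^ k"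
  shows "derived_set G (power_subgroup G (p ^ Suc k)) \<subseteq> power_subgroup G (p ^ (k + 3))"
proof (rule ccontr)
  define U where "U = power_subgroup G (p ^ Suc k)"
  define V where "V = power_subgroup G (p ^ (k + 3))"
  assume "\<not> derived_set G (power_subgroup G (p ^ Suc k)) \<subseteq> power_subgroup G (p ^ (k + 3))"
  then have not: "\<not> derived_set G U \<subseteq> V" by (simp only: U_def V_def not_False_eq_True)
  note GD = p_subgroupD[OF G]
  have nU: "U \<lhd> G" and nV: "V \<lhd> G" unfolding U_def V_def by (rule power_subgroup_normal)+
  have sU: "subgroup U G" using nU by (rule normal_imp_subgroup)
  have UG: "x \<in> carrier G" if "x \<in> U" for x using sU that by (rule subgroup.mem_carrier)
  define \<E> where "\<E> = {E. E \<lhd> G \<and> V \<subseteq> E \<and> \<not> derived_set G U \<subseteq> E}"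
  have "finite \<E>"
    using GD(3) normal_imp_subgroup subgroup.subset
    by (intro finite_subset[of \<E> "Pow (carrier G)"]) (fastforce simp: \<E>_def)+
  moreover have "V \<in> \<E>" using nV not by (auto simp: \<E>_def)
  ultimately obtain E where E: "E \<in> \<E>" and max: "\<And>L. L \<in> \<E> \<Longrightarrow> E \<subseteq> L \<Longrightarrow> E = L"
    using finite_has_maximal[of \<E>] by blast
  have E': "E \<lhd> G" "V \<subseteq> E" "\<not> derived_set G U \<subseteq> E" using E by (auto simp: \<E>_def)
  have sE: "subgroup E G" using E'(1) by (rule normal_imp_subgroup)
  let ?Q = "G Mod E"
  interpret \<pi>: group_hom G ?Q "\<lambda>x. E #> x" using E'(1) by (rule quotient_hom)
  have Q: "p_subgroup ?Q p (carrier ?Q)" using G E'(1) by (rule p_subgroup_quotient)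
  have cardQ: "card (carrier ?Q) \<le> p ^ t"
  proof -
    have finE: "finite E" using finite_subset[OF subgroup.subset[OF sE] GD(3)] .
    have "card (carrier ?Q) * card E = card (carrier G)" using card_quotient[OF E'(1)] .
    also have "\<dots> \<le> p ^ t * card V" using card by (simp add: V_def)
    also have "\<dots> \<le> p ^ t * card E" using E'(2) finE card_mono by (intro mult_le_mono2) blast
    finally show ?thesis using subgroup.finite_imp_card_positive[OF sE GD(3)] by simp
  qed
  have powU: "power_subgroup ?Q (p ^ Suc k) = (\<lambda>x. E #> x) ` U"
    unfolding U_def by (intro \<pi>.power_subgroup_image quotient_image_carrier)
  define \<Omega> where "\<Omega> = {c \<in> carrier ?Q. (\<forall>w\<in>carrier ?Q. w \<otimes>\<^bsub>?Q\<^esub> c = c \<otimes>\<^bsub>?Q\<^esub> w) \<and> c [^]\<^bsub>?Q\<^esub> p = \<one>\<^bsub>?Q\<^esub>}"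
  have n\<Omega>: "\<Omega> \<lhd> ?Q" unfolding \<Omega>_def by (rule \<pi>.H.central_torsion_normal)
  define W where "W = {x \<in> carrier G. E #> x \<in> \<Omega>}"
  have nW: "W \<lhd> G" unfolding W_def by (intro normal_preimage_quotient E'(1) n\<Omega>)
  have EW: "E \<subseteq> W"
  proof
    fix x assume x: "x \<in> E"
    then have "x \<in> carrier G" "E #> x = \<one>\<^bsub>?Q\<^esub>"
      using subgroup.mem_carrier[OF sE] quotient_one_iff[OF E'(1)] by auto
    then show "x \<in> W" using subgroup.one_closed[OF normal_imp_subgroup[OF n\<Omega>]] by (simp add: W_def)
  qed
  have "E \<noteq> W"
  proof -
    have "carrier ?Q \<noteq> {\<one>\<^bsub>?Q\<^esub>}"
    proof
      assume *: "carrier ?Q = {\<one>\<^bsub>?Q\<^esub>}"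
      have "x \<in> E" if "x \<in> carrier G" for x
        using \<pi>.hom_closed[OF that] quotient_one_iff[OF E'(1) that] unfolding * by simp
      then have "derived_set G U \<subseteq> E" using derived_set_in_carrier[of U] UG by blast
      then show False using E'(3) by blast
    qed
    then obtain c where c: "c \<in> carrier ?Q" "c \<noteq> \<one>\<^bsub>?Q\<^esub>"
      "\<And>w. w \<in> carrier ?Q \<Longrightarrow> w \<otimes>\<^bsub>?Q\<^esub> c = c \<otimes>\<^bsub>?Q\<^esub> w" "c [^]\<^bsub>?Q\<^esub> p = \<one>\<^bsub>?Q\<^esub>"
      using \<pi>.H.p_group_central_torsion_nontrivial[OF Q] by blast
    obtain y where y: "y \<in> carrier G" "c = E #> y" using c(1) unfolding carrier_FactGroup by blast
    have "y \<in> W" using c y unfolding W_def \<Omega>_def by blast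
    moreover have "y \<notin> E" using c(2) y quotient_one_iff[OF E'(1)] by simp
    ultimately show ?thesis by blast
  qed
  then have "W \<notin> \<E>" using max EW by blast
  then have dW: "derived_set G U \<subseteq> W" using nW EW E'(2) by (auto simp: \<E>_def)
  have comm\<Omega>: "x \<otimes>\<^bsub>?Q\<^esub> y \<otimes>\<^bsub>?Q\<^esub> inv\<^bsub>?Q\<^esub> x \<otimes>\<^bsub>?Q\<^esub> inv\<^bsub>?Q\<^esub> y \<in> \<Omega>"
    if xy: "x \<in> power_subgroup ?Q (p ^ Suc k)" "y \<in> power_subgroup ?Q (p ^ Suc k)" for x y
  proof -
    obtain u v where uv: "u \<in> U" "v \<in> U" "x = E #> u" "y = E #> v" using xy unfolding powU by blast
    have "u \<otimes> v \<otimes> inv u \<otimes> inv v \<in> W" using dW uv by blast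
    moreover have "E #> (u \<otimes> v \<otimes> inv u \<otimes> inv v) = x \<otimes>\<^bsub>?Q\<^esub> y \<otimes>\<^bsub>?Q\<^esub> inv\<^bsub>?Q\<^esub> x \<otimes>\<^bsub>?Q\<^esub> inv\<^bsub>?Q\<^esub> y"
      using uv UG by (simp del: mult_FactGroup)
    ultimately show ?thesis by (simp add: W_def del: mult_FactGroup)
  qed
  have abelian: "x \<otimes>\<^bsub>?Q\<^esub> y = y \<otimes>\<^bsub>?Q\<^esub> x"
    if xy: "x \<in> power_subgroup ?Q (p ^ Suc k)" "y \<in> power_subgroup ?Q (p ^ Suc k)" for x y
  proof (rule \<pi>.H.power_subgroup_abelian_minimal[OF Q cardQ t _ _ _ xy])
    fix x assume "x \<in> carrier ?Q"
    then obtain g where g: "g \<in> carrier G" "x = E #> g" unfolding carrier_FactGroup by blast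
    have "E #> g [^] (p ^ (k + 3)) = \<one>\<^bsub>?Q\<^esub>"
      using quotient_one_iff[OF E'(1)] power_in_power_subgroup[OF g(1)] E'(2) g(1) unfolding V_def by auto
    then show "x [^]\<^bsub>?Q\<^esub> p ^ (k + 3) = \<one>\<^bsub>?Q\<^esub>" using g \<pi>.hom_nat_pow by simp
  next
    fix u v assume "u \<in> power_subgroup ?Q (p ^ Suc k)" "v \<in> power_subgroup ?Q (p ^ Suc k)"
    from comm\<Omega>[OF this] show "(u \<otimes>\<^bsub>?Q\<^esub> v \<otimes>\<^bsub>?Q\<^esub> inv\<^bsub>?Q\<^esub> u \<otimes>\<^bsub>?Q\<^esub> inv\<^bsub>?Q\<^esub> v) [^]\<^bsub>?Q\<^esub> p = \<one>\<^bsub>?Q\<^esub>"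
      unfolding \<Omega>_def by blast
  next
    fix u v w assume "u \<in> power_subgroup ?Q (p ^ Suc k)" "v \<in> power_subgroup ?Q (p ^ Suc k)" and w: "w \<in> carrier ?Q"
    from comm\<Omega>[OF this(1,2)] have "\<forall>w\<in>carrier ?Q. w \<otimes>\<^bsub>?Q\<^esub> (u \<otimes>\<^bsub>?Q\<^esub> v \<otimes>\<^bsub>?Q\<^esub> inv\<^bsub>?Q\<^esub> u \<otimes>\<^bsub>?Q\<^esub> inv\<^bsub>?Q\<^esub> v)
        = (u \<otimes>\<^bsub>?Q\<^esub> v \<otimes>\<^bsub>?Q\<^esub> inv\<^bsub>?Q\<^esub> u \<otimes>\<^bsub>?Q\<^esub> inv\<^bsub>?Q\<^esub> v) \<otimes>\<^bsub>?Q\<^esub> w"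
      unfolding \<Omega>_def by blast
    from bspec[OF this w, symmetric] show "(u \<otimes>\<^bsub>?Q\<^esub> v \<otimes>\<^bsub>?Q\<^esub> inv\<^bsub>?Q\<^esub> u \<otimes>\<^bsub>?Q\<^esub> inv\<^bsub>?Q\<^esub> v) \<otimes>\<^bsub>?Q\<^esub> w
        = w \<otimes>\<^bsub>?Q\<^esub> (u \<otimes>\<^bsub>?Q\<^esub> v \<otimes>\<^bsub>?Q\<^esub> inv\<^bsub>?Q\<^esub> u \<otimes>\<^bsub>?Q\<^esub> inv\<^bsub>?Q\<^esub> v)"
      .
  qed
  have "u \<otimes> v \<otimes> inv u \<otimes> inv v \<in> E" if uv: "u \<in> U" "v \<in> U" for u v
  proof -
    have "E #> (u \<otimes> v) = E #> (v \<otimes> u)"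
      using abelian[of "E #> u" "E #> v"] uv UG unfolding powU by (simp del: mult_FactGroup)
    then have "u \<otimes> v \<otimes> inv (v \<otimes> u) \<in> E"
      using uv UG by (intro quotient_eq_iff[OF E'(1), THEN iffD1]) auto
    then show ?thesis using uv UG by (simp add: inv_mult_group m_assoc)
  qed
  then show False using E'(3) by blast
qed

text \<open>Powers are multiplicative modulo \<open>V\<close>, as \<open>U\<close> is abelian modulo \<open>V\<close>.\<close>

lemma power_map_hom:
  assumes D: "derived_set G U \<subseteq> V" and U: "subgroup U G" and V: "V \<lhd> G"
  shows "group_hom (G\<lparr>carrier := U\<rparr>) (G Mod V) (\<lambda>x. V #> (x [^] (n::nat)))"
proof -
  interpret \<pi>: group_hom G "G Mod V" "\<lambda>x. V #> x" using V by (rule quotient_hom)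
  have UG: "x \<in> carrier G" if "x \<in> U" for x using U that by (rule subgroup.mem_carrier)
  have "V #> ((x \<otimes> y) [^] n) = (V #> (x [^] n)) \<otimes>\<^bsub>G Mod V\<^esub> (V #> (y [^] n))" if xy: "x \<in> U" "y \<in> U" for x y
  proof -
    have "x \<otimes> y \<otimes> inv (y \<otimes> x) \<in> V"
    proof -
      have "x \<otimes> y \<otimes> inv x \<otimes> inv y \<in> V" using D xy by blast
      then show ?thesis using xy UG by (simp add: inv_mult_group m_assoc)
    qed
    then have "V #> (x \<otimes> y) = V #> (y \<otimes> x)"
      using xy UG by (intro quotient_eq_iff[OF V, THEN iffD2]) auto
    then have "(V #> x) \<otimes>\<^bsub>G Mod V\<^esub> (V #> y) = (V #> y) \<otimes>\<^bsub>G Mod V\<^esub> (V #> x)"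
      using xy UG by (simp del: mult_FactGroup)
    then have "((V #> x) \<otimes>\<^bsub>G Mod V\<^esub> (V #> y)) [^]\<^bsub>G Mod V\<^esub> n
        = (V #> x) [^]\<^bsub>G Mod V\<^esub> n \<otimes>\<^bsub>G Mod V\<^esub> (V #> y) [^]\<^bsub>G Mod V\<^esub> n"
      using xy UG by (intro \<pi>.H.pow_mult_distrib) auto
    then show ?thesis using xy UG by (simp add: \<pi>.hom_nat_pow del: mult_FactGroup)
  qed
  then have "(\<lambda>x. V #> (x [^] n)) \<in> hom (G\<lparr>carrier := U\<rparr>) (G Mod V)"
    using UG by (intro homI) (simp_all del: mult_FactGroup)
  then show ?thesis
    using subgroup_imp_group[OF U] \<pi>.H.is_group by (intro group_hom.intro group_hom_axioms.intro)
qed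

text \<open>It suffices to consider the generators \<open>y [^] (p ^ j)\<close>, as \<open>p\<close>-th powers are multiplicative
  modulo \<open>power_subgroup G (p ^ (j + 2))\<close>, which is contained in the target.\<close>

lemma power_map_power_subgroup:
  assumes D: "derived_set G (power_subgroup G (p ^ j)) \<subseteq> power_subgroup G (p ^ (j + 2))"
    and x: "x \<in> power_subgroup G (p ^ j)"
  shows "x [^] p \<in> power_subgroup G (p ^ Suc j)"
proof -
  define U where "U = power_subgroup G (p ^ j)"
  define V where "V = power_subgroup G (p ^ (j + 2))"
  define W where "W = power_subgroup G (p ^ Suc j)"
  have n: "U \<lhd> G" "V \<lhd> G" "W \<lhd> G" unfolding U_def V_def W_def by (rule power_subgroup_normal)+
  note s = n[THEN normal_imp_subgroup]
  have UG: "x \<in> carrier G" if "x \<in> U" for x using s(1) that by (rule subgroup.mem_carrier)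
  have VW: "V \<subseteq> W" unfolding V_def W_def by (intro power_subgroup_mono_dvd le_imp_power_dvd) simp
  interpret \<theta>: group_hom "G\<lparr>carrier := U\<rparr>" "G Mod V" "\<lambda>x. V #> (x [^] p)"
    using D s(1) n(2) unfolding U_def V_def by (rule power_map_hom)
  have prod: "(u \<otimes> v) [^] p \<in> W" if uv: "u \<in> U" "v \<in> U" "u [^] p \<in> W" "v [^] p \<in> W" for u v
  proof -
    interpret \<pi>: group_hom G "G Mod V" "\<lambda>x. V #> x" using n(2) by (rule quotient_hom)
    have "V #> ((u \<otimes> v) [^] p) = V #> (u [^] p \<otimes> v [^] p)"
      using \<theta>.hom_mult[of u v] uv UG by (simp del: mult_FactGroup)
    then have "(u \<otimes> v) [^] p \<otimes> inv (u [^] p \<otimes> v [^] p) \<in> V"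
      using uv UG by (intro quotient_eq_iff[OF n(2), THEN iffD1]) auto
    then have "(u \<otimes> v) [^] p \<otimes> inv (u [^] p \<otimes> v [^] p) \<in> W" using VW by blast
    then have "(u \<otimes> v) [^] p \<otimes> inv (u [^] p \<otimes> v [^] p) \<otimes> (u [^] p \<otimes> v [^] p) \<in> W"
      using subgroup.m_closed[OF s(3) uv(3,4)] by (rule subgroup.m_closed[OF s(3)])
    then show ?thesis using uv UG by (simp add: m_assoc)
  qed
  have "subgroup {u \<in> U. u [^] p \<in> W} G" (is "subgroup ?S G")
  proof (rule subgroupI)
    show "?S \<subseteq> carrier G" using UG by auto
    show "?S \<noteq> {}" using subgroup.one_closed[OF s(1)] subgroup.one_closed[OF s(3)] by (auto intro!: exI[of _ \<one>])
    show "inv a \<in> ?S" if "a \<in> ?S" for a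
      using that UG subgroup.m_inv_closed[OF s(1)] subgroup.m_inv_closed[OF s(3)] by (simp add: nat_pow_inv)
    show "a \<otimes> b \<in> ?S" if "a \<in> ?S" "b \<in> ?S" for a b
      using that prod subgroup.m_closed[OF s(1)] by simp
  qed
  moreover have "y [^] (p ^ j) \<in> ?S" if y: "y \<in> carrier G" for y
    using power_in_power_subgroup[OF y] y unfolding U_def W_def by (simp add: nat_pow_pow mult.commute)
  ultimately have "power_subgroup G (p ^ j) \<subseteq> ?S" by (intro power_subgroup_subset)
  then show ?thesis using x by (auto simp: W_def)
qed

text \<open>The \<open>p\<close>-th powers of the generators \<open>y [^] (p ^ j)\<close> are the generators of the next power subgroup.\<close>

lemma power_map_image:
  assumes D: "derived_set G (power_subgroup G (p ^ j)) \<subseteq> power_subgroup G (p ^ (j + 2))"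
  shows "(\<lambda>x. power_subgroup G (p ^ (j + 2)) #> (x [^] p)) ` power_subgroup G (p ^ j)
    = (\<lambda>x. power_subgroup G (p ^ (j + 2)) #> x) ` power_subgroup G (p ^ Suc j)"
proof -
  define U where "U = power_subgroup G (p ^ j)"
  define V where "V = power_subgroup G (p ^ (j + 2))"
  have n: "U \<lhd> G" "V \<lhd> G" unfolding U_def V_def by (rule power_subgroup_normal)+
  interpret \<theta>: group_hom "G\<lparr>carrier := U\<rparr>" "G Mod V" "\<lambda>x. V #> (x [^] p)"
    using D normal_imp_subgroup[OF n(1)] n(2) unfolding U_def V_def by (rule power_map_hom)
  have "subgroup ((\<lambda>x. V #> (x [^] p)) ` U) (G Mod V)" using \<theta>.img_is_subgroup by simp
  then have "subgroup {x \<in> carrier G. V #> x \<in> (\<lambda>x. V #> (x [^] p)) ` U} G"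
    by (rule subgroup_preimage_quotient[OF n(2)])
  moreover have "y [^] (p ^ Suc j) \<in> {x \<in> carrier G. V #> x \<in> (\<lambda>x. V #> (x [^] p)) ` U}"
    if y: "y \<in> carrier G" for y
  proof -
    have "y [^] (p ^ Suc j) = (y [^] (p ^ j)) [^] p" using y by (simp add: nat_pow_pow mult.commute)
    moreover have "y [^] (p ^ j) \<in> U" unfolding U_def using y by (rule power_in_power_subgroup)
    ultimately show ?thesis using y by simp
  qed
  ultimately have "power_subgroup G (p ^ Suc j) \<subseteq> {x \<in> carrier G. V #> x \<in> (\<lambda>x. V #> (x [^] p)) ` U}"
    by (intro power_subgroup_subset)
  then show ?thesis
    using power_map_power_subgroup[OF D] unfolding U_def V_def by blast
qed

end

section \<open>The rank of a \<open>p\<close>-group with slowly growing index\<close>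

text \<open>Twice the exponent \<open>(c + k0 + 2) * a\<close> that belongs to the power subgroup for \<open>k0 + 2\<close>, where
  \<open>k0 = (c + 4) * a + 4\<close> is so large that from \<open>k0 + 1\<close> on each power subgroup is abelian modulo the
  next but one. One half generates the intersection of a subgroup with the power subgroup for
  \<open>k0 + 1\<close>, the other half the rest.\<close>

definition p_rank_bound :: "nat \<Rightarrow> nat \<Rightarrow> nat" where
  "p_rank_bound c a = 2 * (c + ((c + 4) * a + 4) + 2) * a"

lemma square_le_two_power: "4 \<le> k \<Longrightarrow> k * k \<le> (2::nat) ^ k"
proof (induction k rule: dec_induct)
  case (step k)
  have "2 * k + 1 \<le> k * k" using mult_le_mono1[OF step(1), of k] step(1) by linarith
  then show ?case using step by simp
qed simp

context group begin

text \<open>Let \<open>U\<close>, \<open>W\<close>, \<open>V\<close> be the power subgroups for \<open>j\<close>, \<open>j + 1\<close>, \<open>j + 2\<close>. The \<open>p\<close>-th power map sends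
  \<open>U\<close> onto \<open>W / V\<close> and \<open>H \<inter> U\<close> into the image of \<open>K \<inter> W\<close>. Its kernel contains \<open>W\<close>, so
  \<open>card_Int_mult_le\<close> compares the kernel on \<open>H \<inter> U\<close> with \<open>H \<inter> W\<close>, to which the induction
  hypothesis applies.\<close>

lemma power_chain_count_step:
  assumes fin: "finite (carrier G)"
    and D: "derived_set G (power_subgroup G (p ^ j)) \<subseteq> power_subgroup G (p ^ (j + 2))"
    and D': "derived_set G (power_subgroup G (p ^ Suc j)) \<subseteq> power_subgroup G (p ^ (Suc j + 2))"
    and H: "subgroup H G" and K: "subgroup K G" and HK: "\<And>x. x \<in> H \<Longrightarrow> x [^] p \<in> K"
    and IH: "card (H \<inter> power_subgroup G (p ^ Suc j)) * card (power_subgroup G (p ^ (j + 2)))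
      \<le> card (K \<inter> power_subgroup G (p ^ (j + 2))) * card (power_subgroup G (p ^ Suc j))"
  shows "card (H \<inter> power_subgroup G (p ^ j)) * card (power_subgroup G (p ^ Suc j))
      \<le> card (K \<inter> power_subgroup G (p ^ Suc j)) * card (power_subgroup G (p ^ j))"
proof -
  define U where "U = power_subgroup G (p ^ j)"
  define V where "V = power_subgroup G (p ^ (j + 2))"
  define W where "W = power_subgroup G (p ^ Suc j)"
  have n: "U \<lhd> G" "V \<lhd> G" "W \<lhd> G" unfolding U_def V_def W_def by (rule power_subgroup_normal)+
  note s = n[THEN normal_imp_subgroup]
  have VW: "V \<subseteq> W" unfolding V_def W_def by (intro power_subgroup_mono_dvd le_imp_power_dvd) simp
  have WU: "W \<subseteq> U" unfolding U_def W_def by (intro power_subgroup_mono_dvd le_imp_power_dvd) simp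
  have finS: "finite S" if "subgroup S G" for S using finite_subset[OF subgroup.subset[OF that] fin] .
  have UG: "x \<in> carrier G" if "x \<in> U" for x using s(1) that by (rule subgroup.mem_carrier)
  interpret \<theta>: group_hom "G\<lparr>carrier := U\<rparr>" "G Mod V" "\<lambda>x. V #> (x [^] p)"
    using D s(1) n(2) unfolding U_def V_def by (rule power_map_hom)
  have \<theta>_one: "V #> (x [^] p) = \<one>\<^bsub>G Mod V\<^esub> \<longleftrightarrow> x [^] p \<in> V" if "x \<in> U" for x
    using quotient_one_iff[OF n(2)] UG[OF that] by simp
  define Ker where "Ker = {x \<in> U. x [^] p \<in> V}"
  have sKer: "subgroup Ker G"
  proof -
    have "Ker = kernel (G\<lparr>carrier := U\<rparr>) (G Mod V) (\<lambda>x. V #> (x [^] p))"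
      using \<theta>_one by (auto simp: Ker_def kernel_def)
    then have "subgroup Ker (G\<lparr>carrier := U\<rparr>)" using \<theta>.subgroup_kernel by simp
    then show ?thesis using s(1) by (rule incl_subgroup[rotated])
  qed
  have WKer: "W \<subseteq> Ker"
    using power_map_power_subgroup[OF D'] WU by (auto simp: Ker_def W_def V_def)
  have split: "card S = card ((\<lambda>x. V #> (x [^] p)) ` S) * card (S \<inter> Ker)" if S: "subgroup S G" "S \<subseteq> U" for S
  proof -
    have "subgroup S (G\<lparr>carrier := U\<rparr>)" using subgroup_incl[OF S(1) s(1) S(2)] .
    then have "card S = card ((\<lambda>x. V #> (x [^] p)) ` S) * card {x \<in> S. V #> (x [^] p) = \<one>\<^bsub>G Mod V\<^esub>}"
      using finS[OF S(1)] by (rule \<theta>.card_subgroup_image)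
    moreover have "{x \<in> S. V #> (x [^] p) = \<one>\<^bsub>G Mod V\<^esub>} = S \<inter> Ker"
      using S(2) \<theta>_one by (auto simp: Ker_def)
    ultimately show ?thesis by simp
  qed
  have sHU: "subgroup (H \<inter> U) G" using H s(1) by (rule subgroups_Inter_pair)
  define eH where "eH = card ((\<lambda>x. V #> (x [^] p)) ` (H \<inter> U))"
  define eK where "eK = card ((\<lambda>x. V #> x) ` (K \<inter> W))"
  define eW where "eW = card ((\<lambda>x. V #> x) ` W)"
  have cU: "card U = eW * card Ker"
  proof -
    have "(\<lambda>x. V #> (x [^] p)) ` U = (\<lambda>x. V #> x) ` W"
      using power_map_image[OF D] by (simp add: U_def V_def W_def)
    moreover have "U \<inter> Ker = Ker" by (auto simp: Ker_def)
    ultimately show ?thesis using split[OF s(1)] by (simp add: eW_def)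
  qed
  have cW: "card W = eW * card V"
    using card_subgroup_quotient_image[OF n(2) s(3) finS[OF s(3)]] VW by (simp add: eW_def Int_absorb1)
  have cK: "card (K \<inter> W) = eK * card (K \<inter> V)"
  proof -
    have "K \<inter> W \<inter> V = K \<inter> V" using VW by blast
    then show ?thesis
      using card_subgroup_quotient_image[OF n(2) subgroups_Inter_pair[OF K s(3)]] finS[OF s(3)] by (simp add: eK_def)
  qed
  have "H \<inter> U \<inter> Ker = H \<inter> Ker" by (auto simp: Ker_def)
  then have cH: "card (H \<inter> U) = eH * card (H \<inter> Ker)"
    using split[OF sHU] by (simp add: eH_def)
  have le_e: "eH \<le> eK"
  proof -
    have "(\<lambda>x. V #> (x [^] p)) ` (H \<inter> U) \<subseteq> (\<lambda>x. V #> x) ` (K \<inter> W)"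
      using HK power_map_power_subgroup[OF D] unfolding U_def W_def by blast
    then show ?thesis unfolding eH_def eK_def using finS[OF s(3)] by (intro card_mono) auto
  qed
  have le_Ker: "card (H \<inter> Ker) * card W \<le> card (H \<inter> W) * card Ker"
    using card_Int_mult_le[OF n(3) WKer H sKer finS[OF sKer]] .
  have IH': "card (H \<inter> W) * card V \<le> card (K \<inter> V) * card W" using IH by (simp add: V_def W_def)
  have posV: "card V > 0" using subgroup.finite_imp_card_positive[OF s(2) fin] .
  have "card (H \<inter> U) * card W * card V = eH * (card (H \<inter> Ker) * card W) * card V"
    by (simp add: cH mult_ac)
  also have "\<dots> \<le> eK * (card (H \<inter> W) * card Ker) * card V"
    by (intro mult_le_mono le_e le_Ker order_refl)
  also have "\<dots> = eK * card Ker * (card (H \<inter> W) * card V)" by (simp add: mult_ac)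
  also have "\<dots> \<le> eK * card Ker * (card (K \<inter> V) * card W)" by (intro mult_le_mono IH' order_refl)
  also have "\<dots> = card (K \<inter> W) * card U * card V" unfolding cK cU cW by (simp add: mult_ac)
  finally have "card (H \<inter> U) * card W \<le> card (K \<inter> W) * card U" using posV by simp
  then show ?thesis by (simp add: U_def W_def)
qed

text \<open>Downward induction, starting where the power subgroups are trivial.\<close>

lemma power_chain_count:
  assumes G: "p_subgroup G p (carrier G)"
    and D: "\<And>j. k \<le> j \<Longrightarrow> derived_set G (power_subgroup G (p ^ j)) \<subseteq> power_subgroup G (p ^ (j + 2))"
    and H: "subgroup H G" and K: "subgroup K G" and HK: "\<And>x. x \<in> H \<Longrightarrow> x [^] p \<in> K"
  shows "card (H \<inter> power_subgroup G (p ^ k)) * card (power_subgroup G (p ^ Suc k))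
      \<le> card (K \<inter> power_subgroup G (p ^ Suc k)) * card (power_subgroup G (p ^ k))"
proof -
  note GD = p_subgroupD[OF G]
  obtain m where m: "card (carrier G) = p ^ m" using G by (auto simp: p_subgroup_def)
  have triv: "power_subgroup G (p ^ j) = {\<one>}" if "m \<le> j" for j
  proof -
    have "x [^] (p ^ j) = \<one>" if "x \<in> carrier G" for x
    proof -
      have "p ^ j = p ^ m * p ^ (j - m)" using \<open>m \<le> j\<close> by (simp flip: power_add)
      then show ?thesis
        using pow_card_subgroup[OF GD(2) that] that m by (simp flip: nat_pow_pow)
    qed
    then have "power_subgroup G (p ^ j) \<subseteq> {\<one>}" by (intro power_subgroup_subset triv_subgroup) auto
    then show ?thesis using subgroup.one_closed[OF normal_imp_subgroup[OF power_subgroup_normal]] by blast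
  qed
  have "k \<le> max m k" by simp
  then show ?thesis
  proof (induction k rule: inc_induct)
    case base
    have "power_subgroup G (p ^ max m k) = {\<one>}" "power_subgroup G (p ^ Suc (max m k)) = {\<one>}"
      using triv[of "max m k"] triv[of "Suc (max m k)"] by (simp_all del: power_Suc)
    then show ?case
      using subgroup.one_closed[OF H] subgroup.one_closed[OF K] by (simp add: Int_absorb1 del: power_Suc)
  next
    case (step j)
    have Dj: "derived_set G (power_subgroup G (p ^ j)) \<subseteq> power_subgroup G (p ^ (j + 2))"
      and Dj': "derived_set G (power_subgroup G (p ^ Suc j)) \<subseteq> power_subgroup G (p ^ (Suc j + 2))"
      using D[of j] D[of "Suc j"] step(1) by linarith+
    show ?case
      using power_chain_count_step[OF GD(3) Dj Dj' H K HK] step(3) by (simp del: power_Suc)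
  qed
qed

text \<open>With \<open>H0\<close> the intersection of \<open>H\<close> and a late power subgroup and \<open>K\<close> its Frattini subgroup,
  \<open>power_chain_count\<close> bounds the index of \<open>K\<close> in \<open>H0\<close>, and the hypothesis on the indices bounds that
  of \<open>H0\<close> in \<open>H\<close>.\<close>

theorem p_group_rank_le:
  assumes G: "p_subgroup G p (carrier G)"
    and index: "\<And>k. card (carrier G) \<le> p ^ ((c + k) * a) * card (power_subgroup G (p ^ k))"
    and H: "subgroup H G"
  shows "\<exists>X. X \<subseteq> H \<and> finite X \<and> card X \<le> p_rank_bound c a \<and> generate G X = H"
proof -
  note GD = p_subgroupD[OF G]
  define k0 where "k0 = (c + 4) * a + 4"
  define P where "P j = power_subgroup G (p ^ j)" for j
  have nP: "P j \<lhd> G" for j unfolding P_def by (rule power_subgroup_normal)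
  have sP: "subgroup (P j) G" for j using nP by (rule normal_imp_subgroup)
  have D: "derived_set G (P j) \<subseteq> P (j + 2)" if j: "Suc k0 \<le> j" for j
  proof -
    obtain k where k: "j = Suc k" "k0 \<le> k" using j by (cases j) auto
    \<comment> \<open>The exponent is linear in \<open>k\<close>, so for \<open>k \<ge> k0\<close> it is at most \<open>k * k\<close> and hence at most \<open>p ^ k\<close>.\<close>
    have "(c + (k + 3)) * a \<le> ((c + 4) * k) * a"
    proof (intro mult_le_mono1)
      have "1 \<le> k" using k(2) by (simp add: k0_def)
      then have "c * 1 \<le> c * k" by (rule mult_le_mono2)
      moreover have "(c + 4) * k = c * k + 4 * k" by (simp add: add_mult_distrib)
      ultimately show "c + (k + 3) \<le> (c + 4) * k" using \<open>1 \<le> k\<close> by linarith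
    qed
    also have "\<dots> = ((c + 4) * a) * k" by (simp add: mult_ac)
    also have "\<dots> \<le> k * k" using k(2) by (intro mult_le_mono1) (simp add: k0_def)
    also have "\<dots> \<le> 2 ^ k" using k(2) by (intro square_le_two_power) (simp add: k0_def)
    also have "\<dots> \<le> p ^ k" using prime_ge_2_nat[OF GD(1)] by (intro power_mono) auto
    finally have "(c + (k + 3)) * a \<le> p ^ k" .
    from derived_power_subgroup_le[OF G index this] show ?thesis
      by (simp only: P_def k(1) add_Suc numeral_3_eq_3 numeral_2_eq_2 add_Suc_right add_0_right)
  qed
  define H0 where "H0 = H \<inter> P (Suc k0)"
  have sH0: "subgroup H0 G" unfolding H0_def using H sP by (rule subgroups_Inter_pair)
  have H0H: "H0 \<subseteq> H" by (auto simp: H0_def)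
  have HG: "H \<subseteq> carrier G" using H by (rule subgroup.subset)
  have pH: "p_subgroup G p H" using p_subgroup_mono[OF G H HG] .
  have pH0: "p_subgroup G p H0" using p_subgroup_mono[OF pH sH0 H0H] .
  define K where "K = p_frattini G p H0"
  have sK: "subgroup K G" unfolding K_def using sH0 by (rule p_frattini_subgroup)
  have HK: "x [^] p \<in> K" if "x \<in> H0" for x
    using that unfolding K_def p_frattini_def by (intro generate.incl) blast
  have pos: "card (P j) > 0" for j using subgroup.finite_imp_card_positive[OF sP GD(3)] .
  define t where "t = (c + k0 + 2) * a"
  have "card H0 * card (P (Suc (Suc k0))) \<le> card K * p ^ t * card (P (Suc (Suc k0)))"
  proof -
    have "card (H0 \<inter> P (Suc k0)) * card (P (Suc (Suc k0))) \<le> card (K \<inter> P (Suc (Suc k0))) * card (P (Suc k0))"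
      using power_chain_count[OF G _ sH0 sK HK, of "Suc k0"] D unfolding P_def by blast
    moreover have "H0 \<inter> P (Suc k0) = H0" by (auto simp: H0_def)
    ultimately have "card H0 * card (P (Suc (Suc k0))) \<le> card (K \<inter> P (Suc (Suc k0))) * card (P (Suc k0))"
      by simp
    also have "\<dots> \<le> card K * (p ^ t * card (P (Suc (Suc k0))))"
    proof (intro mult_le_mono)
      show "card (K \<inter> P (Suc (Suc k0))) \<le> card K"
        using finite_subset[OF subgroup.subset[OF sK] GD(3)] by (intro card_mono) auto
      have "card (P (Suc k0)) \<le> card (carrier G)"
        using subgroup.subset[OF sP] GD(3) by (intro card_mono)
      then show "card (P (Suc k0)) \<le> p ^ t * card (P (Suc (Suc k0)))"
        using index[of "Suc (Suc k0)"] by (simp add: P_def t_def)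
    qed
    finally show ?thesis by (simp only: mult.assoc)
  qed
  then have "card H0 \<le> p ^ t * card K" using pos by (simp add: mult.commute)
  then obtain X0 where X0: "X0 \<subseteq> H0" "finite X0" "card X0 \<le> t" "generate G X0 = H0"
    using p_subgroup_generators_bound[OF GD(3) pH0] unfolding K_def by blast
  obtain X1 where X1: "X1 \<subseteq> H" "finite X1" "generate G (H0 \<union> X1) = H" "p ^ card X1 * card H0 \<le> card H"
    using p_subgroup_complete_generators[OF pH sH0 H0H] by blast
  have "card X1 \<le> t"
  proof -
    have "card H * card (P (Suc k0)) \<le> card H0 * card (carrier G)"
      using card_Int_mult_le[OF nP _ H GD(2,3), of "Suc k0"] subgroup.subset[OF sP] HG
      by (simp add: H0_def Int_absorb2)
    also have "\<dots> \<le> card H0 * (p ^ t * card (P (Suc k0)))"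
    proof (intro mult_le_mono2)
      have "p ^ ((c + Suc k0) * a) \<le> p ^ t"
        using prime_gt_0_nat[OF GD(1)] unfolding t_def by (intro power_increasing mult_le_mono1) auto
      then show "card (carrier G) \<le> p ^ t * card (P (Suc k0))"
        using index[of "Suc k0"] unfolding P_def by (meson le_trans mult_le_mono1)
    qed
    finally have "card H \<le> card H0 * p ^ t" using pos[of "Suc k0"] by (simp add: mult.assoc[symmetric])
    then have "p ^ card X1 * card H0 \<le> p ^ t * card H0" using X1(4) by (metis le_trans mult.commute)
    then have "p ^ card X1 \<le> p ^ t" using p_subgroupD(5)[OF pH0] by simp
    then show ?thesis using prime_gt_1_nat[OF GD(1)] by simp
  qed
  have "generate G (X0 \<union> X1) = H"
  proof
    have "X0 \<union> X1 \<subseteq> H" using X0 X1 H0H by blast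
    then show "generate G (X0 \<union> X1) \<subseteq> H" by (intro generate_subgroup_incl H)
    have s: "subgroup (generate G (X0 \<union> X1)) G" using X0 X1 H0H HG by (intro generate_is_subgroup) blast
    have "H0 \<subseteq> generate G (X0 \<union> X1)" unfolding X0(4)[symmetric] by (rule mono_generate) simp
    then have "H0 \<union> X1 \<subseteq> generate G (X0 \<union> X1)" by (auto intro: generate.incl)
    then show "H \<subseteq> generate G (X0 \<union> X1)" unfolding X1(3)[symmetric] by (intro generate_subgroup_incl s)
  qed
  moreover have "card (X0 \<union> X1) \<le> p_rank_bound c a"
  proof -
    have "card (X0 \<union> X1) \<le> t + t" using card_Un_le[of X0 X1] X0(3) \<open>card X1 \<le> t\<close> by linarith
    also have "\<dots> = p_rank_bound c a" by (simp add: p_rank_bound_def t_def k0_def algebra_simps)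
    finally show ?thesis .
  qed
  ultimately show ?thesis using X0 X1 H0H by (intro exI[of _ "X0 \<union> X1"]) auto
qed

end

section \<open>Normal \<open>p\<close>-subgroups of finite soluble groups\<close>

lemma only_prime_divisor_imp_power:
  fixes n p :: nat
  assumes "n > 0" "prime p" "\<And>q. prime q \<Longrightarrow> q dvd n \<Longrightarrow> q = p"
  shows "\<exists>k. n = p ^ k"
proof -
  obtain m where m: "n = p ^ multiplicity p n * m" "\<not> p dvd m"
    using assms by (metis multiplicity_decompose' neq0_conv not_prime_unit)
  have "m = 1"
  proof (rule ccontr)
    assume "m \<noteq> 1"
    then obtain q where "prime q" "q dvd m" using prime_factor_nat by blast
    then show False using assms(3)[of q] m by (metis dvd_mult)
  qed
  then show ?thesis using m by auto
qed

context group begin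

lemma prime_power_order_element:
  assumes fin: "finite (carrier G)" and S: "subgroup S G" and q: "prime q" "q dvd card S"
  obtains x n where "x \<in> S" "x \<noteq> \<one>" "x [^] (q ^ n :: nat) = \<one>"
proof -
  have finS: "finite S" using finite_subset[OF subgroup.subset[OF S] fin] .
  have "card S > 0" using subgroup.finite_imp_card_positive[OF S fin] .
  then obtain m where m: "card S = q ^ multiplicity q (card S) * m" "\<not> q dvd m"
    using q by (metis multiplicity_decompose' neq0_conv not_prime_unit)
  define n where "n = multiplicity q (card S)"
  have "n > 0" using q \<open>card S > 0\<close> unfolding n_def by (simp add: prime_multiplicity_gt_zero_iff)
  interpret S: group "G\<lparr>carrier := S\<rparr>" using S by (rule subgroup_imp_group)
  obtain T where T: "subgroup T (G\<lparr>carrier := S\<rparr>)" "card T = q ^ n"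
    using sylow_thm[OF q(1) S.is_group, of n m] m(1) finS unfolding n_def by (auto simp: order_def)
  have TG: "subgroup T G" "T \<subseteq> S" using T(1) incl_subgroup[OF S] subgroup.subset by fastforce+
  have "q ^ n \<noteq> 1" using one_less_power[OF prime_gt_1_nat[OF q(1)] \<open>n > 0\<close>] by (metis less_irrefl)
  then have "T \<noteq> {\<one>}" using T(2) by (metis is_singletonI is_singleton_altdef)
  then obtain x where "x \<in> T" "x \<noteq> \<one>" using subgroup.one_closed[OF TG(1)] by blast
  then show ?thesis using that[of x n] TG pow_card_subgroup[OF TG(1), of x] T(2) by auto
qed

lemma p_subgroup_if_elements:
  assumes fin: "finite (carrier G)" and S: "subgroup S G" and p: "prime p"
    and el: "\<And>x. x \<in> S \<Longrightarrow> \<exists>n. x [^] (p ^ n :: nat) = \<one>"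
  shows "p_subgroup G p S"
proof -
  have "q = p" if q: "prime q" "q dvd card S" for q
  proof (rule ccontr)
    assume "q \<noteq> p"
    obtain x n where x: "x \<in> S" "x \<noteq> \<one>" "x [^] (q ^ n :: nat) = \<one>"
      using prime_power_order_element[OF fin S q] by blast
    obtain m where m: "x [^] (p ^ m :: nat) = \<one>" using el[OF x(1)] by blast
    have "coprime (q ^ n) (p ^ m)" using \<open>q \<noteq> p\<close> q(1) p by (simp add: primes_coprime)
    then show False using pow_coprime_one[OF subgroup.mem_carrier[OF S x(1)] x(3) m] x(2) by blast
  qed
  then show ?thesis
    using only_prime_divisor_imp_power[OF subgroup.finite_imp_card_positive[OF S fin] p] S p
    unfolding p_subgroup_def by blast
qed

lemma p_frattini_normal:
  assumes "F \<lhd> G"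
  shows "p_frattini G p F \<lhd> G"
  unfolding p_frattini_def
proof (rule normal_generateI)
  have s: "subgroup F G" using assms by (rule normal_imp_subgroup)
  have FG: "x \<in> carrier G" if "x \<in> F" for x using s that by (rule subgroup.mem_carrier)
  have conj: "g \<otimes> x \<otimes> inv g \<in> F" if "x \<in> F" "g \<in> carrier G" for g x
    using assms that by (simp add: normal_inv_iff)
  show "{x [^] p |x. x \<in> F} \<union> derived_set G F \<subseteq> carrier G" using FG by auto
  show "g \<otimes> h \<otimes> inv g \<in> {x [^] p |x. x \<in> F} \<union> derived_set G F"
    if h: "h \<in> {x [^] p |x. x \<in> F} \<union> derived_set G F" and g: "g \<in> carrier G" for h g
  proof (cases "h \<in> derived_set G F")
    case True
    then obtain x y where xy: "x \<in> F" "y \<in> F" "h = x \<otimes> y \<otimes> inv x \<otimes> inv y" by blast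
    have "g \<otimes> h \<otimes> inv g = (g \<otimes> x \<otimes> inv g) \<otimes> (g \<otimes> y \<otimes> inv g) \<otimes> inv (g \<otimes> x \<otimes> inv g) \<otimes> inv (g \<otimes> y \<otimes> inv g)"
      using xy g FG by (simp add: m_assoc inv_mult_group)
    then show ?thesis using conj[OF xy(1) g] conj[OF xy(2) g] by blast
  next
    case False
    then obtain x where x: "x \<in> F" "h = x [^] p" using h by blast
    then have "g \<otimes> h \<otimes> inv g = (g \<otimes> x \<otimes> inv g) [^] p" using conj_pow[OF FG[OF x(1)] g] by simp
    then show ?thesis using conj[OF x(1) g] by blast
  qed
qed

lemma derived_subset_p_frattini:
  assumes "M \<subseteq> F"
  shows "derived G M \<subseteq> p_frattini G p F"
  unfolding derived_def p_frattini_def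
  using mono_derived_set[OF assms] by (intro mono_generate le_supI2)

text \<open>Each coset \<open>\<Phi> #> x\<close> of the Frattini subgroup has \<open>p\<close>-power size, so \<open>s\<close>, whose order is a power
  of a different prime, fixes a point of it. So \<open>F\<close> is generated by \<open>\<Phi>\<close> and the centralizer of \<open>s\<close>
  in \<open>F\<close>, hence equal to that centralizer.\<close>

lemma coprime_action_trivial:
  assumes fin: "finite (carrier G)" and F: "p_subgroup G p F" and B: "subgroup B G"
    and norm: "\<And>g x. g \<in> B \<Longrightarrow> x \<in> F \<Longrightarrow> g \<otimes> x \<otimes> inv g \<in> F"
    and triv: "\<And>g x. g \<in> B \<Longrightarrow> x \<in> F \<Longrightarrow> g \<otimes> x \<otimes> inv g \<otimes> inv x \<in> p_frattini G p F"
    and s: "s \<in> B" "s [^] (q ^ n :: nat) = \<one>" and q: "prime q" "q \<noteq> p"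
    and x: "x \<in> F"
  shows "s \<otimes> x = x \<otimes> s"
proof -
  note FD = p_subgroupD[OF F]
  define \<Phi> where "\<Phi> = p_frattini G p F"
  have s\<Phi>: "subgroup \<Phi> G" and \<Phi>F: "\<Phi> \<subseteq> F"
    unfolding \<Phi>_def using p_frattini_subgroup[OF FD(2)] p_frattini_subset[OF FD(2)] by auto
  have FG: "y \<in> carrier G" if "y \<in> F" for y using FD(2) that by (rule subgroup.mem_carrier)
  have BG: "y \<in> carrier G" if "y \<in> B" for y using B that by (rule subgroup.mem_carrier)
  have sG: "s \<in> carrier G" using BG s by blast
  define S where "S = generate G {s}"
  have SS: "subgroup S G" unfolding S_def using sG by (intro generate_is_subgroup) auto
  have SB: "S \<subseteq> B" unfolding S_def using s(1) B by (intro generate_subgroup_incl) auto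
  have sS: "s \<in> S" unfolding S_def by (auto intro: generate.incl)
  have qS: "p_subgroup G q S"
  proof -
    have "card S = ord s" unfolding S_def using generate_pow_card[OF sG] by simp
    moreover have "ord s dvd q ^ n" using s(2) sG pow_eq_id by blast
    ultimately show ?thesis using q SS divides_primepow_nat unfolding p_subgroup_def by metis
  qed
  define C where "C = F \<inter> {z \<in> carrier G. \<forall>w\<in>{s}. w \<otimes> z \<otimes> inv w \<otimes> inv z \<in> {\<one>}}"
  have sC: "subgroup C G"
    unfolding C_def using FD(2) sG one_is_normal by (intro subgroups_Inter_pair centralizer_modulo_subgroup) auto
  have C_iff: "z \<in> C \<longleftrightarrow> z \<in> F \<and> s \<otimes> z = z \<otimes> s" for z
    using FG commutator_eq_one_iff[OF sG] by (auto simp: C_def)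
  have "F \<subseteq> generate G (C \<union> \<Phi>)"
  proof
    fix y assume y: "y \<in> F"
    define E where "E = (\<lambda>f. f \<otimes> y) ` \<Phi>"
    have cardE: "card E = card \<Phi>"
      unfolding E_def using \<Phi>F FG y by (intro card_image inj_onI) (auto dest!: right_cancel[THEN iffD1, rotated -1])
    have finE: "finite E" using finite_subset[OF \<Phi>F FD(3)] by (simp add: E_def)
    have EF: "z \<in> F" if "z \<in> E" for z using that \<Phi>F y subgroup.m_closed[OF FD(2)] by (auto simp: E_def)
    let ?fix = "{z \<in> E. \<forall>g\<in>S. g \<otimes> z \<otimes> inv g = z}"
    have "card ?fix mod q = card E mod q"
    proof (rule p_subgroup_fixed_points[OF qS finE])
      fix g z assume g: "g \<in> S" and z: "z \<in> E"
      then obtain f where f: "f \<in> \<Phi>" "z = f \<otimes> y" by (auto simp: E_def)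
      have gB: "g \<in> B" "g \<in> carrier G" using g SB BG by auto
      have fF: "f \<in> F" "f \<in> carrier G" using f \<Phi>F FG by auto
      have "(g \<otimes> f \<otimes> inv g \<otimes> inv f) \<otimes> f \<otimes> (g \<otimes> y \<otimes> inv g \<otimes> inv y) \<in> \<Phi>"
        using triv[OF gB(1)] fF(1) y f(1) subgroup.m_closed[OF s\<Phi>] unfolding \<Phi>_def[symmetric] by blast
      moreover have "g \<otimes> z \<otimes> inv g = (g \<otimes> f \<otimes> inv g \<otimes> inv f) \<otimes> f \<otimes> (g \<otimes> y \<otimes> inv g \<otimes> inv y) \<otimes> y"
        using f(2) gB fF FG[OF y] by (simp add: m_assoc)
      ultimately show "g \<otimes> z \<otimes> inv g \<in> E" unfolding E_def by blast
    next
      fix z assume "z \<in> E"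
      then show "\<one> \<otimes> z \<otimes> inv \<one> = z" using EF FG by simp
    next
      fix g h z assume "g \<in> S" "h \<in> S" "z \<in> E"
      then show "g \<otimes> h \<otimes> z \<otimes> inv (g \<otimes> h) = g \<otimes> (h \<otimes> z \<otimes> inv h) \<otimes> inv g"
        using EF FG SB BG by (simp add: m_assoc inv_mult_group subset_iff)
    qed
    moreover have "\<not> q dvd card E"
    proof -
      obtain m where "card \<Phi> = p ^ m"
        using p_subgroup_mono[OF F s\<Phi> \<Phi>F] by (auto simp: p_subgroup_def)
      then show ?thesis using cardE q FD(1) by (metis prime_dvd_power primes_dvd_imp_eq)
    qed
    ultimately have "card ?fix \<noteq> 0" by (metis dvd_eq_mod_eq_0 mod_0)
    then have "?fix \<noteq> {}" by (metis card.empty)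
    then obtain z where z: "z \<in> E" "\<forall>g\<in>S. g \<otimes> z \<otimes> inv g = z" by blast
    obtain f where f: "f \<in> \<Phi>" "z = f \<otimes> y" using z(1) by (auto simp: E_def)
    have zF: "z \<in> F" "z \<in> carrier G" using EF z(1) FG by auto
    have "s \<otimes> z \<otimes> inv s = z" using z(2) sS by blast
    then have "s \<otimes> z = z \<otimes> s"
      by (rule inv_solve_right'[THEN iffD1, rotated 3]) (use zF sG in auto)
    then have "z \<in> C" using C_iff zF by blast
    moreover have "y = inv f \<otimes> z" using f FG \<Phi>F y by (simp add: subset_iff)
    moreover have "subgroup (generate G (C \<union> \<Phi>)) G"
      using subgroup.subset[OF sC] subgroup.subset[OF s\<Phi>] by (intro generate_is_subgroup) auto
    moreover have "inv f \<in> \<Phi>" using f s\<Phi> by (simp add: subgroup.m_inv_closed)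
    ultimately show "y \<in> generate G (C \<union> \<Phi>)"
      by (simp add: generate.incl subgroup.m_closed)
  qed
  then have "C = F"
    using p_frattini_nongenerators[OF fin F sC] unfolding \<Phi>_def by (auto simp: C_def)
  then show ?thesis using x C_iff by blast
qed

lemma derived_funpow_normal: "N \<lhd> G \<Longrightarrow> (derived G ^^ n) N \<lhd> G"
  by (induction n) (simp_all add: derived_is_normal)

text \<open>The elements that commute with a given set modulo \<open>F\<close> form a subgroup; this is used for \<open>X\<close> and
  then for the group generated by \<open>X\<close>.\<close>

lemma derived_set_generate_subset:
  assumes F: "F \<lhd> G" and X: "X \<subseteq> carrier G" and D: "derived_set G X \<subseteq> F"
  shows "derived_set G (generate G X) \<subseteq> F"
proof -
  have sF: "subgroup F G" using F by (rule normal_imp_subgroup)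
  have swap: "y \<otimes> x \<otimes> inv y \<otimes> inv x \<in> F"
    if "x \<otimes> y \<otimes> inv x \<otimes> inv y \<in> F" "x \<in> carrier G" "y \<in> carrier G" for x y
  proof -
    have "inv (x \<otimes> y \<otimes> inv x \<otimes> inv y) \<in> F" using subgroup.m_inv_closed[OF sF that(1)] .
    then show ?thesis using that(2,3) by (simp add: m_assoc inv_mult_group)
  qed
  have gG: "x \<in> carrier G" if "x \<in> generate G X" for x using X that by (rule generate_in_carrier)
  have "subgroup {z \<in> carrier G. \<forall>w\<in>X. w \<otimes> z \<otimes> inv w \<otimes> inv z \<in> F} G"
    using F X by (rule centralizer_modulo_subgroup)
  then have *: "generate G X \<subseteq> {z \<in> carrier G. \<forall>w\<in>X. w \<otimes> z \<otimes> inv w \<otimes> inv z \<in> F}"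
    using X D by (intro generate_subgroup_incl) blast+
  have 1: "z \<otimes> w \<otimes> inv z \<otimes> inv w \<in> F" if "z \<in> generate G X" "w \<in> X" for z w
  proof (rule swap)
    show "w \<otimes> z \<otimes> inv w \<otimes> inv z \<in> F" using * that by blast
  qed (use that gG X in blast)+
  have "subgroup {z \<in> carrier G. \<forall>w\<in>generate G X. w \<otimes> z \<otimes> inv w \<otimes> inv z \<in> F} G"
    using F gG by (intro centralizer_modulo_subgroup) blast+
  then have "generate G X \<subseteq> {z \<in> carrier G. \<forall>w\<in>generate G X. w \<otimes> z \<otimes> inv w \<otimes> inv z \<in> F}"
    using X 1 by (intro generate_subgroup_incl) blast+
  then show ?thesis by blast
qed

text \<open>Suppose not. A term \<open>A\<close> of the derived series of \<open>D\<close> then yields a normal subgroup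
  \<open>B\<close> that properly contains \<open>F\<close>, is abelian modulo \<open>F\<close> and acts trivially on \<open>F / \<Phi>\<close>.
  It is not a \<open>p\<close>-group, so it has nontrivial elements of \<open>q\<close>-power order for some prime
  \<open>q \<noteq> p\<close>. These centralize \<open>F\<close>, hence commute with each other, hence form a normal
  \<open>q\<close>-subgroup.\<close>

lemma solvable_frattini_centralizer_le:
  assumes fin: "finite (carrier G)" and sol: "solvable G"
    and F: "p_subgroup G p F" "F \<lhd> G" and max: "\<And>N. N \<lhd> G \<Longrightarrow> p_subgroup G p N \<Longrightarrow> F \<subseteq> N \<Longrightarrow> N = F"
    and noq: "\<And>q N. q \<noteq> p \<Longrightarrow> N \<lhd> G \<Longrightarrow> p_subgroup G q N \<Longrightarrow> N = {\<one>}"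
  shows "{z \<in> carrier G. \<forall>w\<in>F. w \<otimes> z \<otimes> inv w \<otimes> inv z \<in> p_frattini G p F} \<subseteq> F" (is "?D \<subseteq> F")
proof (rule ccontr)
  assume DF: "\<not> ?D \<subseteq> F"
  note FD = p_subgroupD[OF F(1)]
  define \<Phi> where "\<Phi> = p_frattini G p F"
  define D where "D = ?D"
  have n\<Phi>: "\<Phi> \<lhd> G" unfolding \<Phi>_def using F(2) by (rule p_frattini_normal)
  have s\<Phi>: "subgroup \<Phi> G" using n\<Phi> by (rule normal_imp_subgroup)
  have \<Phi>F: "\<Phi> \<subseteq> F" unfolding \<Phi>_def using FD(2) by (rule p_frattini_subset)
  have FG: "y \<in> carrier G" if "y \<in> F" for y using FD(2) that by (rule subgroup.mem_carrier)
  have conjF: "g \<otimes> x \<otimes> inv g \<in> F" if "x \<in> F" "g \<in> carrier G" for g x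
    using F(2) that by (simp add: normal_inv_iff)
  have conj\<Phi>: "g \<otimes> x \<otimes> inv g \<in> \<Phi>" if "x \<in> \<Phi>" "g \<in> carrier G" for g x
    using n\<Phi> that by (simp add: normal_inv_iff)
  have D_iff: "z \<in> D \<longleftrightarrow> z \<in> carrier G \<and> (\<forall>w\<in>F. w \<otimes> z \<otimes> inv w \<otimes> inv z \<in> \<Phi>)" for z
    by (auto simp: D_def \<Phi>_def)
  have sD: "subgroup D G"
    unfolding D_def \<Phi>_def[symmetric] using n\<Phi> FG by (intro centralizer_modulo_subgroup) auto
  have nD: "D \<lhd> G"
    unfolding normal_inv_iff
  proof (intro conjI sD ballI)
    fix y g assume y: "y \<in> carrier G" and g: "g \<in> D"
    have gG: "g \<in> carrier G" using g D_iff by blast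
    have "w \<otimes> (y \<otimes> g \<otimes> inv y) \<otimes> inv w \<otimes> inv (y \<otimes> g \<otimes> inv y) \<in> \<Phi>" if w: "w \<in> F" for w
    proof -
      have "inv y \<otimes> w \<otimes> inv (inv y) \<in> F" using conjF[OF w, of "inv y"] y by simp
      then have "(inv y \<otimes> w \<otimes> y) \<otimes> g \<otimes> inv (inv y \<otimes> w \<otimes> y) \<otimes> inv g \<in> \<Phi>" using g D_iff y by simp
      from conj\<Phi>[OF this y] show ?thesis using y gG FG[OF w] by (simp add: m_assoc inv_mult_group)
    qed
    then show "y \<otimes> g \<otimes> inv y \<in> D" using D_iff y gG by simp
  qed
  have FsubD: "F \<subseteq> D"
  proof
    fix x assume x: "x \<in> F"
    have "w \<otimes> x \<otimes> inv w \<otimes> inv x \<in> \<Phi>" if "w \<in> F" for w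
      using that x unfolding \<Phi>_def p_frattini_def by (intro generate.incl) blast
    then show "x \<in> D" using D_iff x FG by blast
  qed
  obtain m where "(derived G ^^ m) (carrier G) = {\<one>}"
    using sol solvable_iff_trivial_derived_seq by blast
  then have "(derived G ^^ m) D \<subseteq> F"
    using mono_exp_of_derived[OF subgroup.subset[OF sD], of m] subgroup.one_closed[OF FD(2)] by auto
  then have ex: "\<exists>m. (derived G ^^ m) D \<subseteq> F" by blast
  define m0 where "m0 = (LEAST m. (derived G ^^ m) D \<subseteq> F)"
  have m0: "(derived G ^^ m0) D \<subseteq> F" unfolding m0_def using ex by (rule LeastI_ex)
  have "m0 \<noteq> 0"
  proof
    assume "m0 = 0"
    then show False using m0 DF by (simp add: D_def)
  qed
  then obtain m1 where m1: "m0 = Suc m1" by (cases m0) auto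
  define A where "A = (derived G ^^ m1) D"
  have AF: "\<not> A \<subseteq> F" using not_less_Least[of m1 "\<lambda>m. (derived G ^^ m) D \<subseteq> F"] m1 unfolding A_def m0_def by simp
  have dA: "derived G A \<subseteq> F" using m0 by (simp add: A_def m1)
  have nA: "A \<lhd> G" unfolding A_def using nD by (rule derived_funpow_normal)
  have AG: "A \<subseteq> carrier G" using subgroup.subset[OF normal_imp_subgroup[OF nA]] .
  have AD: "A \<subseteq> D"
    unfolding A_def
  proof (induction m1)
    case (Suc n)
    then show ?case using derived_incl[OF Suc sD] by simp
  qed simp
  define B where "B = generate G (A \<union> F)"
  have AFG: "A \<union> F \<subseteq> carrier G" using AG FG by auto
  have nB: "B \<lhd> G"
    unfolding B_def
  proof (rule normal_generateI[OF AFG])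
    show "g \<otimes> h \<otimes> inv g \<in> A \<union> F" if "h \<in> A \<union> F" "g \<in> carrier G" for h g
      using that nA F(2) unfolding normal_inv_iff by blast
  qed
  have sB: "subgroup B G" using nB by (rule normal_imp_subgroup)
  have BG: "y \<in> carrier G" if "y \<in> B" for y using sB that by (rule subgroup.mem_carrier)
  have BD: "B \<subseteq> D" unfolding B_def using AD FsubD by (intro generate_subgroup_incl sD) blast
  have FB: "F \<subseteq> B" and AB: "A \<subseteq> B" unfolding B_def by (auto intro: generate.incl)
  have dB: "derived_set G B \<subseteq> F"
    unfolding B_def
  proof (rule derived_set_generate_subset[OF F(2) AFG])
    show "derived_set G (A \<union> F) \<subseteq> F"
    proof -
      have "x \<otimes> y \<otimes> inv x \<otimes> inv y \<in> F" if xy: "x \<in> A \<union> F" "y \<in> A \<union> F" for x y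
      proof -
        have xyG: "x \<in> carrier G" "y \<in> carrier G" using xy AFG by auto
        consider "x \<in> A" "y \<in> A" | "x \<in> F" | "y \<in> F" using xy by blast
        then show ?thesis
        proof cases
          case 1
          then have "x \<otimes> y \<otimes> inv x \<otimes> inv y \<in> derived_set G A" by blast
          then show ?thesis using dA unfolding derived_def by (auto intro: generate.incl)
        next
          case 2
          have "x \<otimes> (y \<otimes> inv x \<otimes> inv y) \<in> F"
            using 2 conjF[OF subgroup.m_inv_closed[OF FD(2) 2] xyG(2)] by (rule subgroup.m_closed[OF FD(2)])
          then show ?thesis using xyG by (simp add: m_assoc)
        next
          case 3
          show ?thesis
            using conjF[OF 3 xyG(1)] subgroup.m_inv_closed[OF FD(2) 3] by (rule subgroup.m_closed[OF FD(2)])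
        qed
      qed
      then show ?thesis by blast
    qed
  qed
  have "\<not> p_subgroup G p B" using max[OF nB _ FB] AF AB by blast
  then obtain q where q: "prime q" "q dvd card B" "q \<noteq> p"
    using only_prime_divisor_imp_power[OF subgroup.finite_imp_card_positive[OF sB fin] FD(1)] sB FD(1)
    unfolding p_subgroup_def by blast
  define S where "S = {s \<in> B. \<exists>n. s [^] (q ^ n :: nat) = \<one>}"
  have cent: "s \<otimes> x = x \<otimes> s" if s: "s \<in> S" and x: "x \<in> F" for s x
  proof -
    obtain n where n: "s \<in> B" "s [^] (q ^ n :: nat) = \<one>" using s by (auto simp: S_def)
    show ?thesis
    proof (rule coprime_action_trivial[OF fin F(1) sB _ _ n q(1,3) x])
      show "g \<otimes> x \<otimes> inv g \<in> F" if "g \<in> B" "x \<in> F" for g x using conjF that BG by blast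
      show "g \<otimes> x \<otimes> inv g \<otimes> inv x \<in> p_frattini G p F" if gx: "g \<in> B" "x \<in> F" for g x
      proof -
        have "x \<otimes> g \<otimes> inv x \<otimes> inv g \<in> \<Phi>" using gx BD D_iff by blast
        then have "inv (x \<otimes> g \<otimes> inv x \<otimes> inv g) \<in> \<Phi>" by (rule subgroup.m_inv_closed[OF s\<Phi>])
        then show ?thesis using BG[OF gx(1)] FG[OF gx(2)] by (simp add: \<Phi>_def m_assoc inv_mult_group)
      qed
    qed
  qed
  have SG: "s \<in> carrier G" if "s \<in> S" for s using that BG by (auto simp: S_def)
  have comm: "s \<otimes> t = t \<otimes> s" if st: "s \<in> S" "t \<in> S" for s t
  proof -
    define c where "c = s \<otimes> t \<otimes> inv s \<otimes> inv t"
    have cF: "c \<in> F" using dB st unfolding c_def S_def by blast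
    have cG: "c \<in> carrier G" using cF FG by blast
    obtain n where n: "t [^] (q ^ n :: nat) = \<one>" using st by (auto simp: S_def)
    have "s \<otimes> t \<otimes> inv s = c \<otimes> t" using SG[OF st(1)] SG[OF st(2)] by (simp add: c_def m_assoc)
    then have "(c \<otimes> t) [^] (q ^ n) = \<one>"
      using conj_pow[OF SG[OF st(2)] SG[OF st(1)], of "q ^ n"] n SG[OF st(1)] by simp
    moreover have "(c \<otimes> t) [^] (q ^ n) = c [^] (q ^ n) \<otimes> t [^] (q ^ n)"
      using cent[OF st(2) cF, symmetric] cG SG[OF st(2)] by (rule pow_mult_distrib)
    ultimately have cq: "c [^] (q ^ n) = \<one>" using n cG by simp
    obtain k where cp: "c [^] (p ^ k) = \<one>" using p_subgroup_elem[OF F(1) cF] by blast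
    have "coprime (q ^ n) (p ^ k)" using q FD(1) by (simp add: primes_coprime)
    then have "c = \<one>" using pow_coprime_one[OF cG cq cp] by blast
    then show ?thesis unfolding c_def using commutator_eq_one_iff SG st by blast
  qed
  have sS: "subgroup S G"
  proof (rule subgroupI)
    show "S \<subseteq> carrier G" using SG by blast
    show "S \<noteq> {}" using subgroup.one_closed[OF sB] by (auto simp: S_def intro!: exI[of _ \<one>])
    show "inv a \<in> S" if "a \<in> S" for a
      using that SG[OF that] subgroup.m_inv_closed[OF sB] by (auto simp: S_def nat_pow_inv)
    show "a \<otimes> b \<in> S" if ab: "a \<in> S" "b \<in> S" for a b
    proof -
      obtain m n where mn: "a [^] (q ^ m :: nat) = \<one>" "b [^] (q ^ n :: nat) = \<one>" using ab by (auto simp: S_def)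
      have "(a \<otimes> b) [^] (q ^ (m + n)) = a [^] (q ^ (m + n)) \<otimes> b [^] (q ^ (m + n))"
        using comm[OF ab] SG[OF ab(1)] SG[OF ab(2)] by (rule pow_mult_distrib)
      also have "a [^] (q ^ (m + n)) = \<one>"
        using mn(1) nat_pow_pow[OF SG[OF ab(1)], of "q ^ m" "q ^ n"] by (simp add: power_add)
      also have "b [^] (q ^ (m + n)) = \<one>"
        using mn(2) nat_pow_pow[OF SG[OF ab(2)], of "q ^ n" "q ^ m"] by (simp add: power_add mult.commute)
      finally have "(a \<otimes> b) [^] (q ^ (m + n)) = \<one>" by simp
      moreover have "a \<otimes> b \<in> B" using ab subgroup.m_closed[OF sB] by (auto simp: S_def)
      ultimately show ?thesis unfolding S_def by blast
    qed
  qed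
  have "S \<lhd> G"
    unfolding normal_inv_iff
  proof (intro conjI sS ballI)
    fix x h assume x: "x \<in> carrier G" and h: "h \<in> S"
    obtain n where n: "h [^] (q ^ n :: nat) = \<one>" using h by (auto simp: S_def)
    have "(x \<otimes> h \<otimes> inv x) [^] (q ^ n :: nat) = \<one>" using conj_pow[OF SG[OF h] x] n x by simp
    moreover have "x \<otimes> h \<otimes> inv x \<in> B" using nB x h unfolding normal_inv_iff S_def by blast
    ultimately show "x \<otimes> h \<otimes> inv x \<in> S" unfolding S_def by blast
  qed
  moreover have "p_subgroup G q S"
    using fin sS q(1) by (rule p_subgroup_if_elements) (simp add: S_def)
  ultimately have "S = {\<one>}" using noq[OF q(3)] by blast
  moreover obtain x n where "x \<in> B" "x \<noteq> \<one>" "x [^] (q ^ n :: nat) = \<one>"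
    using prime_power_order_element[OF fin sB q(1,2)] by blast
  then have "x \<in> S" unfolding S_def by blast
  ultimately show False using \<open>x \<noteq> \<one>\<close> by blast
qed

text \<open>As \<open>F / \<Phi>\<close> is elementary abelian, each element of \<open>X\<close> contributes a factor of at most \<open>p\<close>.\<close>

lemma card_generate_p_frattini_le:
  assumes fin: "finite (carrier G)" and F: "p_subgroup G p F" and X: "finite X" "X \<subseteq> F"
  shows "card (generate G (X \<union> p_frattini G p F)) \<le> p ^ card X * card (p_frattini G p F)"
  using X
proof (induction X rule: finite_induct)
  case empty
  note FD = p_subgroupD[OF F]
  show ?case using generate_subgroup_eq[OF p_frattini_subgroup[OF FD(2)]] by simp
next
  case (insert x X)
  note FD = p_subgroupD[OF F]
  define \<Phi> where "\<Phi> = p_frattini G p F"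
  have s\<Phi>: "subgroup \<Phi> G" and \<Phi>F: "\<Phi> \<subseteq> F"
    unfolding \<Phi>_def using p_frattini_subgroup[OF FD(2)] p_frattini_subset[OF FD(2)] by auto
  define B where "B = generate G (X \<union> \<Phi>)"
  have XF: "X \<union> \<Phi> \<subseteq> F" using insert.prems \<Phi>F by blast
  have sB: "subgroup B G" unfolding B_def using XF FD(4) by (intro generate_is_subgroup) blast
  have BF: "B \<subseteq> F" unfolding B_def using XF FD(2) by (rule generate_subgroup_incl)
  have \<Phi>B: "\<Phi> \<subseteq> B" unfolding B_def by (auto intro: generate.incl)
  have x: "x \<in> F" "x \<in> carrier G" using insert.prems FD(4) by auto
  have BG: "b \<in> carrier G" if "b \<in> B" for b using sB that by (rule subgroup.mem_carrier)
  have conj: "x \<otimes> b \<otimes> inv x \<in> B" if b: "b \<in> B" for b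
  proof -
    have "x \<otimes> b \<otimes> inv x \<otimes> inv b \<in> \<Phi>"
      unfolding \<Phi>_def p_frattini_def using x b BF by (intro generate.incl) blast
    then have "(x \<otimes> b \<otimes> inv x \<otimes> inv b) \<otimes> b \<in> B"
      using subgroup.m_closed[OF sB, of "x \<otimes> b \<otimes> inv x \<otimes> inv b" b] \<Phi>B b by blast
    then show ?thesis using x BG[OF b] by (simp add: m_assoc)
  qed
  have "x [^] p \<in> \<Phi>" unfolding \<Phi>_def p_frattini_def using x by (intro generate.incl) blast
  then have xp: "x [^] p \<in> B" using \<Phi>B by blast
  let ?V = "{b \<otimes> x [^] (k::nat) | b k. b \<in> B}"
  have V: "?V = (\<lambda>(b, k). b \<otimes> x [^] k) ` (B \<times> {..<p})"
  proof
    show "?V \<subseteq> (\<lambda>(b, k). b \<otimes> x [^] k) ` (B \<times> {..<p})"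
    proof
      fix v assume "v \<in> ?V"
      then obtain b k where bk: "v = b \<otimes> x [^] (k::nat)" "b \<in> B" by blast
      have "x [^] k = (x [^] p) [^] (k div p) \<otimes> x [^] (k mod p)"
        using x by (simp add: nat_pow_pow nat_pow_mult)
      then have "v = (b \<otimes> (x [^] p) [^] (k div p)) \<otimes> x [^] (k mod p)"
        using bk BG x by (simp add: m_assoc)
      moreover have "b \<otimes> (x [^] p) [^] (k div p) \<in> B"
        using bk subgroup_pow_closed[OF sB xp] by (intro subgroup.m_closed[OF sB])
      moreover have "k mod p < p" using prime_gt_0_nat[OF FD(1)] by simp
      ultimately show "v \<in> (\<lambda>(b, k). b \<otimes> x [^] k) ` (B \<times> {..<p})" by force
    qed
  qed auto
  have sV: "subgroup ?V G" using sB fin x(2) conj by (rule subgroup_normalized_times_powers)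
  have finB: "finite B" using finite_subset[OF BF FD(3)] .
  have "generate G (insert x X \<union> \<Phi>) \<subseteq> ?V"
  proof (intro generate_subgroup_incl sV)
    have "\<one> \<otimes> x [^] (1::nat) \<in> ?V" using subgroup.one_closed[OF sB] by blast
    moreover have "b \<otimes> x [^] (0::nat) \<in> ?V" if "b \<in> B" for b using that by blast
    moreover have "X \<union> \<Phi> \<subseteq> B" unfolding B_def by (auto intro: generate.incl)
    ultimately show "insert x X \<union> \<Phi> \<subseteq> ?V" using x BG by auto
  qed
  then have "card (generate G (insert x X \<union> \<Phi>)) \<le> card ?V"
    unfolding V using finB by (intro card_mono) auto
  also have "\<dots> \<le> card (B \<times> {..<p})" unfolding V using finB by (intro card_image_le) simp
  also have "\<dots> = card B * p" by (simp add: card_cartesian_product)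
  also have "\<dots> \<le> (p ^ card X * card \<Phi>) * p"
    using insert.IH insert.prems unfolding B_def \<Phi>_def by (intro mult_le_mono1) simp
  finally show ?case using insert.hyps by (simp add: \<Phi>_def mult_ac)
qed

text \<open>An automorphism of \<open>F / \<Phi>\<close> is determined by the images of at most \<open>r\<close> generators, for each of which there
  are at most \<open>p ^ r\<close> possibilities.\<close>

lemma card_le_frattini_centralizer:
  assumes fin: "finite (carrier G)" and F: "p_subgroup G p F" "F \<lhd> G"
    and X: "X \<subseteq> F" "finite X" "card X \<le> r" and gen: "F \<subseteq> generate G (X \<union> p_frattini G p F)"
  shows "card (carrier G)
    \<le> p ^ (r * r) * card {z \<in> carrier G. \<forall>w\<in>F. w \<otimes> z \<otimes> inv w \<otimes> inv z \<in> p_frattini G p F}"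
proof -
  note FD = p_subgroupD[OF F(1)]
  define \<Phi> where "\<Phi> = p_frattini G p F"
  define D where "D = {z \<in> carrier G. \<forall>w\<in>F. w \<otimes> z \<otimes> inv w \<otimes> inv z \<in> \<Phi>}"
  have n\<Phi>: "\<Phi> \<lhd> G" unfolding \<Phi>_def using F(2) by (rule p_frattini_normal)
  have s\<Phi>: "subgroup \<Phi> G" using n\<Phi> by (rule normal_imp_subgroup)
  have \<Phi>F: "\<Phi> \<subseteq> F" unfolding \<Phi>_def using FD(2) by (rule p_frattini_subset)
  have FG: "y \<in> carrier G" if "y \<in> F" for y using FD(2) that by (rule subgroup.mem_carrier)
  have conjF: "g \<otimes> x \<otimes> inv g \<in> F" if "x \<in> F" "g \<in> carrier G" for g x
    using F(2) that by (simp add: normal_inv_iff)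
  have conj\<Phi>: "g \<otimes> x \<otimes> inv g \<in> \<Phi>" if "x \<in> \<Phi>" "g \<in> carrier G" for g x
    using n\<Phi> that by (simp add: normal_inv_iff)
  have genX: "generate G X = F" using p_frattini_generate_eq[OF fin F(1) X(1) gen] .
  have sD: "subgroup D G" unfolding D_def using n\<Phi> FD(4) by (rule centralizer_modulo_subgroup)
  have finD: "finite D" using finite_subset[OF subgroup.subset[OF sD] fin] .
  define act where "act g = restrict (\<lambda>x. \<Phi> #> (g \<otimes> x \<otimes> inv g)) X" for g
  define V where "V = (\<lambda>f. \<Phi> #> f) ` F"
  have finV: "finite V" unfolding V_def using FD(3) by simp
  have cardV: "card V \<le> p ^ r"
  proof -
    have "card F = card V * card \<Phi>"
      using card_subgroup_quotient_image[OF n\<Phi> FD(2,3)] \<Phi>F by (simp add: V_def Int_absorb1)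
    moreover have "card F \<le> p ^ card X * card \<Phi>"
    proof -
      have "card F \<le> card (generate G (X \<union> \<Phi>))"
        using gen finite_subset[OF generate_incl fin] X(1) \<Phi>F FD(4) unfolding \<Phi>_def by (intro card_mono) blast+
      also have "\<dots> \<le> p ^ card X * card \<Phi>"
        unfolding \<Phi>_def using fin F(1) X(2,1) by (rule card_generate_p_frattini_le)
      finally show ?thesis .
    qed
    moreover have "card \<Phi> > 0" using subgroup.finite_imp_card_positive[OF s\<Phi> fin] .
    ultimately have "card V \<le> p ^ card X" by simp
    also have "\<dots> \<le> p ^ r" using X(3) prime_gt_0_nat[OF FD(1)] by (intro power_increasing) auto
    finally show ?thesis .
  qed
  have img: "act ` carrier G \<subseteq> X \<rightarrow>\<^sub>E V"
    using X(1) conjF by (auto simp: act_def V_def)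
  have fib: "card {g \<in> carrier G. act g = y} \<le> card D" if y: "y \<in> act ` carrier G" for y
  proof -
    obtain g0 where g0: "g0 \<in> carrier G" "y = act g0" using y by blast
    have "{g \<in> carrier G. act g = y} \<subseteq> (\<lambda>d. g0 \<otimes> d) ` D"
    proof
      fix g assume "g \<in> {g \<in> carrier G. act g = y}"
      then have g: "g \<in> carrier G" "act g = act g0" using g0 by auto
      define h where "h = inv g0 \<otimes> g"
      have hG: "h \<in> carrier G" using g g0 by (simp add: h_def)
      have sC: "subgroup {z \<in> carrier G. \<forall>w\<in>{h}. w \<otimes> z \<otimes> inv w \<otimes> inv z \<in> \<Phi>} G"
        using n\<Phi> hG by (intro centralizer_modulo_subgroup) auto
      have "h \<otimes> x \<otimes> inv h \<otimes> inv x \<in> \<Phi>" if x: "x \<in> X" for x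
      proof -
        have xG: "x \<in> carrier G" using x X(1) FG by blast
        have "\<Phi> #> (g \<otimes> x \<otimes> inv g) = \<Phi> #> (g0 \<otimes> x \<otimes> inv g0)"
          using fun_cong[OF g(2), of x] x by (simp add: act_def)
        then have "(g \<otimes> x \<otimes> inv g) \<otimes> inv (g0 \<otimes> x \<otimes> inv g0) \<in> \<Phi>"
          using g g0 xG by (intro quotient_eq_iff[OF n\<Phi>, THEN iffD1]) auto
        then have "inv g0 \<otimes> ((g \<otimes> x \<otimes> inv g) \<otimes> inv (g0 \<otimes> x \<otimes> inv g0)) \<otimes> inv (inv g0) \<in> \<Phi>"
          using g0 by (intro conj\<Phi>) auto
        then show ?thesis using g g0 xG by (simp add: h_def m_assoc inv_mult_group)
      qed
      then have "generate G X \<subseteq> {z \<in> carrier G. \<forall>w\<in>{h}. w \<otimes> z \<otimes> inv w \<otimes> inv z \<in> \<Phi>}"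
        using X(1) FG by (intro generate_subgroup_incl sC) auto
      then have hx: "h \<otimes> x \<otimes> inv h \<otimes> inv x \<in> \<Phi>" if "x \<in> F" for x using that unfolding genX by blast
      have "x \<otimes> h \<otimes> inv x \<otimes> inv h \<in> \<Phi>" if x: "x \<in> F" for x
        using subgroup.m_inv_closed[OF s\<Phi> hx[OF x]] hG FG[OF x] by (simp add: m_assoc inv_mult_group)
      then have "h \<in> D" using hG by (simp add: D_def)
      moreover have "g = g0 \<otimes> h" using g g0 by (simp add: h_def)
      ultimately show "g \<in> (\<lambda>d. g0 \<otimes> d) ` D" by blast
    qed
    then have "card {g \<in> carrier G. act g = y} \<le> card ((\<lambda>d. g0 \<otimes> d) ` D)"
      using finD by (intro card_mono) auto
    also have "\<dots> \<le> card D" using finD by (rule card_image_le)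
    finally show ?thesis .
  qed
  have "card (carrier G) = (\<Sum>y\<in>act ` carrier G. card {g \<in> carrier G. act g = y})"
    using sum.group[of "carrier G" "act ` carrier G" act "\<lambda>_. 1::nat"] fin by simp
  also have "\<dots> \<le> (\<Sum>y\<in>act ` carrier G. card D)" using fib by (rule sum_mono)
  also have "\<dots> = card (act ` carrier G) * card D" by simp
  also have "\<dots> \<le> card (X \<rightarrow>\<^sub>E V) * card D"
    using img X(2) finV by (intro mult_le_mono1 card_mono finite_PiE) auto
  also have "card (X \<rightarrow>\<^sub>E V) = card V ^ card X" using X(2) by (simp add: card_PiE)
  also have "card V ^ card X * card D \<le> p ^ (r * r) * card D"
  proof (intro mult_le_mono1)
    have "card V ^ card X \<le> (p ^ r) ^ card X" using cardV by (rule power_mono) simp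
    also have "\<dots> \<le> (p ^ r) ^ r" using X(3) prime_gt_0_nat[OF FD(1)] by (intro power_increasing) auto
    finally show "card V ^ card X \<le> p ^ (r * r)" by (simp add: power_mult)
  qed
  finally show ?thesis by (simp add: D_def \<Phi>_def)
qed

text \<open>With \<open>m\<close> the order of \<open>G / F\<close>, the \<open>m * p ^ k\<close>-th powers in \<open>G\<close> are \<open>p ^ k\<close>-th powers of elements
  of \<open>F\<close>.\<close>

lemma normal_subgroup_power_index:
  assumes fin: "finite (carrier G)" and F: "F \<lhd> G" and p: "prime p"
    and index: "card (carrier G) \<le> p ^ s * card F"
    and PIG: "\<And>n. n \<ge> 1 \<Longrightarrow> card (carrier G) \<le> n ^ a * card (power_subgroup G n)"
  shows "card F \<le> p ^ ((s + k) * a) * card (power_subgroup (G\<lparr>carrier := F\<rparr>) (p ^ k))"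
proof -
  have sF: "subgroup F G" using F by (rule normal_imp_subgroup)
  have posF: "card F > 0" using subgroup.finite_imp_card_positive[OF sF fin] .
  interpret \<pi>: group_hom G "G Mod F" "\<lambda>x. F #> x" using F by (rule quotient_hom)
  interpret F: group "G\<lparr>carrier := F\<rparr>" using sF by (rule subgroup_imp_group)
  define m where "m = card (carrier (G Mod F))"
  have cG: "m * card F = card (carrier G)" unfolding m_def using card_quotient[OF F] .
  have "m * card F \<noteq> 0" using cG fin by (metis card_0_eq carrier_not_empty)
  then have m1: "m \<ge> 1" by (cases m) auto
  have m_le: "m \<le> p ^ s" using index cG posF by (metis mult_le_cancel2)
  define W where "W = power_subgroup (G\<lparr>carrier := F\<rparr>) (p ^ k)"
  have sW: "subgroup W G"
    unfolding W_def using incl_subgroup[OF sF normal_imp_subgroup[OF F.power_subgroup_normal]] .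
  have "power_subgroup G (m * p ^ k) \<subseteq> W"
  proof (rule power_subgroup_subset[OF sW])
    fix x assume x: "x \<in> carrier G"
    have "F #> x [^] m = \<one>\<^bsub>G Mod F\<^esub>"
      using \<pi>.hom_nat_pow[OF x, of m] \<pi>.H.pow_order_eq_1[OF \<pi>.hom_closed[OF x]]
      by (simp add: m_def order_def)
    then have "x [^] m \<in> F" using quotient_one_iff[OF F, of "x [^] m"] x by simp
    then have "(x [^] m) [^]\<^bsub>G\<lparr>carrier := F\<rparr>\<^esub> (p ^ k) \<in> W"
      unfolding W_def by (intro F.power_in_power_subgroup) simp
    then show "x [^] (m * p ^ k) \<in> W" using x by (simp add: nat_pow_pow flip: nat_pow_consistent)
  qed
  then have le: "card (power_subgroup G (m * p ^ k)) \<le> card W"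
    using finite_subset[OF subgroup.subset[OF sW] fin] by (intro card_mono)
  have "m * p ^ k \<ge> 1" using m1 prime_gt_0_nat[OF p] by simp
  have "card F \<le> m * card F" using m1 by simp
  also have "\<dots> = card (carrier G)" by (rule cG)
  also have "\<dots> \<le> (m * p ^ k) ^ a * card (power_subgroup G (m * p ^ k))" using PIG \<open>m * p ^ k \<ge> 1\<close> .
  also have "\<dots> \<le> (p ^ s * p ^ k) ^ a * card W"
    using m_le le by (intro mult_le_mono power_mono) auto
  also have "(p ^ s * p ^ k) ^ a = p ^ ((s + k) * a)" by (simp add: power_add power_mult)
  finally show ?thesis by (simp add: W_def)
qed

text \<open>Let \<open>F\<close> be the largest normal \<open>p\<close>-subgroup. Generators modulo the derived group of \<open>M\<close> are
  generators, as that group lies in the Frattini subgroup of \<open>F\<close>. So \<open>F\<close> has index at most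
  \<open>p ^ (r * r)\<close>, and its power subgroups have indices as \<open>p_group_rank_le\<close> requires.\<close>

lemma normal_p_subgroup_rank_le:
  assumes fin: "finite (carrier G)" and sol: "solvable G"
    and PIG: "\<And>n. n \<ge> 1 \<Longrightarrow> card (carrier G) \<le> n ^ a * card (power_subgroup G n)"
    and noq: "\<And>q N. q \<noteq> p \<Longrightarrow> N \<lhd> G \<Longrightarrow> p_subgroup G q N \<Longrightarrow> N = {\<one>}"
    and M: "p_subgroup G p M" "M \<lhd> G"
    and gen: "\<And>H. subgroup H G \<Longrightarrow> \<exists>X\<subseteq>H. finite X \<and> card X \<le> r \<and> H \<subseteq> generate G (X \<union> derived G M)"
    and H: "subgroup H G" "H \<subseteq> M"
  shows "\<exists>X. X \<subseteq> H \<and> finite X \<and> card X \<le> p_rank_bound (r * r) a \<and> generate G X = H"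
proof -
  define \<F> where "\<F> = {F. F \<lhd> G \<and> p_subgroup G p F \<and> M \<subseteq> F}"
  have "finite \<F>"
    using fin p_subgroupD(4) by (intro finite_subset[of \<F> "Pow (carrier G)"]) (fastforce simp: \<F>_def)+
  moreover have "M \<in> \<F>" using M by (auto simp: \<F>_def)
  ultimately obtain F where "F \<in> \<F>" and max: "\<And>L. L \<in> \<F> \<Longrightarrow> F \<subseteq> L \<Longrightarrow> F = L"
    using finite_has_maximal[of \<F>] by blast
  then have F: "p_subgroup G p F" "F \<lhd> G" "M \<subseteq> F" by (auto simp: \<F>_def)
  note FD = p_subgroupD[OF F(1)]
  let ?D = "{z \<in> carrier G. \<forall>w\<in>F. w \<otimes> z \<otimes> inv w \<otimes> inv z \<in> p_frattini G p F}"
  have "?D \<subseteq> F"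
  proof (rule solvable_frattini_centralizer_le[OF fin sol F(1,2) _ noq])
    show "N = F" if "N \<lhd> G" "p_subgroup G p N" "F \<subseteq> N" for N
      using max[of N] that F(3) by (auto simp: \<F>_def)
  qed
  then have cD: "card ?D \<le> card F" using FD(3) by (intro card_mono)
  obtain X where X: "X \<subseteq> F" "finite X" "card X \<le> r" "F \<subseteq> generate G (X \<union> derived G M)"
    using gen[OF FD(2)] by blast
  have "generate G (X \<union> derived G M) \<subseteq> generate G (X \<union> p_frattini G p F)"
    using derived_subset_p_frattini[OF F(3)] by (intro mono_generate) blast
  then have "card (carrier G) \<le> p ^ (r * r) * card ?D"
    using X(4) by (intro card_le_frattini_centralizer[OF fin F(1,2) X(1-3)]) blast
  also have "\<dots> \<le> p ^ (r * r) * card F" using cD by (rule mult_le_mono2)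
  finally have index: "card (carrier G) \<le> p ^ (r * r) * card F" .
  interpret F: group "G\<lparr>carrier := F\<rparr>" using FD(2) by (rule subgroup_imp_group)
  have pF: "p_subgroup (G\<lparr>carrier := F\<rparr>) p (carrier (G\<lparr>carrier := F\<rparr>))"
    using F(1) F.subgroup_self unfolding p_subgroup_def by simp
  have HF: "H \<subseteq> F" using H F(3) by blast
  have "\<exists>X. X \<subseteq> H \<and> finite X \<and> card X \<le> p_rank_bound (r * r) a \<and> generate (G\<lparr>carrier := F\<rparr>) X = H"
  proof (rule F.p_group_rank_le[OF pF])
    show "card (carrier (G\<lparr>carrier := F\<rparr>)) \<le> p ^ ((r * r + k) * a) * card (power_subgroup (G\<lparr>carrier := F\<rparr>) (p ^ k))" for k
      using normal_subgroup_power_index[OF fin F(2) FD(1) index PIG] by simp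
    show "subgroup H (G\<lparr>carrier := F\<rparr>)" using subgroup_incl[OF H(1) FD(2) HF] .
  qed
  then obtain X where "X \<subseteq> H" "finite X" "card X \<le> p_rank_bound (r * r) a" "generate (G\<lparr>carrier := F\<rparr>) X = H" by blast
  moreover have "generate (G\<lparr>carrier := F\<rparr>) X = generate G X"
    using \<open>X \<subseteq> H\<close> HF by (intro generate_consistent FD(2)) blast
  ultimately show ?thesis by (intro exI[of _ X]) simp
qed

section \<open>Finite nilpotent groups\<close>

lemma lower_central_series_normal: "lower_central_series G n \<lhd> G"
proof (induction n)
  case 0
  show ?case by (simp add: normal_self)
next
  case (Suc n)
  have sub: "x \<in> carrier G" if "x \<in> lower_central_series G n" for x
    using subgroup.mem_carrier[OF normal_imp_subgroup[OF Suc] that] .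
  show ?case
    unfolding lower_central_series.simps
  proof (rule normal_generateI)
    fix h g
    assume "h \<in> (\<Union>x\<in>lower_central_series G n. \<Union>y\<in>carrier G. {x \<otimes> y \<otimes> inv x \<otimes> inv y})" and g: "g \<in> carrier G"
    then obtain x y where xy: "x \<in> lower_central_series G n" "y \<in> carrier G" "h = x \<otimes> y \<otimes> inv x \<otimes> inv y" by blast
    have "g \<otimes> h \<otimes> inv g = (g \<otimes> x \<otimes> inv g) \<otimes> (g \<otimes> y \<otimes> inv g) \<otimes> inv (g \<otimes> x \<otimes> inv g) \<otimes> inv (g \<otimes> y \<otimes> inv g)"
      using xy g sub by (simp add: m_assoc inv_mult_group)
    moreover have "g \<otimes> x \<otimes> inv g \<in> lower_central_series G n" using Suc xy g by (simp add: normal_inv_iff)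
    moreover have "g \<otimes> y \<otimes> inv g \<in> carrier G" using xy g by simp
    ultimately show "g \<otimes> h \<otimes> inv g \<in> (\<Union>x\<in>lower_central_series G n. \<Union>y\<in>carrier G. {x \<otimes> y \<otimes> inv x \<otimes> inv y})"
      by blast
  qed (use sub in auto)
qed

end

lemma (in group_hom) lower_central_series_image_subset:
  "h ` lower_central_series G n \<subseteq> lower_central_series H n"
proof (induction n)
  case 0
  show ?case by auto
next
  case (Suc n)
  have sub: "x \<in> carrier G" if "x \<in> lower_central_series G n" for x
    using subgroup.mem_carrier[OF normal_imp_subgroup[OF G.lower_central_series_normal] that] .
  let ?C = "\<Union>x\<in>lower_central_series G n. \<Union>y\<in>carrier G. {x \<otimes> y \<otimes> inv x \<otimes> inv y}"
  let ?D = "\<Union>x\<in>lower_central_series H n. \<Union>y\<in>carrier H.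
      {x \<otimes>\<^bsub>H\<^esub> y \<otimes>\<^bsub>H\<^esub> inv\<^bsub>H\<^esub> x \<otimes>\<^bsub>H\<^esub> inv\<^bsub>H\<^esub> y}"
  have "h (x \<otimes> y \<otimes> inv x \<otimes> inv y) \<in> ?D" if xy: "x \<in> lower_central_series G n" "y \<in> carrier G" for x y
  proof -
    have "h (x \<otimes> y \<otimes> inv x \<otimes> inv y) = h x \<otimes>\<^bsub>H\<^esub> h y \<otimes>\<^bsub>H\<^esub> inv\<^bsub>H\<^esub> h x \<otimes>\<^bsub>H\<^esub> inv\<^bsub>H\<^esub> h y"
      using xy sub by simp
    moreover have "h x \<in> lower_central_series H n" using Suc xy(1) by blast
    ultimately show ?thesis using hom_closed[OF xy(2)] by blast
  qed
  then have "h ` ?C \<subseteq> ?D" by blast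
  then have "generate H (h ` ?C) \<subseteq> generate H ?D" by (rule H.mono_generate)
  moreover have "?C \<subseteq> carrier G" using sub by auto
  ultimately show ?case using generate_img[of ?C] by simp
qed

lemma (in group_hom) lower_central_series_image:
  assumes "h ` carrier G = carrier H"
  shows "lower_central_series H n = h ` lower_central_series G n"
proof (induction n)
  case 0
  show ?case using assms by simp
next
  case (Suc n)
  have sub: "x \<in> carrier G" if "x \<in> lower_central_series G n" for x
    using subgroup.mem_carrier[OF normal_imp_subgroup[OF G.lower_central_series_normal] that] .
  let ?C = "\<Union>x\<in>lower_central_series G n. \<Union>y\<in>carrier G. {x \<otimes> y \<otimes> inv x \<otimes> inv y}"
  have "h ` ?C = (\<Union>x\<in>lower_central_series H n. \<Union>y\<in>carrier H.
      {x \<otimes>\<^bsub>H\<^esub> y \<otimes>\<^bsub>H\<^esub> inv\<^bsub>H\<^esub> x \<otimes>\<^bsub>H\<^esub> inv\<^bsub>H\<^esub> y})"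
    unfolding Suc assms[symmetric] using sub by (simp add: image_UN)
  moreover have "?C \<subseteq> carrier G" using sub by auto
  ultimately show ?case using generate_img[of ?C] by simp
qed

lemma (in group_hom) nilpotent_group_image:
  assumes "h ` carrier G = carrier H" "nilpotent_group G"
  shows "nilpotent_group H"
  using assms lower_central_series_image unfolding nilpotent_group_def by (metis hom_one image_empty image_insert)

context group begin

text \<open>If \<open>c = [x, y]\<close> is central modulo \<open>N\<close>, then its order modulo \<open>N\<close> divides the orders of
  both \<open>x\<close> and \<open>y\<close>. So \<open>c\<close> descends through the lower central series.\<close>

lemma nilpotent_coprime_commute:
  assumes nil: "nilpotent_group G" and xy: "x \<in> carrier G" "y \<in> carrier G"
    and mn: "x [^] (m::nat) = \<one>" "y [^] (n::nat) = \<one>" "coprime m n"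
  shows "x \<otimes> y = y \<otimes> x"
proof -
  define c where "c = x \<otimes> y \<otimes> inv x \<otimes> inv y"
  have cG: "c \<in> carrier G" using xy by (simp add: c_def)
  have "c \<in> lower_central_series G i" for i
  proof (induction i)
    case 0
    show ?case using cG by simp
  next
    case (Suc i)
    define N where "N = lower_central_series G (Suc i)"
    have nN: "N \<lhd> G" unfolding N_def by (rule lower_central_series_normal)
    interpret \<pi>: group_hom G "G Mod N" "\<lambda>x. N #> x" using nN by (rule quotient_hom)
    let ?\<pi> = "\<lambda>x. N #> x"
    have central: "?\<pi> c \<otimes>\<^bsub>G Mod N\<^esub> ?\<pi> z = ?\<pi> z \<otimes>\<^bsub>G Mod N\<^esub> ?\<pi> c" if z: "z \<in> carrier G" for z
    proof -
      have "c \<otimes> z \<otimes> inv c \<otimes> inv z \<in> N"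
        unfolding N_def lower_central_series.simps using Suc z by (intro generate.incl) blast
      then have "(c \<otimes> z) \<otimes> inv (z \<otimes> c) \<in> N" using cG z by (simp add: m_assoc inv_mult_group)
      then have "?\<pi> (c \<otimes> z) = ?\<pi> (z \<otimes> c)" using cG z by (intro quotient_eq_iff[OF nN, THEN iffD2]) auto
      then show ?thesis using cG z by (simp del: mult_FactGroup)
    qed
    have pow1: "?\<pi> c [^]\<^bsub>G Mod N\<^esub> k = \<one>\<^bsub>G Mod N\<^esub>"
      if z: "z \<in> carrier G" "z [^] k = \<one>" "(c \<otimes> z) [^] k = \<one>" for z and k :: nat
    proof -
      have "(?\<pi> c \<otimes>\<^bsub>G Mod N\<^esub> ?\<pi> z) [^]\<^bsub>G Mod N\<^esub> k = ?\<pi> c [^]\<^bsub>G Mod N\<^esub> k \<otimes>\<^bsub>G Mod N\<^esub> ?\<pi> z [^]\<^bsub>G Mod N\<^esub> k"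
        using central[OF z(1)] \<pi>.hom_closed[OF cG] \<pi>.hom_closed[OF z(1)] by (rule \<pi>.H.pow_mult_distrib)
      moreover have "(?\<pi> c \<otimes>\<^bsub>G Mod N\<^esub> ?\<pi> z) [^]\<^bsub>G Mod N\<^esub> k = \<one>\<^bsub>G Mod N\<^esub>"
        using \<pi>.hom_nat_pow[of "c \<otimes> z" k] \<pi>.hom_mult[OF cG z(1)] z(1,3) cG \<pi>.hom_one by simp
      moreover have "?\<pi> z [^]\<^bsub>G Mod N\<^esub> k = \<one>\<^bsub>G Mod N\<^esub>"
        using \<pi>.hom_nat_pow[OF z(1), of k] z(2) \<pi>.hom_one by simp
      ultimately show ?thesis
        using \<pi>.H.r_one[OF \<pi>.H.nat_pow_closed[OF \<pi>.hom_closed[OF cG]], of k] by simp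
    qed
    have "(c \<otimes> y) [^] n = \<one>"
    proof -
      have "c \<otimes> y = x \<otimes> y \<otimes> inv x" using xy by (simp add: c_def m_assoc)
      then show ?thesis using conj_pow[OF xy(2,1), of n] mn(2) xy by simp
    qed
    then have n: "?\<pi> c [^]\<^bsub>G Mod N\<^esub> n = \<one>\<^bsub>G Mod N\<^esub>" using pow1[OF xy(2) mn(2)] by blast
    have "c \<otimes> (y \<otimes> x \<otimes> inv y) = x" using xy by (simp add: c_def m_assoc)
    moreover have "(y \<otimes> x \<otimes> inv y) [^] m = \<one>" using conj_pow[OF xy, of m] mn(1) xy by simp
    ultimately have m: "?\<pi> c [^]\<^bsub>G Mod N\<^esub> m = \<one>\<^bsub>G Mod N\<^esub>"
      using pow1[of "y \<otimes> x \<otimes> inv y" m] xy mn(1) by simp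
    have "?\<pi> c = \<one>\<^bsub>G Mod N\<^esub>" using \<pi>.H.pow_coprime_one[OF \<pi>.hom_closed[OF cG] m n mn(3)] .
    then show ?case using quotient_one_iff[OF nN cG] by (simp add: N_def)
  qed
  then have "c = \<one>" using nil unfolding nilpotent_group_def by blast
  then show ?thesis using commutator_eq_one_iff[OF xy] unfolding c_def by blast
qed

text \<open>A Sylow \<open>p\<close>-subgroup is normalized by the Sylow subgroups for all primes, as those for the
  other primes centralize it. So it is normal and contains all elements of \<open>p\<close>-power order.\<close>

lemma p_elements_subgroup:
  assumes fin: "finite (carrier G)" and p: "prime p"
    and comm: "\<And>x y m n. x \<in> carrier G \<Longrightarrow> y \<in> carrier G \<Longrightarrow> x [^] (m::nat) = \<one> \<Longrightarrow> y [^] (n::nat) = \<one> \<Longrightarrow>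
      coprime m n \<Longrightarrow> x \<otimes> y = y \<otimes> x"
  shows "subgroup {x \<in> carrier G. \<exists>n. x [^] (p ^ n :: nat) = \<one>} G"
proof -
  have sylow: "\<exists>S. subgroup S G \<and> card S = q ^ multiplicity q (card (carrier G))" if q: "prime q" for q
  proof -
    obtain m where "card (carrier G) = q ^ multiplicity q (card (carrier G)) * m"
      by (metis multiplicity_dvd dvdE)
    then show ?thesis using sylow_thm[OF q is_group, of "multiplicity q (card (carrier G))" m] fin
      by (simp add: order_def)
  qed
  have pos: "card (carrier G) > 0" using fin carrier_not_empty by (simp add: card_gt_0_iff)
  obtain S where S: "subgroup S G" "card S = p ^ multiplicity p (card (carrier G))" using sylow[OF p] by blast
  have SG: "x \<in> carrier G" if "x \<in> S" for x using S(1) that by (rule subgroup.mem_carrier)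
  define N where "N = {g \<in> carrier G. \<forall>s\<in>S. g \<otimes> s \<otimes> inv g \<in> S \<and> inv g \<otimes> s \<otimes> g \<in> S}"
  have sN: "subgroup N G"
  proof (rule subgroupI)
    show "N \<subseteq> carrier G" by (auto simp: N_def)
    show "N \<noteq> {}" using SG by (auto simp: N_def intro!: exI[of _ \<one>])
    show "inv a \<in> N" if "a \<in> N" for a using that by (simp add: N_def)
    show "a \<otimes> b \<in> N" if ab: "a \<in> N" "b \<in> N" for a b
    proof -
      have abG: "a \<in> carrier G" "b \<in> carrier G" using ab by (auto simp: N_def)
      have "(a \<otimes> b) \<otimes> s \<otimes> inv (a \<otimes> b) = a \<otimes> (b \<otimes> s \<otimes> inv b) \<otimes> inv a"
        "inv (a \<otimes> b) \<otimes> s \<otimes> (a \<otimes> b) = inv b \<otimes> (inv a \<otimes> s \<otimes> a) \<otimes> b" if "s \<in> S" for s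
        using abG SG[OF that] by (simp_all add: m_assoc inv_mult_group)
      then show ?thesis using ab abG by (simp add: N_def)
    qed
  qed
  have "card (carrier G) dvd card N"
  proof (rule multiplicity_le_imp_dvd)
    show "card (carrier G) \<noteq> 0" using pos by simp
    fix q :: nat assume q: "prime q"
    have cN: "card N \<noteq> 0" using subgroup.finite_imp_card_positive[OF sN fin] by simp
    obtain T where T: "subgroup T G" "card T = q ^ multiplicity q (card (carrier G))" using sylow[OF q] by blast
    have "\<exists>T'. subgroup T' G \<and> T' \<subseteq> N \<and> card T' = q ^ multiplicity q (card (carrier G))"
    proof (cases "q = p")
      case True
      have "S \<subseteq> N"
        using SG subgroup.m_closed[OF S(1)] subgroup.m_inv_closed[OF S(1)] by (auto simp: N_def)
      then show ?thesis using S True by blast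
    next
      case False
      have "T \<subseteq> N"
      proof
        fix t assume t: "t \<in> T"
        have tG: "t \<in> carrier G" using T(1) t by (rule subgroup.mem_carrier)
        have "t \<otimes> s \<otimes> inv t = s \<and> inv t \<otimes> s \<otimes> t = s" if s: "s \<in> S" for s
        proof -
          have "coprime (card T) (card S)" using S(2) T(2) p q False by (simp add: primes_coprime)
          then have ts: "t \<otimes> s = s \<otimes> t"
            using comm[OF tG SG[OF s] pow_card_subgroup[OF T(1) t] pow_card_subgroup[OF S(1) s]] by blast
          have "t \<otimes> s \<otimes> inv t = s \<otimes> t \<otimes> inv t" by (simp only: ts)
          moreover have "inv t \<otimes> s \<otimes> t = inv t \<otimes> (t \<otimes> s)"
            using tG SG[OF s] by (simp only: ts m_assoc inv_closed)
          ultimately show ?thesis using tG SG[OF s] by (simp add: m_assoc)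
        qed
        then show "t \<in> N" using tG by (simp add: N_def)
      qed
      then show ?thesis using T by blast
    qed
    then have "q ^ multiplicity q (card (carrier G)) dvd card N"
      using card_subgroup_dvd[OF _ sN] by metis
    then show "multiplicity q (card (carrier G)) \<le> multiplicity q (card N)"
      using cN q by (intro multiplicity_geI) auto
  qed
  moreover have "card N > 0" using subgroup.finite_imp_card_positive[OF sN fin] .
  ultimately have "card (carrier G) \<le> card N" by (rule dvd_imp_le)
  then have "N = carrier G" using fin subgroup.subset[OF sN] by (simp add: card_seteq)
  then have nS: "S \<lhd> G" unfolding normal_inv_iff using S(1) by (auto simp: N_def)
  have "{x \<in> carrier G. \<exists>n. x [^] (p ^ n :: nat) = \<one>} = S"
  proof
    show "S \<subseteq> {x \<in> carrier G. \<exists>n. x [^] (p ^ n :: nat) = \<one>}"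
      using SG pow_card_subgroup[OF S(1)] S(2) by auto
    show "{x \<in> carrier G. \<exists>n. x [^] (p ^ n :: nat) = \<one>} \<subseteq> S"
    proof
      fix x assume "x \<in> {x \<in> carrier G. \<exists>n. x [^] (p ^ n :: nat) = \<one>}"
      then obtain n where x: "x \<in> carrier G" "x [^] (p ^ n :: nat) = \<one>" by blast
      interpret \<pi>: group_hom G "G Mod S" "\<lambda>x. S #> x" using nS by (rule quotient_hom)
      have "card (carrier (G Mod S)) * p ^ multiplicity p (card (carrier G)) = card (carrier G)"
        using card_quotient[OF nS] S(2) by simp
      moreover have "\<not> p ^ Suc (multiplicity p (card (carrier G))) dvd card (carrier G)"
      proof
        assume "p ^ Suc (multiplicity p (card (carrier G))) dvd card (carrier G)"
        then have "Suc (multiplicity p (card (carrier G))) \<le> multiplicity p (card (carrier G))"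
          using pos p by (intro multiplicity_geI) auto
        then show False by simp
      qed
      ultimately have "\<not> p dvd card (carrier (G Mod S))"
        by (metis mult_dvd_mono dvd_refl power_Suc)
      then have "coprime (p ^ n) (card (carrier (G Mod S)))" using p by (simp add: prime_imp_coprime)
      moreover have "(S #> x) [^]\<^bsub>G Mod S\<^esub> (p ^ n) = \<one>\<^bsub>G Mod S\<^esub>"
        using \<pi>.hom_nat_pow[OF x(1), of "p ^ n"] x(2) \<pi>.hom_one by simp
      moreover have "(S #> x) [^]\<^bsub>G Mod S\<^esub> card (carrier (G Mod S)) = \<one>\<^bsub>G Mod S\<^esub>"
        using \<pi>.H.pow_order_eq_1[OF \<pi>.hom_closed[OF x(1)]] by (simp add: order_def)
      ultimately have "S #> x = \<one>\<^bsub>G Mod S\<^esub>"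
        using \<pi>.H.pow_coprime_one[OF \<pi>.hom_closed[OF x(1)]] by blast
      then show "x \<in> S" using quotient_one_iff[OF nS x(1)] by simp
    qed
  qed
  then show ?thesis using S(1) by simp
qed

lemma pow_cong:
  assumes "x \<in> carrier G" "x [^] (m::nat) = \<one>" "[u = v] (mod m)"
  shows "x [^] u = x [^] v"
proof -
  have "x [^] w = x [^] (w mod m)" for w :: nat
  proof -
    have "x [^] (m * (w div m)) = \<one>"
      using nat_pow_pow[OF assms(1), of m "w div m"] assms(2) by simp
    moreover have "x [^] w = x [^] (m * (w div m)) \<otimes> x [^] (w mod m)"
      using nat_pow_mult[OF assms(1), of "m * (w div m)" "w mod m"] by simp
    ultimately show ?thesis using assms(1) by simp
  qed
  then show ?thesis using assms(3) unfolding cong_def by metis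
qed

lemma normal_nilpotent_coprime_commute:
  assumes M: "M \<lhd> G" "nilpotent_group (G\<lparr>carrier := M\<rparr>)"
    and "x \<in> M" "y \<in> M" "x [^] (m::nat) = \<one>" "y [^] (n::nat) = \<one>" "coprime m n"
  shows "x \<otimes> y = y \<otimes> x"
proof -
  interpret M: group "G\<lparr>carrier := M\<rparr>" using normal_imp_subgroup[OF M(1)] by (rule subgroup_imp_group)
  show ?thesis
    using M.nilpotent_coprime_commute[OF M(2), of x y m n] assms(3-) by (simp flip: nat_pow_consistent)
qed

lemma normal_nilpotent_p_elements:
  assumes fin: "finite (carrier G)" and M: "M \<lhd> G" "nilpotent_group (G\<lparr>carrier := M\<rparr>)" and p: "prime p"
  shows "{x \<in> M. \<exists>n. x [^] (p ^ n :: nat) = \<one>} \<lhd> G" (is "?P \<lhd> G")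
    and "p_subgroup G p {x \<in> M. \<exists>n. x [^] (p ^ n :: nat) = \<one>}"
proof -
  have sM: "subgroup M G" using M(1) by (rule normal_imp_subgroup)
  have MG: "x \<in> carrier G" if "x \<in> M" for x using sM that by (rule subgroup.mem_carrier)
  interpret M: group "G\<lparr>carrier := M\<rparr>" using sM by (rule subgroup_imp_group)
  have "subgroup {x \<in> carrier (G\<lparr>carrier := M\<rparr>). \<exists>n. x [^]\<^bsub>G\<lparr>carrier := M\<rparr>\<^esub> (p ^ n :: nat) = \<one>\<^bsub>G\<lparr>carrier := M\<rparr>\<^esub>} (G\<lparr>carrier := M\<rparr>)"
    using finite_subset[OF subgroup.subset[OF sM] fin] p M.nilpotent_coprime_commute[OF M(2)]
    by (intro M.p_elements_subgroup) simp_all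
  then have "subgroup ?P (G\<lparr>carrier := M\<rparr>)" by (simp flip: nat_pow_consistent)
  then have sP: "subgroup ?P G" by (rule incl_subgroup[OF sM])
  then show "p_subgroup G p ?P" using p by (intro p_subgroup_if_elements fin) auto
  show "?P \<lhd> G"
    unfolding normal_inv_iff
  proof (intro conjI sP ballI)
    fix x h assume x: "x \<in> carrier G" and h: "h \<in> ?P"
    then obtain n where n: "h \<in> M" "h [^] (p ^ n :: nat) = \<one>" by blast
    have "(x \<otimes> h \<otimes> inv x) [^] (p ^ n) = \<one>" using conj_pow[OF MG[OF n(1)] x] n(2) x by simp
    moreover have "x \<otimes> h \<otimes> inv x \<in> M" using M(1) x n(1) unfolding normal_inv_iff by blast
    ultimately show "x \<otimes> h \<otimes> inv x \<in> ?P" by blast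
  qed
qed

text \<open>Padding with \<open>\<one>\<close> gives families of a fixed length, which can be multiplied pointwise and are points
  of a product space.\<close>

lemma generators_indexed:
  assumes H: "subgroup H G" and X: "X \<subseteq> H" "finite X" "card X \<le> r" "generate G X = H"
  shows "\<exists>t. t ` {..<r} \<subseteq> H \<and> generate G (t ` {..<r}) = H"
proof -
  obtain h where h: "bij_betw h {0..<card X} X" using ex_bij_betw_nat_finite[OF X(2)] by blast
  define t where "t i = (if i < card X then h i else \<one>)" for i
  have tX: "t ` {..<card X} = X"
    using bij_betw_imp_surj_on[OF h] by (auto simp: t_def atLeast0LessThan)
  have "t i \<in> insert \<one> X" for i
  proof (cases "i < card X")
    case True
    then have "t i \<in> t ` {..<card X}" by blast
    then show ?thesis unfolding tX by blast
  qed (simp add: t_def)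
  then have "t ` {..<r} \<subseteq> insert \<one> X" by (rule image_subsetI)
  moreover have "insert \<one> X \<subseteq> H" using X(1) subgroup.one_closed[OF H] by simp
  ultimately have sub: "t ` {..<r} \<subseteq> H" by (rule order_trans)
  have "t ` {..<card X} \<subseteq> t ` {..<r}" using X(3) by (intro image_mono) auto
  then have "X \<subseteq> t ` {..<r}" unfolding tX .
  then have "generate G X \<subseteq> generate G (t ` {..<r})" by (rule mono_generate)
  then have "H \<subseteq> generate G (t ` {..<r})" unfolding X(4) .
  then have "generate G (t ` {..<r}) = H" using generate_subgroup_incl[OF sub H] by (rule subset_antisym[rotated])
  then show ?thesis using sub by blast
qed

text \<open>By the Chinese remainder theorem \<open>t\<close> and \<open>f\<close> are powers of \<open>t \<otimes> f\<close> if they commute and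
  have coprime orders. So the \<open>i\<close>-th generators for all primes can be multiplied together.\<close>

lemma coprime_commuting_generators:
  assumes fin: "finite (carrier G)" and H: "subgroup H G"
    and comm: "\<And>x y m n. x \<in> H \<Longrightarrow> y \<in> H \<Longrightarrow> x [^] (m::nat) = \<one> \<Longrightarrow> y [^] (n::nat) = \<one> \<Longrightarrow>
      coprime m n \<Longrightarrow> x \<otimes> y = y \<otimes> x"
    and gens: "\<And>p. prime p \<Longrightarrow> \<exists>f. f ` {..<r} \<subseteq> {x \<in> H. \<exists>n. x [^] (p ^ n :: nat) = \<one>} \<and>
      {x \<in> H. \<exists>n. x [^] (p ^ n :: nat) = \<one>} \<subseteq> generate G (f ` {..<r})"
  shows "\<exists>X. X \<subseteq> H \<and> finite X \<and> card X \<le> r \<and> generate G X = H"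
proof -
  have HG: "x \<in> carrier G" if "x \<in> H" for x using H that by (rule subgroup.mem_carrier)
  define part where "part \<pi> = {x \<in> H. \<exists>n>0. prime_factors n \<subseteq> \<pi> \<and> x [^] (n::nat) = \<one>}" for \<pi> :: "nat set"
  have "\<exists>t. t ` {..<r} \<subseteq> part \<pi> \<and> part \<pi> \<subseteq> generate G (t ` {..<r})"
    if "finite \<pi>" "\<And>p. p \<in> \<pi> \<Longrightarrow> prime p" for \<pi>
    using that
  proof (induction \<pi> rule: finite_induct)
    case empty
    have "x = \<one>" if x: "x \<in> part {}" for x
    proof -
      obtain n where n: "n > 0" "prime_factors n \<subseteq> {}" "x [^] (n::nat) = \<one>" "x \<in> H"
        using x unfolding part_def by blast
      have "n = 1"
      proof (rule ccontr)
        assume "n \<noteq> 1"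
        then obtain q where "prime q" "q dvd n" using prime_factor_nat by blast
        then have "q \<in> prime_factors n" using n(1) by (simp add: in_prime_factors_iff)
        then show False using n(2) by blast
      qed
      then show ?thesis using n HG by simp
    qed
    then have "part {} \<subseteq> {\<one>}" by blast
    moreover have "\<one> \<in> part {}"
      using subgroup.one_closed[OF H] by (auto simp: part_def intro!: exI[of _ 1])
    ultimately have "(\<lambda>_. \<one>) ` {..<r} \<subseteq> part {}" "part {} \<subseteq> generate G ((\<lambda>_. \<one>) ` {..<r})"
      using generate.one[of G "(\<lambda>_. \<one>) ` {..<r}"] by blast+
    then show ?case by blast
  next
    case (insert p \<pi>)
    have p: "prime p" using insert.prems by blast
    have "\<exists>t. t ` {..<r} \<subseteq> part \<pi> \<and> part \<pi> \<subseteq> generate G (t ` {..<r})"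
      by (rule insert.IH) (simp add: insert.prems)
    then obtain t where t: "t ` {..<r} \<subseteq> part \<pi>" "part \<pi> \<subseteq> generate G (t ` {..<r})" by blast
    obtain f where f: "f ` {..<r} \<subseteq> {x \<in> H. \<exists>n. x [^] (p ^ n :: nat) = \<one>}"
      "{x \<in> H. \<exists>n. x [^] (p ^ n :: nat) = \<one>} \<subseteq> generate G (f ` {..<r})"
      using gens[OF p] by (elim exE conjE)
    have cop: "coprime n (p ^ k)" if "n > 0" "prime_factors n \<subseteq> \<pi>" for n k
    proof -
      have "\<not> p dvd n" using that insert.hyps(2) p by (auto simp: in_prime_factors_iff)
      then have "coprime p n" using p prime_imp_coprime by blast
      then show ?thesis by (simp add: coprime_commute[of n p])
    qed
    define g where "g i = t i \<otimes> f i" for i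
    have "g i \<in> H" if "i < r" for i
    proof -
      have "t i \<in> H" "f i \<in> H" using t(1) f(1) that unfolding part_def by blast+
      then show ?thesis unfolding g_def by (rule subgroup.m_closed[OF H])
    qed
    then have "g ` {..<r} \<subseteq> carrier G" using HG by blast
    then have sg: "subgroup (generate G (g ` {..<r})) G" by (rule generate_is_subgroup)
    have both: "g i \<in> part (insert p \<pi>) \<and> t i \<in> generate G (g ` {..<r}) \<and> f i \<in> generate G (g ` {..<r})"
      if i: "i < r" for i
    proof -
      obtain n where n: "n > 0" "prime_factors n \<subseteq> \<pi>" "t i [^] n = \<one>" "t i \<in> H"
        using t(1) i unfolding part_def by blast
      obtain k where k: "f i [^] (p ^ k) = \<one>" "f i \<in> H" using f(1) i by blast
      have c: "coprime n (p ^ k)" using cop n by blast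
      have tf: "t i \<otimes> f i = f i \<otimes> t i" using comm[OF n(4) k(2) n(3) k(1) c] .
      have gpow: "g i [^] w = t i [^] w \<otimes> f i [^] w" for w :: nat
        unfolding g_def using tf HG[OF n(4)] HG[OF k(2)] by (rule pow_mult_distrib)
      have gH: "g i \<in> H" using n(4) k(2) subgroup.m_closed[OF H] by (simp add: g_def)
      have tnp: "t i [^] (n * p ^ k) = \<one>" using n(3) HG[OF n(4)] by (simp flip: nat_pow_pow)
      have fnp: "f i [^] (n * p ^ k) = \<one>" using k(1) HG[OF k(2)] by (simp add: mult.commute[of n] flip: nat_pow_pow)
      have "g i [^] (n * p ^ k) = \<one>" using tnp fnp by (simp add: gpow)
      moreover have "prime_factors (n * p ^ k) \<subseteq> insert p \<pi>"
      proof
        fix q assume "q \<in> prime_factors (n * p ^ k)"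
        then have q: "prime q" "q dvd n * p ^ k" by (auto simp: in_prime_factors_iff)
        then have "q dvd n \<or> q = p" using p by (metis prime_dvd_mult_iff prime_dvd_power primes_dvd_imp_eq)
        then show "q \<in> insert p \<pi>" using n(1,2) q(1) by (auto simp: in_prime_factors_iff)
      qed
      moreover have "n * p ^ k > 0" using n(1) prime_gt_0_nat[OF p] by simp
      ultimately have 1: "g i \<in> part (insert p \<pi>)" using gH unfolding part_def by blast
      have "g i \<in> generate G (g ` {..<r})" using i by (intro generate.incl) blast
      then have gg: "g i [^] w \<in> generate G (g ` {..<r})" for w :: nat by (rule subgroup_pow_closed[OF sg])
      obtain u where u: "[u = 1] (mod n)" "[u = 0] (mod (p ^ k))" using binary_chinese_remainder_nat[OF c] by blast
      have "g i [^] u = t i"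
        using pow_cong[OF HG[OF n(4)] n(3) u(1)] pow_cong[OF HG[OF k(2)] k(1) u(2)] HG[OF n(4)] by (simp add: gpow)
      then have 2: "t i \<in> generate G (g ` {..<r})" using gg[of u] by simp
      obtain v where v: "[v = 0] (mod n)" "[v = 1] (mod (p ^ k))" using binary_chinese_remainder_nat[OF c] by blast
      have "g i [^] v = f i"
        using pow_cong[OF HG[OF n(4)] n(3) v(1)] pow_cong[OF HG[OF k(2)] k(1) v(2)] HG[OF k(2)] by (simp add: gpow)
      then have 3: "f i \<in> generate G (g ` {..<r})" using gg[of v] by simp
      show ?thesis using 1 2 3 by blast
    qed
    have tg: "part \<pi> \<subseteq> generate G (g ` {..<r})"
      using t(2) generate_subgroup_incl[OF _ sg, of "t ` {..<r}"] both by blast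
    have fg: "{x \<in> H. \<exists>n. x [^] (p ^ n :: nat) = \<one>} \<subseteq> generate G (g ` {..<r})"
      using f(2) generate_subgroup_incl[OF _ sg, of "f ` {..<r}"] both by blast
    have "part (insert p \<pi>) \<subseteq> generate G (g ` {..<r})"
    proof
      fix x assume "x \<in> part (insert p \<pi>)"
      then obtain N where N: "N > 0" "prime_factors N \<subseteq> insert p \<pi>" "x [^] N = \<one>" and x: "x \<in> H"
        unfolding part_def by blast
      obtain n where n: "N = p ^ multiplicity p N * n" "\<not> p dvd n"
        using N(1) p by (metis multiplicity_decompose' neq0_conv not_prime_unit)
      define k where "k = multiplicity p N"
      have Nk: "N = p ^ k * n" using n(1) by (simp add: k_def)
      have n0: "n > 0" using N(1) Nk by (cases n) auto
      have "prime_factors n \<subseteq> \<pi>"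
      proof
        fix q assume "q \<in> prime_factors n"
        then have q: "prime q" "q dvd n" by (auto simp: in_prime_factors_iff)
        then have "q \<in> prime_factors N" using N(1) Nk by (simp add: in_prime_factors_iff)
        then show "q \<in> \<pi>" using N(2) n(2) q(2) by blast
      qed
      then have c: "coprime n (p ^ k)" using cop n0 by blast
      obtain u where u: "[u = 1] (mod n)" "[u = 0] (mod (p ^ k))" using binary_chinese_remainder_nat[OF c] by blast
      obtain v where v: "[v = 0] (mod n)" "[v = 1] (mod (p ^ k))" using binary_chinese_remainder_nat[OF c] by blast
      have "(x [^] u) [^] n = \<one>"
      proof -
        have "[u * n = 0] (mod N)" using u(2) unfolding Nk by (simp add: cong_0_iff mult_dvd_mono)
        then show ?thesis using pow_cong[OF HG[OF x] N(3)] HG[OF x] by (simp add: nat_pow_pow)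
      qed
      then have 1: "x [^] u \<in> part \<pi>"
        using n0 \<open>prime_factors n \<subseteq> \<pi>\<close> subgroup_pow_closed[OF H x] unfolding part_def by blast
      have "(x [^] v) [^] (p ^ k) = \<one>"
      proof -
        have "[v * p ^ k = 0] (mod N)"
          using v(1) unfolding Nk by (simp add: cong_0_iff mult_dvd_mono mult.commute[of "p ^ k" n])
        then show ?thesis using pow_cong[OF HG[OF x] N(3)] HG[OF x] by (simp add: nat_pow_pow)
      qed
      then have 2: "x [^] v \<in> {x \<in> H. \<exists>n. x [^] (p ^ n :: nat) = \<one>}"
        using subgroup_pow_closed[OF H x] by blast
      have "[u + v = 1] (mod n)" "[u + v = 1] (mod (p ^ k))"
        using cong_add[OF u(1) v(1)] cong_add[OF u(2) v(2)] by simp_all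
      then have "[u + v = 1] (mod N)"
        using c unfolding Nk by (metis coprime_cong_mult_nat mult.commute)
      then have "x [^] (u + v) = x [^] (1::nat)" by (rule pow_cong[OF HG[OF x] N(3)])
      then have "x = x [^] u \<otimes> x [^] v" using nat_pow_mult[OF HG[OF x], of u v] HG[OF x] by simp
      moreover have "x [^] u \<otimes> x [^] v \<in> generate G (g ` {..<r})"
        using subsetD[OF tg 1] subsetD[OF fg 2] by (rule subgroup.m_closed[OF sg])
      ultimately show "x \<in> generate G (g ` {..<r})" by (rule ssubst)
    qed
    then show ?case using both by (intro exI[of _ g]) auto
  qed
  from this[of "prime_factors (card (carrier G))"]
  obtain t where t: "t ` {..<r} \<subseteq> part (prime_factors (card (carrier G)))"
    "part (prime_factors (card (carrier G))) \<subseteq> generate G (t ` {..<r})" by auto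
  have "card (carrier G) > 0" using fin carrier_not_empty by (simp add: card_gt_0_iff)
  then have "H \<subseteq> part (prime_factors (card (carrier G)))"
    using pow_card_subgroup[OF subgroup_self HG] unfolding part_def by blast
  moreover have tH: "t ` {..<r} \<subseteq> H" using t(1) by (auto simp: part_def)
  ultimately have "generate G (t ` {..<r}) = H" using t(2) generate_subgroup_incl[OF tH H] by blast
  moreover have "card (t ` {..<r}) \<le> r" using card_image_le[of "{..<r}" t] by simp
  ultimately show ?thesis using tH by (intro exI[of _ "t ` {..<r}"]) auto
qed

end

section \<open>Finite soluble groups of polynomial index growth\<close>

text \<open>The properties that the quotients by open normal subgroups share: \<open>a\<close> measures the growth of the
  indices of the power subgroups, and \<open>r\<close> counts generators modulo the derived group of \<open>M\<close>.\<close>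

definition solvable_PIG_pair :: "nat \<Rightarrow> nat \<Rightarrow> ('a, 'b) monoid_scheme \<Rightarrow> 'a set \<Rightarrow> bool" where
  "solvable_PIG_pair a r G M \<longleftrightarrow>
     group G \<and> finite (carrier G) \<and> solvable G \<and>
     (\<forall>n\<ge>1. card (carrier G) \<le> n ^ a * card (power_subgroup G n)) \<and>
     M \<lhd> G \<and> nilpotent_group (G\<lparr>carrier := M\<rparr>) \<and>
     (\<forall>H. subgroup H G \<longrightarrow>
       (\<exists>X\<subseteq>H. finite X \<and> card X \<le> r \<and> H \<subseteq> generate G (X \<union> derived G M)))"

context group begin

lemma restricted_quotient_hom:
  assumes K: "K \<lhd> G" and M: "subgroup M G"
  shows "group_hom (G\<lparr>carrier := M\<rparr>) ((G Mod K)\<lparr>carrier := (\<lambda>x. K #> x) ` M\<rparr>) (\<lambda>x. K #> x)"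
proof -
  interpret \<pi>: group_hom G "G Mod K" "\<lambda>x. K #> x" using K by (rule quotient_hom)
  have "(\<lambda>x. K #> x) \<in> hom (G\<lparr>carrier := M\<rparr>) ((G Mod K)\<lparr>carrier := (\<lambda>x. K #> x) ` M\<rparr>)"
    using subgroup.mem_carrier[OF M] by (intro homI) (auto simp del: mult_FactGroup)
  then show ?thesis
    using subgroup_imp_group[OF M] \<pi>.H.subgroup_imp_group[OF \<pi>.subgroup_img_is_subgroup[OF M]]
    by (intro group_hom.intro group_hom_axioms.intro)
qed

lemma nilpotent_group_quotient_image:
  assumes "K \<lhd> G" "subgroup M G" "nilpotent_group (G\<lparr>carrier := M\<rparr>)"
  shows "nilpotent_group ((G Mod K)\<lparr>carrier := (\<lambda>x. K #> x) ` M\<rparr>)"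
  using group_hom.nilpotent_group_image[OF restricted_quotient_hom[OF assms(1,2)]] assms(3) by simp

end

lemma solvable_PIG_pair_quotient:
  fixes G (structure)
  assumes G: "solvable_PIG_pair a r G M" and L: "L \<lhd> G"
  shows "solvable_PIG_pair a r (G Mod L) ((\<lambda>x. L #> x) ` M)"
proof -
  interpret group G using G by (simp add: solvable_PIG_pair_def)
  have fin: "finite (carrier G)" and sol: "solvable G"
    and PIG: "\<And>n. n \<ge> 1 \<Longrightarrow> card (carrier G) \<le> n ^ a * card (power_subgroup G n)"
    and M: "M \<lhd> G" "nilpotent_group (G\<lparr>carrier := M\<rparr>)"
    and gen: "\<And>H. subgroup H G \<Longrightarrow> \<exists>X\<subseteq>H. finite X \<and> card X \<le> r \<and> H \<subseteq> generate G (X \<union> derived G M)"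
    using G by (auto simp: solvable_PIG_pair_def)
  let ?\<pi> = "\<lambda>x. L #> x"
  interpret \<pi>: group_hom G "G Mod L" ?\<pi> using L by (rule quotient_hom)
  have sL: "subgroup L G" using L by (rule normal_imp_subgroup)
  have sM: "subgroup M G" using M(1) by (rule normal_imp_subgroup)
  have MG: "M \<subseteq> carrier G" using sM by (rule subgroup.subset)
  have posL: "card L > 0" using subgroup.finite_imp_card_positive[OF sL fin] .
  show ?thesis
    unfolding solvable_PIG_pair_def
  proof (intro conjI allI impI)
    show "group (G Mod L)" by (rule \<pi>.H.is_group)
    show "finite (carrier (G Mod L))" using fin by (simp add: carrier_FactGroup)
    show "solvable (G Mod L)" using \<pi>.surj_hom_imp_solvable[OF quotient_image_carrier sol] .
    show "?\<pi> ` M \<lhd> G Mod L"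
      using normal.surj_hom_normal_subgroup[OF M(1) \<pi>.group_hom_axioms quotient_image_carrier] .
    show "nilpotent_group ((G Mod L)\<lparr>carrier := ?\<pi> ` M\<rparr>)"
      using L sM M(2) by (rule nilpotent_group_quotient_image)
  next
    fix n :: nat assume n: "1 \<le> n"
    have fP: "finite (power_subgroup G n)"
      using finite_subset[OF subgroup.subset[OF normal_imp_subgroup[OF power_subgroup_normal]] fin] .
    have "card (carrier (G Mod L)) * card L = card (carrier G)" using card_quotient[OF L] .
    also have "\<dots> \<le> n ^ a * card (power_subgroup G n)" using PIG[OF n] .
    also have "card (power_subgroup G n) = card (?\<pi> ` power_subgroup G n) * card (power_subgroup G n \<inter> L)"
      using card_subgroup_quotient_image[OF L normal_imp_subgroup[OF power_subgroup_normal] fP] .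
    also have "n ^ a * (card (?\<pi> ` power_subgroup G n) * card (power_subgroup G n \<inter> L))
        \<le> n ^ a * (card (?\<pi> ` power_subgroup G n) * card L)"
      using finite_subset[OF subgroup.subset[OF sL] fin] by (intro mult_le_mono2 card_mono) auto
    finally have "card (carrier (G Mod L)) \<le> n ^ a * card (?\<pi> ` power_subgroup G n)"
      using posL by (simp add: mult.assoc[symmetric])
    then show "card (carrier (G Mod L)) \<le> n ^ a * card (power_subgroup (G Mod L) n)"
      using \<pi>.power_subgroup_image[OF quotient_image_carrier] by simp
  next
    fix H assume H: "subgroup H (G Mod L)"
    define H' where "H' = {x \<in> carrier G. ?\<pi> x \<in> H}"
    have sH': "subgroup H' G" unfolding H'_def using L H by (rule subgroup_preimage_quotient)
    have H'H: "?\<pi> ` H' = H"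
    proof
      show "H \<subseteq> ?\<pi> ` H'"
        using subgroup.subset[OF H] unfolding H'_def carrier_FactGroup by blast
    qed (auto simp: H'_def)
    obtain X where X: "X \<subseteq> H'" "finite X" "card X \<le> r" "H' \<subseteq> generate G (X \<union> derived G M)"
      using gen[OF sH'] by blast
    have "X \<union> derived G M \<subseteq> carrier G"
      using X(1) subgroup.subset[OF sH'] derived_in_carrier[OF MG] by blast
    then have "generate (G Mod L) (?\<pi> ` X \<union> derived (G Mod L) (?\<pi> ` M)) = ?\<pi> ` generate G (X \<union> derived G M)"
      using \<pi>.generate_img[of "X \<union> derived G M"] \<pi>.derived_img[OF MG] by (simp add: image_Un)
    then have "H \<subseteq> generate (G Mod L) (?\<pi> ` X \<union> derived (G Mod L) (?\<pi> ` M))"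
      using X(4) H'H by blast
    moreover have "?\<pi> ` X \<subseteq> H" using X(1) H'H by blast
    moreover have "card (?\<pi> ` X) \<le> r" using card_image_le[OF X(2), of ?\<pi>] X(3) by linarith
    ultimately show "\<exists>X\<subseteq>H. finite X \<and> card X \<le> r \<and> H \<subseteq> generate (G Mod L) (X \<union> derived (G Mod L) (?\<pi> ` M))"
      using X(2) by (intro exI[of _ "?\<pi> ` X"]) auto
  qed
qed

text \<open>Let \<open>L\<close> be the largest normal subgroup of order prime to \<open>p\<close>. The \<open>p\<close>-elements of \<open>M\<close> embed
  into \<open>G / L\<close>, which has no nontrivial normal \<open>q\<close>-subgroups for \<open>q \<noteq> p\<close>, and in which therefore
  the image of \<open>M\<close> is a \<open>p\<close>-group.\<close>

lemma solvable_PIG_pair_p_rank: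
  fixes G (structure)
  assumes G: "solvable_PIG_pair a r G M" and p: "prime p"
    and H: "subgroup H G" "H \<subseteq> {x \<in> M. \<exists>n. x [^]\<^bsub>G\<^esub> (p ^ n :: nat) = \<one>\<^bsub>G\<^esub>}"
  shows "\<exists>X. X \<subseteq> H \<and> finite X \<and> card X \<le> p_rank_bound (r * r) a \<and> generate G X = H"
proof -
  interpret group G using G by (simp add: solvable_PIG_pair_def)
  have fin: "finite (carrier G)" using G by (simp add: solvable_PIG_pair_def)
  have HG: "x \<in> carrier G" if "x \<in> H" for x using H(1) that by (rule subgroup.mem_carrier)
  define \<L> where "\<L> = {L. L \<lhd> G \<and> coprime (card L) p}"
  have "finite \<L>"
    using fin normal_imp_subgroup subgroup.subset
    by (intro finite_subset[of \<L> "Pow (carrier G)"]) (fastforce simp: \<L>_def)+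
  moreover have "{\<one>} \<in> \<L>" using one_is_normal by (auto simp: \<L>_def)
  ultimately obtain L where "L \<in> \<L>" and max: "\<And>K. K \<in> \<L> \<Longrightarrow> L \<subseteq> K \<Longrightarrow> L = K"
    using finite_has_maximal[of \<L>] by blast
  then have L: "L \<lhd> G" "coprime (card L) p" by (auto simp: \<L>_def)
  have sL: "subgroup L G" using L(1) by (rule normal_imp_subgroup)
  let ?Q = "G Mod L" and ?\<pi> = "\<lambda>x. L #> x"
  interpret \<pi>: group_hom G ?Q ?\<pi> using L(1) by (rule quotient_hom)
  have Q: "solvable_PIG_pair a r ?Q (?\<pi> ` M)" using G L(1) by (rule solvable_PIG_pair_quotient)
  then have finQ: "finite (carrier ?Q)" and solQ: "solvable ?Q"
    and PIGQ: "\<And>n. n \<ge> 1 \<Longrightarrow> card (carrier ?Q) \<le> n ^ a * card (power_subgroup ?Q n)"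
    and MQ: "?\<pi> ` M \<lhd> ?Q" "nilpotent_group (?Q\<lparr>carrier := ?\<pi> ` M\<rparr>)"
    and genQ: "\<And>H. subgroup H ?Q \<Longrightarrow> \<exists>X\<subseteq>H. finite X \<and> card X \<le> r \<and> H \<subseteq> generate ?Q (X \<union> derived ?Q (?\<pi> ` M))"
    by (auto simp: solvable_PIG_pair_def)
  have noq: "N = {\<one>\<^bsub>?Q\<^esub>}" if "q \<noteq> p" "N \<lhd> ?Q" "p_subgroup ?Q q N" for q N
  proof -
    define K where "K = {x \<in> carrier G. ?\<pi> x \<in> N}"
    have nK: "K \<lhd> G" unfolding K_def using L(1) that(2) by (rule normal_preimage_quotient)
    have sK: "subgroup K G" using nK by (rule normal_imp_subgroup)
    have sN: "subgroup N ?Q" using that(2) by (rule normal_imp_subgroup)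
    have LK: "L \<subseteq> K"
    proof
      fix x assume x: "x \<in> L"
      then have "x \<in> carrier G" "?\<pi> x = \<one>\<^bsub>?Q\<^esub>"
        using subgroup.mem_carrier[OF sL] quotient_one_iff[OF L(1)] by auto
      then show "x \<in> K" using subgroup.one_closed[OF sN] by (simp add: K_def)
    qed
    have KN: "?\<pi> ` K = N"
    proof
      show "N \<subseteq> ?\<pi> ` K" using subgroup.subset[OF sN] unfolding K_def carrier_FactGroup by blast
    qed (auto simp: K_def)
    have "card K = card N * card L"
      using card_subgroup_quotient_image[OF L(1) sK] finite_subset[OF subgroup.subset[OF sK] fin] LK KN
      by (simp add: Int_absorb1)
    moreover have "coprime (card N) p"
      using that(1,3) p unfolding p_subgroup_def by (auto simp: primes_coprime)
    ultimately have "K \<in> \<L>" using nK L(2) by (simp add: \<L>_def)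
    then have "K = L" using max LK by blast
    have "x = \<one>\<^bsub>?Q\<^esub>" if xN: "x \<in> N" for x
    proof -
      obtain y where "y \<in> K" "x = ?\<pi> y" using xN KN by blast
      then show ?thesis using quotient_one_iff[OF L(1), of y] \<open>K = L\<close> subgroup.mem_carrier[OF sL] by auto
    qed
    then show ?thesis using subgroup.one_closed[OF sN] by blast
  qed
  have sMQ: "subgroup (?\<pi> ` M) ?Q" using MQ(1) by (rule normal_imp_subgroup)
  have "q = p" if q: "prime q" "q dvd card (?\<pi> ` M)" for q
  proof (rule ccontr)
    assume "q \<noteq> p"
    then have "{x \<in> ?\<pi> ` M. \<exists>n. x [^]\<^bsub>?Q\<^esub> (q ^ n :: nat) = \<one>\<^bsub>?Q\<^esub>} = {\<one>\<^bsub>?Q\<^esub>}"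
      using \<pi>.H.normal_nilpotent_p_elements[OF finQ MQ q(1)] by (rule noq)
    moreover obtain x n where "x \<in> ?\<pi> ` M" "x \<noteq> \<one>\<^bsub>?Q\<^esub>" "x [^]\<^bsub>?Q\<^esub> (q ^ n :: nat) = \<one>\<^bsub>?Q\<^esub>"
      using \<pi>.H.prime_power_order_element[OF finQ sMQ q] by blast
    ultimately show False by blast
  qed
  then have pMQ: "p_subgroup ?Q p (?\<pi> ` M)"
    using only_prime_divisor_imp_power[OF subgroup.finite_imp_card_positive[OF sMQ finQ] p] sMQ p
    unfolding p_subgroup_def by blast
  have sHQ: "subgroup (?\<pi> ` H) ?Q" using H(1) by (rule \<pi>.subgroup_img_is_subgroup)
  have HMQ: "?\<pi> ` H \<subseteq> ?\<pi> ` M" using H(2) by blast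
  have "\<exists>Y. Y \<subseteq> ?\<pi> ` H \<and> finite Y \<and> card Y \<le> p_rank_bound (r * r) a \<and> generate ?Q Y = ?\<pi> ` H"
    by (rule \<pi>.H.normal_p_subgroup_rank_le[OF finQ solQ PIGQ noq pMQ MQ(1) genQ sHQ HMQ])
  then obtain Y where Y: "Y \<subseteq> ?\<pi> ` H" "finite Y" "card Y \<le> p_rank_bound (r * r) a" "generate ?Q Y = ?\<pi> ` H"
    by (elim exE conjE)
  obtain X where X: "X \<subseteq> H" "inj_on ?\<pi> X" "Y = ?\<pi> ` X"
    using Y(1)[unfolded subset_image_inj] by (elim exE conjE)
  have XG: "X \<subseteq> carrier G" using X(1) HG by blast
  have sX: "subgroup (generate G X) G" using XG by (rule generate_is_subgroup)
  have XH: "generate G X \<subseteq> H" using X(1) H(1) by (rule generate_subgroup_incl)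
  have "H \<subseteq> generate G X"
  proof
    fix h assume h: "h \<in> H"
    have "?\<pi> h \<in> ?\<pi> ` generate G X"
      using h Y(4) \<pi>.generate_img[OF XG] unfolding X(3) by blast
    then obtain w where w: "w \<in> generate G X" "?\<pi> h = ?\<pi> w" by blast
    have wH: "w \<in> H" using w XH by blast
    define d where "d = h \<otimes> inv w"
    have dL: "d \<in> L" unfolding d_def using quotient_eq_iff[OF L(1) HG[OF h] HG[OF wH]] w(2) by blast
    have dH: "d \<in> H" unfolding d_def using h wH H(1) by (simp add: subgroup.m_closed subgroup.m_inv_closed)
    obtain n where n: "d [^] (p ^ n :: nat) = \<one>" using dH H(2) by blast
    have "coprime (p ^ n) (card L)" using L(2) by (simp add: coprime_commute)
    then have "d = \<one>" using pow_coprime_one[OF HG[OF dH] n pow_card_subgroup[OF sL dL]] by blast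
    then have "h = w" unfolding d_def using HG[OF h] HG[OF wH] by (metis inv_equality inv_inv inv_closed)
    then show "h \<in> generate G X" using w(1) by simp
  qed
  then have "generate G X = H" using XH by blast
  moreover have "card X \<le> p_rank_bound (r * r) a" using Y(3) X(2,3) by (simp add: card_image)
  moreover have "finite X" using Y(2) X(2,3) by (simp add: finite_image_iff)
  ultimately show ?thesis using X(1) by blast
qed

text \<open>The primes together contribute \<open>p_rank_bound (r * r) a\<close> generators of \<open>H \<inter> M\<close>, and \<open>r\<close> elements
  generate \<open>H\<close> modulo \<open>M\<close>.\<close>

theorem solvable_PIG_pair_rank:
  fixes G (structure)
  assumes G: "solvable_PIG_pair a r G M" and H: "subgroup H G"
  shows "\<exists>X. X \<subseteq> H \<and> finite X \<and> card X \<le> r + p_rank_bound (r * r) a \<and> generate G X = H"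
proof -
  interpret group G using G by (simp add: solvable_PIG_pair_def)
  define s where "s = p_rank_bound (r * r) a"
  have fin: "finite (carrier G)" and M: "M \<lhd> G" "nilpotent_group (G\<lparr>carrier := M\<rparr>)"
    using G by (auto simp: solvable_PIG_pair_def)
  have sM: "subgroup M G" using M(1) by (rule normal_imp_subgroup)
  have MG: "x \<in> carrier G" if "x \<in> M" for x using sM that by (rule subgroup.mem_carrier)
  have HG: "x \<in> carrier G" if "x \<in> H" for x using H that by (rule subgroup.mem_carrier)
  have sHM: "subgroup (H \<inter> M) G" using H sM by (rule subgroups_Inter_pair)
  have "\<exists>Y. Y \<subseteq> H \<inter> M \<and> finite Y \<and> card Y \<le> s \<and> generate G Y = H \<inter> M"
  proof (rule coprime_commuting_generators[OF fin sHM])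
    show "x \<otimes> y = y \<otimes> x"
      if "x \<in> H \<inter> M" "y \<in> H \<inter> M" "x [^] (m::nat) = \<one>" "y [^] (n::nat) = \<one>" "coprime m n" for x y m n
      using normal_nilpotent_coprime_commute[OF M _ _ that(3-5)] that(1,2) by blast
  next
    fix p :: nat assume p: "prime p"
    let ?P = "{x \<in> M. \<exists>n. x [^] (p ^ n :: nat) = \<one>}"
    have sP: "subgroup (H \<inter> ?P) G"
      using H normal_imp_subgroup[OF normal_nilpotent_p_elements(1)[OF fin M p]] by (rule subgroups_Inter_pair)
    have eq: "H \<inter> ?P = {x \<in> H \<inter> M. \<exists>n. x [^] (p ^ n :: nat) = \<one>}" by blast
    obtain X where "X \<subseteq> H \<inter> ?P" "finite X" "card X \<le> s" "generate G X = H \<inter> ?P"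
      using solvable_PIG_pair_p_rank[OF G p sP] unfolding s_def by blast
    from generators_indexed[OF sP this] obtain f where "f ` {..<s} \<subseteq> H \<inter> ?P" "generate G (f ` {..<s}) = H \<inter> ?P"
      by blast
    then show "\<exists>f. f ` {..<s} \<subseteq> {x \<in> H \<inter> M. \<exists>n. x [^] (p ^ n :: nat) = \<one>} \<and>
        {x \<in> H \<inter> M. \<exists>n. x [^] (p ^ n :: nat) = \<one>} \<subseteq> generate G (f ` {..<s})"
      unfolding eq[symmetric] by (intro exI[of _ f]) simp
  qed
  then obtain Y where Y: "Y \<subseteq> H \<inter> M" "finite Y" "card Y \<le> s" "generate G Y = H \<inter> M" by blast
  obtain X where X: "X \<subseteq> H" "finite X" "card X \<le> r" "H \<subseteq> generate G (X \<union> derived G M)"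
    using G H unfolding solvable_PIG_pair_def by blast
  have XY: "X \<union> Y \<subseteq> H" using X(1) Y(1) by blast
  have sXY: "subgroup (generate G (X \<union> Y)) G" using XY HG by (intro generate_is_subgroup) blast
  have XYH: "generate G (X \<union> Y) \<subseteq> H" using XY H by (rule generate_subgroup_incl)
  interpret \<pi>: group_hom G "G Mod M" "\<lambda>x. M #> x" using M(1) by (rule quotient_hom)
  have "H \<subseteq> generate G (X \<union> Y)"
  proof
    fix h assume h: "h \<in> H"
    have "(\<lambda>x. M #> x) ` generate G (X \<union> Y) = generate (G Mod M) ((\<lambda>x. M #> x) ` (X \<union> Y))"
      using XY HG by (intro \<pi>.generate_img[symmetric]) blast
    then have sub: "subgroup (generate (G Mod M) ((\<lambda>x. M #> x) ` (X \<union> Y))) (G Mod M)"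
      using \<pi>.subgroup_img_is_subgroup[OF sXY] by simp
    have "generate G (X \<union> derived G M) \<subseteq> {x \<in> carrier G. M #> x \<in> (\<lambda>x. M #> x) ` generate G (X \<union> Y)}"
    proof (rule generate_subgroup_incl)
      show "subgroup {x \<in> carrier G. M #> x \<in> (\<lambda>x. M #> x) ` generate G (X \<union> Y)} G"
        using M(1) \<pi>.subgroup_img_is_subgroup[OF sXY] by (rule subgroup_preimage_quotient)
      have "M #> x \<in> (\<lambda>x. M #> x) ` generate G (X \<union> Y)" if "x \<in> X" for x
        using that by (intro imageI generate.incl) blast
      moreover have "M #> x \<in> (\<lambda>x. M #> x) ` generate G (X \<union> Y)" if "x \<in> derived G M" for x
      proof -
        have "x \<in> M" using derived_incl[OF subset_refl sM] that by blast
        then have "M #> x = M #> \<one>"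
          using quotient_one_iff[OF M(1) MG] coset_mult_one subgroup.subset[OF sM] by simp
        moreover have "M #> \<one> \<in> (\<lambda>x. M #> x) ` generate G (X \<union> Y)" by (intro imageI generate.one)
        ultimately show ?thesis by (simp only:)
      qed
      ultimately show "X \<union> derived G M \<subseteq> {x \<in> carrier G. M #> x \<in> (\<lambda>x. M #> x) ` generate G (X \<union> Y)}"
        using X(1) HG derived_in_carrier[OF subgroup.subset[OF sM]] by blast
    qed
    then obtain w where w: "w \<in> generate G (X \<union> Y)" "M #> h = M #> w" using h X(4) by blast
    have wH: "w \<in> H" using w XYH by blast
    have "h \<otimes> inv w \<in> M" using quotient_eq_iff[OF M(1) HG[OF h] HG[OF wH]] w(2) by blast
    moreover have "h \<otimes> inv w \<in> H" using h wH H by (simp add: subgroup.m_closed subgroup.m_inv_closed)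
    moreover have "generate G Y \<subseteq> generate G (X \<union> Y)" by (rule mono_generate) simp
    ultimately have "h \<otimes> inv w \<in> generate G (X \<union> Y)" using Y(4) by blast
    then have "h \<otimes> inv w \<otimes> w \<in> generate G (X \<union> Y)" using w(1) by (rule subgroup.m_closed[OF sXY])
    then show "h \<in> generate G (X \<union> Y)" using HG[OF h] HG[OF wH] by (simp add: m_assoc)
  qed
  then have "generate G (X \<union> Y) = H" using XYH by blast
  moreover have "card (X \<union> Y) \<le> r + s" using card_Un_le[of X Y] X(3) Y(3) by linarith
  ultimately show ?thesis using XY X(2) Y(2) unfolding s_def by (intro exI[of _ "X \<union> Y"]) auto
qed

section \<open>Inverse limits of finite groups\<close>

lemma inverse_limit_closedin:
  assumes "inverse_system I R H \<phi>"
  shows "closedin (product_topology (\<lambda>i. discrete_topology (carrier (H i))) I) (carrier (inverse_limit I R H \<phi>))"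
proof -
  let ?X = "product_topology (\<lambda>i. discrete_topology (carrier (H i))) I"
  have RI: "R \<subseteq> I \<times> I" using assms by (auto simp: inverse_system_def partial_order_on_def preorder_on_def)
  have cl: "closedin ?X {x \<in> topspace ?X. \<phi> i j (x j) = x i}" if ij: "(i, j) \<in> R" for i j
  proof (rule closedin_continuous_maps_eq[OF Hausdorff_space_discrete_topology])
    have i: "i \<in> I" and j: "j \<in> I" using ij RI by auto
    have "continuous_map (discrete_topology (carrier (H j))) (discrete_topology (carrier (H i))) (\<phi> i j)"
      using assms ij by (auto simp: inverse_system_def hom_def)
    then have "continuous_map ?X (discrete_topology (carrier (H i))) (\<phi> i j \<circ> (\<lambda>x. x j))"
      using continuous_map_product_projection[OF j, of "\<lambda>i. discrete_topology (carrier (H i))"]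
      by (rule continuous_map_compose[rotated])
    then show "continuous_map ?X (discrete_topology (carrier (H i))) (\<lambda>x. \<phi> i j (x j))" by (simp add: o_def)
    show "continuous_map ?X (discrete_topology (carrier (H i))) (\<lambda>x. x i)"
      using continuous_map_product_projection[OF i, of "\<lambda>i. discrete_topology (carrier (H i))"] .
  qed
  have "carrier (inverse_limit I R H \<phi>)
      = topspace ?X \<inter> (\<Inter>(i, j)\<in>R. {x \<in> topspace ?X. \<phi> i j (x j) = x i})"
    by (auto simp: inverse_limit_def)
  also have "closedin ?X \<dots>"
  proof (cases "R = {}")
    case False
    then show ?thesis using cl by (intro closedin_Int closedin_Inter closedin_topspace) auto
  qed (use closedin_topspace[of ?X] in simp)
  finally show ?thesis .
qed

lemma inverse_limit_of_finite_compact: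
  assumes "inverse_limit_of_finite P G T"
  shows "compact_space T"
proof -
  obtain I :: "'a set set" and R and H :: "'a set \<Rightarrow> nat monoid" and \<phi> f
    where sys: "inverse_system I R H \<phi>" and fin: "\<forall>i\<in>I. finite (carrier (H i)) \<and> P (H i)"
      and hom: "homeomorphic_map T (inverse_limit_topology I R H \<phi>) f"
    using assms unfolding inverse_limit_of_finite_def by blast
  let ?X = "product_topology (\<lambda>i. discrete_topology (carrier (H i))) I"
  have "compact_space ?X"
    using fin by (auto simp: compact_space_product_topology compact_space_discrete_topology)
  then have "compact_space (inverse_limit_topology I R H \<phi>)"
    unfolding inverse_limit_topology_def
    using inverse_limit_closedin[OF sys] by (intro compact_space_subtopology closedin_compact_space)
  then show ?thesis using hom homeomorphic_compact_space homeomorphic_map_imp_homeomorphic_space by metis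
qed

lemma directed_finite_upper_bound:
  assumes sys: "inverse_system I R H \<phi>" and "finite J" "J \<subseteq> I"
  shows "\<exists>k\<in>I. \<forall>j\<in>J. (j, k) \<in> R"
  using assms(2,3)
proof (induction J rule: finite_induct)
  case empty
  then show ?case using sys by (auto simp: inverse_system_def)
next
  case (insert i J)
  then obtain k where k: "k \<in> I" "\<forall>j\<in>J. (j, k) \<in> R" by auto
  obtain l where l: "l \<in> I" "(i, l) \<in> R" "(k, l) \<in> R"
    using sys insert.prems k(1) unfolding inverse_system_def by (meson insert_subset)
  have "trans R" using sys by (auto simp: inverse_system_def partial_order_on_def preorder_on_def)
  have "(j, l) \<in> R" if "j \<in> insert i J" for j
  proof (cases "j = i")
    case False
    then have "(j, k) \<in> R" using that k(2) by blast
    then show ?thesis using \<open>trans R\<close> l(3) by (meson transD)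
  qed (use l(2) in simp)
  then show ?case using l(1) by blast
qed

text \<open>A basic neighbourhood of the identity restricts only finitely many coordinates. By directedness
  there is an index \<open>k\<close> above them, and the coordinate at \<open>k\<close> determines them all.\<close>

lemma inverse_limit_of_finite_small_kernel:
  fixes G (structure)
  assumes "inverse_limit_of_finite P G T" and U: "openin T U" "\<one> \<in> U"
  obtains A :: "nat monoid" and \<pi>
  where "group A" "P A" "\<pi> \<in> hom G A" "{x \<in> carrier G. \<pi> x = \<one>\<^bsub>A\<^esub>} \<subseteq> U"
    "openin T {x \<in> carrier G. \<pi> x = \<one>\<^bsub>A\<^esub>}"
proof -
  obtain I :: "'a set set" and R and H :: "'a set \<Rightarrow> nat monoid" and \<phi> f
    where top: "topological_group G T" and sys: "inverse_system I R H \<phi>"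
      and fin: "\<forall>i\<in>I. finite (carrier (H i)) \<and> P (H i)"
      and iso: "f \<in> iso G (inverse_limit I R H \<phi>)"
      and hom: "homeomorphic_map T (inverse_limit_topology I R H \<phi>) f"
    using assms(1) unfolding inverse_limit_of_finite_def by blast
  interpret group G using top by (simp add: topological_group_def)
  have topT: "topspace T = carrier G" using top by (simp add: topological_group_def)
  let ?L = "inverse_limit I R H \<phi>"
  let ?X = "product_topology (\<lambda>i. discrete_topology (carrier (H i))) I"
  have RI: "R \<subseteq> I \<times> I" using sys by (auto simp: inverse_system_def partial_order_on_def preorder_on_def)
  have grp: "group (H i)" if "i \<in> I" for i using sys that by (auto simp: inverse_system_def)
  have fL: "f x \<in> carrier ?L" if "x \<in> carrier G" for x using iso that by (auto simp: iso_def hom_def)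
  have f_mult: "f (x \<otimes> y) = f x \<otimes>\<^bsub>?L\<^esub> f y" if "x \<in> carrier G" "y \<in> carrier G" for x y
    using iso that by (auto simp: iso_def hom_def)
  have fH: "f x i \<in> carrier (H i)" if "x \<in> carrier G" "i \<in> I" for x i
    using fL[OF that(1)] that(2) by (auto simp: inverse_limit_def)
  have f\<phi>: "\<phi> i j (f x j) = f x i" if "x \<in> carrier G" "(i, j) \<in> R" for x i j
    using fL[OF that(1)] that(2) by (auto simp: inverse_limit_def)
  have pr: "(\<lambda>x. f x i) \<in> hom G (H i)" if i: "i \<in> I" for i
  proof (rule homI)
    show "f x i \<in> carrier (H i)" if "x \<in> carrier G" for x using fH that i by blast
    show "f (x \<otimes> y) i = f x i \<otimes>\<^bsub>H i\<^esub> f y i" if "x \<in> carrier G" "y \<in> carrier G" for x y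
      using f_mult[OF that] i by (simp add: inverse_limit_def)
  qed
  have f_one: "f \<one> i = \<one>\<^bsub>H i\<^esub>" if "i \<in> I" for i
    using hom_one[OF pr[OF that] is_group grp[OF that]] .
  have f1: "f \<one> \<in> f ` U" using U(2) by blast
  have "openin (inverse_limit_topology I R H \<phi>) (f ` U)"
    using hom U(1) homeomorphic_map_openness_eq by blast
  then obtain W where W: "openin ?X W" "f ` U = W \<inter> carrier ?L"
    unfolding inverse_limit_topology_def openin_subtopology by blast
  have "f \<one> \<in> W" using f1 W(2) by blast
  then obtain V where V: "finite {i \<in> I. V i \<noteq> topspace (discrete_topology (carrier (H i)))}"
    "f \<one> \<in> Pi\<^sub>E I V" "Pi\<^sub>E I V \<subseteq> W"
    using W(1) unfolding openin_product_topology_alt by meson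
  define J where "J = {i \<in> I. V i \<noteq> carrier (H i)}"
  have "finite J" "J \<subseteq> I" using V(1) by (auto simp: J_def)
  then obtain k where k: "k \<in> I" "\<forall>j\<in>J. (j, k) \<in> R" using directed_finite_upper_bound[OF sys] by blast
  let ?K = "{x \<in> carrier G. f x k = \<one>\<^bsub>H k\<^esub>}"
  have "?K \<subseteq> U"
  proof
    fix x assume "x \<in> ?K"
    then have x: "x \<in> carrier G" "f x k = \<one>\<^bsub>H k\<^esub>" by auto
    have "f x i \<in> V i" if i: "i \<in> I" for i
    proof (cases "i \<in> J")
      case True
      then have ik: "(i, k) \<in> R" using k(2) by blast
      have "f x i = \<phi> i k (f x k)" using f\<phi>[OF x(1) ik] by simp
      also have "\<dots> = \<phi> i k (f \<one> k)" using x(2) f_one[OF k(1)] by simp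
      also have "\<dots> = f \<one> i" using f\<phi>[OF one_closed ik] .
      finally show ?thesis using V(2) i by auto
    next
      case False
      then show ?thesis using fH[OF x(1) i] i by (simp add: J_def)
    qed
    moreover have "f x \<in> extensional I" using fL[OF x(1)] by (auto simp: inverse_limit_def PiE_def)
    ultimately have "f x \<in> Pi\<^sub>E I V" by (auto simp: PiE_def)
    then have "f x \<in> f ` U" using V(3) W(2) fL[OF x(1)] by blast
    then obtain u where u: "u \<in> U" "f x = f u" by blast
    moreover have "u \<in> carrier G" using openin_subset[OF U(1)] topT u(1) by blast
    ultimately show "x \<in> U" using x(1) homeomorphic_imp_injective_map[OF hom] topT by (metis inj_onD)
  qed
  moreover have "openin T ?K"
  proof -
    have "continuous_map (inverse_limit_topology I R H \<phi>) (discrete_topology (carrier (H k))) (\<lambda>x. x k)"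
      unfolding inverse_limit_topology_def
      using continuous_map_product_projection[OF k(1), of "\<lambda>i. discrete_topology (carrier (H i))"]
      by (rule continuous_map_from_subtopology)
    then have "continuous_map T (discrete_topology (carrier (H k))) ((\<lambda>x. x k) \<circ> f)"
      using homeomorphic_imp_continuous_map[OF hom] by (rule continuous_map_compose[rotated])
    then have "openin T {x \<in> topspace T. ((\<lambda>x. x k) \<circ> f) x \<in> {\<one>\<^bsub>H k\<^esub>}}"
      by (rule openin_continuous_map_preimage)
        (simp add: group.is_monoid[OF grp[OF k(1)], THEN monoid.one_closed])
    then show ?thesis by (simp add: topT)
  qed
  ultimately show ?thesis using that[of "H k" "\<lambda>x. f x k"] grp[OF k(1)] fin k(1) pr[OF k(1)] by blast
qed

section \<open>Profinite groups\<close>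

text \<open>This description of an inverse limit of finite groups does not involve an index set and transition
  maps.\<close>

locale profinite = group G for G (structure) and T +
  assumes topology: "topological_group G T"
    and compact: "compact_space T"
    and base: "\<And>U. openin T U \<Longrightarrow> \<one> \<in> U \<Longrightarrow> \<exists>K. K \<lhd> G \<and> openin T K \<and> K \<subseteq> U"

lemma inverse_limit_of_finite_profinite:
  fixes G (structure)
  assumes G: "inverse_limit_of_finite P G T"
  shows "profinite G T"
proof -
  have top: "topological_group G T" using G by (simp add: inverse_limit_of_finite_def)
  interpret group G using top by (simp add: topological_group_def)
  have "\<exists>K. K \<lhd> G \<and> openin T K \<and> K \<subseteq> U" if U: "openin T U" "\<one> \<in> U" for U
  proof -
    obtain A :: "nat monoid" and \<pi> where A: "group A" "\<pi> \<in> hom G A" "{x \<in> carrier G. \<pi> x = \<one>\<^bsub>A\<^esub>} \<subseteq> U"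
      "openin T {x \<in> carrier G. \<pi> x = \<one>\<^bsub>A\<^esub>}"
      using inverse_limit_of_finite_small_kernel[OF G U] by blast
    interpret \<pi>: group_hom G A \<pi>
      using A(1,2) by (intro group_hom.intro group_hom_axioms.intro is_group)
    have "{x \<in> carrier G. \<pi> x = \<one>\<^bsub>A\<^esub>} \<lhd> G" using \<pi>.normal_kernel by (simp add: kernel_def)
    then show ?thesis using A(3,4) by blast
  qed
  then show ?thesis
    using top inverse_limit_of_finite_compact[OF G] by unfold_locales
qed

context profinite begin

lemma topspace_eq: "topspace T = carrier G"
  using topology by (simp add: topological_group_def)

lemma continuous_map_mult_right:
  assumes "a \<in> carrier G"
  shows "continuous_map T T (\<lambda>x. x \<otimes> a)"
proof -
  have "continuous_map T (prod_topology T T) (\<lambda>x. (x, a))"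
    using assms by (intro continuous_map_pairedI) (auto simp: topspace_eq)
  moreover have "continuous_map (prod_topology T T) T (\<lambda>(x, y). x \<otimes> y)"
    using topology by (simp add: topological_group_def)
  ultimately have "continuous_map T T ((\<lambda>(x, y). x \<otimes> y) \<circ> (\<lambda>x. (x, a)))" by (rule continuous_map_compose)
  then show ?thesis by (simp add: o_def)
qed

lemma open_translate:
  assumes "openin T U" "a \<in> carrier G"
  shows "openin T {x \<in> carrier G. x \<otimes> a \<in> U}"
  using openin_continuous_map_preimage[OF continuous_map_mult_right[OF assms(2)] assms(1)]
  by (simp add: topspace_eq)

lemma open_coset:
  assumes "K \<lhd> G" "openin T K" "a \<in> carrier G"
  shows "openin T (K #> a)"
proof -
  have "K #> a = {x \<in> carrier G. x \<otimes> inv a \<in> K}"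
    using assms(3) normal_imp_subgroup[OF assms(1)]
    by (auto simp: r_coset_def subgroup.mem_carrier m_assoc intro!: bexI[of _ "_ \<otimes> inv a"])
  then show ?thesis using open_translate[OF assms(2), of "inv a"] assms(3) by simp
qed

lemma open_normal_Int:
  "K \<lhd> G \<Longrightarrow> openin T K \<Longrightarrow> L \<lhd> G \<Longrightarrow> openin T L \<Longrightarrow> K \<inter> L \<lhd> G \<and> openin T (K \<inter> L)"
  by (simp add: normal_subgroup_intersect openin_Int)

lemma open_closed_if_contains_open_normal:
  assumes K: "K \<lhd> G" "openin T K" and V: "subgroup V G" "K \<subseteq> V"
  shows "openin T V" and "closedin T V"
proof -
  have VG: "V \<subseteq> carrier G" using V(1) by (rule subgroup.subset)
  have self: "x \<in> K #> x" if "x \<in> carrier G" for x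
    using that rcos_self normal_imp_subgroup[OF K(1)] by blast
  have in_V: "K #> x \<subseteq> V" if "x \<in> V" for x
    using that V subgroup.m_closed[OF V(1)] by (auto simp: r_coset_def)
  have off_V: "K #> x \<subseteq> carrier G - V" if x: "x \<in> carrier G - V" for x
  proof
    fix y assume "y \<in> K #> x"
    then obtain k where k: "k \<in> K" "y = k \<otimes> x" by (auto simp: r_coset_def)
    have kV: "k \<in> V" "k \<in> carrier G" using k(1) V(2) VG by auto
    have "y \<notin> V"
    proof
      assume "y \<in> V"
      then have "inv k \<otimes> y \<in> V" using kV V(1) by (simp add: subgroup.m_closed subgroup.m_inv_closed)
      then show False using k(2) kV x by simp
    qed
    then show "y \<in> carrier G - V" using k kV x by simp
  qed
  have "V = (\<Union>x\<in>V. K #> x)" using in_V self VG by blast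
  moreover have "openin T (\<Union>x\<in>V. K #> x)" using open_coset[OF K] VG by (intro openin_Union) auto
  ultimately show "openin T V" by simp
  have "carrier G - V = (\<Union>x\<in>carrier G - V. K #> x)" using off_V self by blast
  moreover have "openin T (\<Union>x\<in>carrier G - V. K #> x)" using open_coset[OF K] by (intro openin_Union) auto
  ultimately have "openin T (topspace T - V)" by (simp add: topspace_eq)
  then show "closedin T V" using VG by (simp add: closedin_def topspace_eq)
qed

lemma finite_quotient:
  assumes K: "K \<lhd> G" "openin T K"
  shows "finite (carrier (G Mod K))"
proof -
  have sK: "subgroup K G" using K(1) by (rule normal_imp_subgroup)
  have "\<forall>C\<in>carrier (G Mod K). openin T C" using open_coset[OF K] by (auto simp: carrier_FactGroup)
  moreover have "topspace T \<subseteq> \<Union>(carrier (G Mod K))"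
    using rcos_self[OF _ sK] by (auto simp: topspace_eq carrier_FactGroup)
  ultimately obtain \<F> where \<F>: "finite \<F>" "\<F> \<subseteq> carrier (G Mod K)" "topspace T \<subseteq> \<Union>\<F>"
    using compact unfolding compact_space_alt by meson
  have "carrier (G Mod K) \<subseteq> \<F>"
  proof
    fix C assume "C \<in> carrier (G Mod K)"
    then obtain x where x: "x \<in> carrier G" "C = K #> x" by (auto simp: carrier_FactGroup)
    then obtain D where D: "D \<in> \<F>" "x \<in> D" using \<F>(3) by (auto simp: topspace_eq)
    then obtain y where y: "y \<in> carrier G" "D = K #> y" using \<F>(2) by (auto simp: carrier_FactGroup)
    have "C = D" using repr_independence[OF _ y(1) sK, of x] D(2) x y by simp
    then show "C \<in> \<F>" using D(1) by simp
  qed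
  then show ?thesis using \<F>(1) finite_subset by blast
qed

text \<open>The cosets of open normal subgroups form a base of the topology.\<close>

lemma in_closure_iff:
  assumes S: "S \<subseteq> carrier G"
  shows "x \<in> T closure_of S \<longleftrightarrow>
    x \<in> carrier G \<and> (\<forall>K. K \<lhd> G \<longrightarrow> openin T K \<longrightarrow> (\<exists>s\<in>S. x \<otimes> inv s \<in> K))"
proof (intro iffI conjI allI impI)
  assume x: "x \<in> T closure_of S"
  then have "x \<in> topspace T" by (simp add: in_closure_of)
  then show xG: "x \<in> carrier G" by (simp only: topspace_eq)
  fix K assume K: "K \<lhd> G" "openin T K"
  have "x \<in> K #> x" using xG normal_imp_subgroup[OF K(1)] by (rule rcos_self)
  then obtain s where s: "s \<in> S" "s \<in> K #> x"
    using x open_coset[OF K xG] unfolding in_closure_of by blast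
  then obtain k where k: "k \<in> K" "s = k \<otimes> x" by (auto simp: r_coset_def)
  have sK: "subgroup K G" using K(1) by (rule normal_imp_subgroup)
  have kG: "k \<in> carrier G" using sK k(1) by (rule subgroup.mem_carrier)
  have "x \<otimes> inv s = inv k" using k(2) kG xG by (simp add: inv_mult_group)
  then have "x \<otimes> inv s \<in> K" using subgroup.m_inv_closed[OF sK k(1)] by (simp only:)
  then show "\<exists>s\<in>S. x \<otimes> inv s \<in> K" using s(1) by blast
next
  assume x: "x \<in> carrier G \<and> (\<forall>K. K \<lhd> G \<longrightarrow> openin T K \<longrightarrow> (\<exists>s\<in>S. x \<otimes> inv s \<in> K))"
  have "\<exists>y. y \<in> S \<and> y \<in> U" if U: "x \<in> U" "openin T U" for U
  proof -
    obtain K where K: "K \<lhd> G" "openin T K" "K \<subseteq> {y \<in> carrier G. y \<otimes> x \<in> U}"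
      using base[OF open_translate[OF U(2)], of x] x U(1) by auto
    have sK: "subgroup K G" using K(1) by (rule normal_imp_subgroup)
    obtain s where s: "s \<in> S" "x \<otimes> inv s \<in> K" using x K(1,2) by blast
    have sG: "s \<in> carrier G" using s(1) S by blast
    have "inv (x \<otimes> inv s) \<in> K" using s(2) by (rule subgroup.m_inv_closed[OF sK])
    then have "inv (x \<otimes> inv s) \<otimes> x \<in> U" using K(3) by blast
    moreover have "inv (x \<otimes> inv s) \<otimes> x = s" using x sG by (simp add: inv_mult_group m_assoc)
    ultimately show ?thesis using s(1) by auto
  qed
  then show "x \<in> T closure_of S" using x by (auto simp: in_closure_of topspace_eq)
qed

lemma closure_subgroup:
  assumes S: "subgroup S G"
  shows "subgroup (T closure_of S) G"
proof -
  have SG: "S \<subseteq> carrier G" using S by (rule subgroup.subset)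
  note iff = in_closure_iff[OF SG]
  show ?thesis
  proof (rule subgroupI)
    show "T closure_of S \<subseteq> carrier G" using iff by blast
    show "T closure_of S \<noteq> {}"
      using closure_of_subset[of S T] SG subgroup.one_closed[OF S] by (auto simp: topspace_eq)
    show "inv a \<in> T closure_of S" if a: "a \<in> T closure_of S" for a
      unfolding iff
    proof (intro conjI allI impI)
      have aG: "a \<in> carrier G" using a iff by blast
      then show "inv a \<in> carrier G" by simp
      fix K assume K: "K \<lhd> G" "openin T K"
      have sK: "subgroup K G" using K(1) by (rule normal_imp_subgroup)
      obtain s where s: "s \<in> S" "a \<otimes> inv s \<in> K" using a iff K by blast
      have sG: "s \<in> carrier G" using s(1) SG by blast
      have "inv a \<otimes> inv (a \<otimes> inv s) \<otimes> inv (inv a) \<in> K"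
        using K(1) aG subgroup.m_inv_closed[OF sK s(2)] unfolding normal_inv_iff by blast
      then have "inv a \<otimes> inv (inv s) \<in> K" using aG sG by (simp add: inv_mult_group m_assoc)
      then show "\<exists>s\<in>S. inv a \<otimes> inv s \<in> K" using subgroup.m_inv_closed[OF S s(1)] by blast
    qed
    show "a \<otimes> b \<in> T closure_of S" if ab: "a \<in> T closure_of S" "b \<in> T closure_of S" for a b
      unfolding iff
    proof (intro conjI allI impI)
      have abG: "a \<in> carrier G" "b \<in> carrier G" using ab iff by blast+
      then show "a \<otimes> b \<in> carrier G" by simp
      fix K assume K: "K \<lhd> G" "openin T K"
      have sK: "subgroup K G" using K(1) by (rule normal_imp_subgroup)
      obtain s where s: "s \<in> S" "a \<otimes> inv s \<in> K" using ab(1) iff K by blast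
      obtain t where t: "t \<in> S" "b \<otimes> inv t \<in> K" using ab(2) iff K by blast
      have stG: "s \<in> carrier G" "t \<in> carrier G" using s(1) t(1) SG by auto
      have "a \<otimes> (b \<otimes> inv t) \<otimes> inv a \<in> K" using K(1) abG t(2) unfolding normal_inv_iff by blast
      then have "(a \<otimes> (b \<otimes> inv t) \<otimes> inv a) \<otimes> (a \<otimes> inv s) \<in> K" using s(2) by (rule subgroup.m_closed[OF sK])
      then have "(a \<otimes> b) \<otimes> inv (s \<otimes> t) \<in> K" using abG stG by (simp add: inv_mult_group m_assoc)
      then show "\<exists>s\<in>S. a \<otimes> b \<otimes> inv s \<in> K" using subgroup.m_closed[OF S s(1) t(1)] by blast
    qed
  qed
qed

lemma closure_normal:
  assumes N: "N \<lhd> G"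
  shows "T closure_of N \<lhd> G"
  unfolding normal_inv_iff
proof (intro conjI ballI)
  have sN: "subgroup N G" using N by (rule normal_imp_subgroup)
  show "subgroup (T closure_of N) G" using sN by (rule closure_subgroup)
  have NG: "N \<subseteq> carrier G" using sN by (rule subgroup.subset)
  note iff = in_closure_iff[OF NG]
  fix x h assume x: "x \<in> carrier G" and h: "h \<in> T closure_of N"
  show "x \<otimes> h \<otimes> inv x \<in> T closure_of N"
    unfolding iff
  proof (intro conjI allI impI)
    have hG: "h \<in> carrier G" using h iff by blast
    then show "x \<otimes> h \<otimes> inv x \<in> carrier G" using x by simp
    fix K assume K: "K \<lhd> G" "openin T K"
    obtain s where s: "s \<in> N" "h \<otimes> inv s \<in> K" using h iff K by blast
    have sG: "s \<in> carrier G" using s(1) NG by blast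
    have "x \<otimes> (h \<otimes> inv s) \<otimes> inv x \<in> K" using K(1) x s(2) unfolding normal_inv_iff by blast
    then have "(x \<otimes> h \<otimes> inv x) \<otimes> inv (x \<otimes> s \<otimes> inv x) \<in> K" using x hG sG by (simp add: inv_mult_group m_assoc)
    moreover have "x \<otimes> s \<otimes> inv x \<in> N" using N x s(1) unfolding normal_inv_iff by blast
    ultimately show "\<exists>s\<in>N. x \<otimes> h \<otimes> inv x \<otimes> inv s \<in> K" by blast
  qed
qed

end

section \<open>Topological generators and finite quotients\<close>

context group begin

text \<open>Since \<open>H N / N = H / (H \<inter> N)\<close>, every generator can be multiplied by an element of \<open>N\<close> so as to lie
  in \<open>H\<close>.\<close>

lemma generators_modulo_normal:
  assumes N: "N \<lhd> G" and H: "subgroup H G" and Z: "finite Z" "Z \<subseteq> generate G (H \<union> N)"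
    and gen: "H \<subseteq> generate G (Z \<union> N)"
  shows "\<exists>X\<subseteq>H. finite X \<and> card X \<le> card Z \<and> H \<subseteq> generate G (X \<union> N)"
proof -
  have sN: "subgroup N G" using N by (rule normal_imp_subgroup)
  have HG: "x \<in> carrier G" if "x \<in> H" for x using H that by (rule subgroup.mem_carrier)
  have NG: "x \<in> carrier G" if "x \<in> N" for x using sN that by (rule subgroup.mem_carrier)
  interpret \<pi>: group_hom G "G Mod N" "\<lambda>x. N #> x" using N by (rule quotient_hom)
  have NH: "N #> x \<in> (\<lambda>x. N #> x) ` H" if "x \<in> N" for x
  proof -
    have "N #> x = N #> \<one>"
      using quotient_one_iff[OF N NG[OF that]] that coset_mult_one subgroup.subset[OF sN] by simp
    then show ?thesis using subgroup.one_closed[OF H] by blast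
  qed
  have "generate G (H \<union> N) \<subseteq> {x \<in> carrier G. N #> x \<in> (\<lambda>x. N #> x) ` H}"
  proof (rule generate_subgroup_incl)
    show "subgroup {x \<in> carrier G. N #> x \<in> (\<lambda>x. N #> x) ` H} G"
      using N \<pi>.subgroup_img_is_subgroup[OF H] by (rule subgroup_preimage_quotient)
    show "H \<union> N \<subseteq> {x \<in> carrier G. N #> x \<in> (\<lambda>x. N #> x) ` H}" using HG NG NH by blast
  qed
  then have ZG: "z \<in> carrier G" and ex: "\<exists>h\<in>H. N #> z = N #> h" if "z \<in> Z" for z
    using Z(2) that by blast+
  then obtain h where h: "\<And>z. z \<in> Z \<Longrightarrow> h z \<in> H \<and> N #> z = N #> h z" by metis
  have "generate G (Z \<union> N) \<subseteq> generate G (h ` Z \<union> N)"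
  proof (rule generate_subgroup_incl)
    have "h ` Z \<union> N \<subseteq> carrier G" using h HG NG by blast
    then show s: "subgroup (generate G (h ` Z \<union> N)) G" by (rule generate_is_subgroup)
    have "z \<in> generate G (h ` Z \<union> N)" if z: "z \<in> Z" for z
    proof -
      have hz: "h z \<in> H" "N #> z = N #> h z" using h[OF z] by auto
      have "z \<otimes> inv h z \<in> N" using quotient_eq_iff[OF N ZG[OF z] HG[OF hz(1)]] hz(2) by blast
      then have "z \<otimes> inv h z \<in> generate G (h ` Z \<union> N)" by (intro generate.incl) blast
      moreover have "h z \<in> generate G (h ` Z \<union> N)" using z by (intro generate.incl) blast
      ultimately have "z \<otimes> inv h z \<otimes> h z \<in> generate G (h ` Z \<union> N)" by (rule subgroup.m_closed[OF s])
      then show ?thesis using ZG[OF z] HG[OF hz(1)] by (simp add: m_assoc)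
    qed
    then show "Z \<union> N \<subseteq> generate G (h ` Z \<union> N)" by (auto intro: generate.incl)
  qed
  then have "H \<subseteq> generate G (h ` Z \<union> N)" using gen by blast
  moreover have "h ` Z \<subseteq> H" using h by blast
  ultimately show ?thesis using Z(1) card_image_le[OF Z(1), of h] by (intro exI[of _ "h ` Z"]) auto
qed

lemma generate_quotient_image:
  assumes "K \<lhd> G" "A \<subseteq> carrier G"
  shows "(\<lambda>x. K #> x) ` generate G (A \<union> K) = generate (G Mod K) ((\<lambda>x. K #> x) ` A)"
proof -
  interpret \<pi>: group_hom G "G Mod K" "\<lambda>x. K #> x" using assms(1) by (rule quotient_hom)
  have sK: "subgroup K G" using assms(1) by (rule normal_imp_subgroup)
  have AK: "A \<union> K \<subseteq> carrier G" using assms(2) subgroup.subset[OF sK] by blast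
  have "(\<lambda>x. K #> x) ` A \<subseteq> carrier (G Mod K)" using assms(2) by (auto simp: carrier_FactGroup)
  then have s: "subgroup (generate (G Mod K) ((\<lambda>x. K #> x) ` A)) (G Mod K)"
    by (rule \<pi>.H.generate_is_subgroup)
  have "K #> x \<in> generate (G Mod K) ((\<lambda>x. K #> x) ` A)" if "x \<in> K" for x
    using that quotient_one_iff[OF assms(1) subgroup.mem_carrier[OF sK that]] subgroup.one_closed[OF s] by simp
  moreover have "K #> x \<in> generate (G Mod K) ((\<lambda>x. K #> x) ` A)" if "x \<in> A" for x
    using that by (intro generate.incl) blast
  ultimately have "generate (G Mod K) ((\<lambda>x. K #> x) ` (A \<union> K)) \<subseteq> generate (G Mod K) ((\<lambda>x. K #> x) ` A)"
    by (intro \<pi>.H.generate_subgroup_incl s) blast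
  moreover have "generate (G Mod K) ((\<lambda>x. K #> x) ` A) \<subseteq> generate (G Mod K) ((\<lambda>x. K #> x) ` (A \<union> K))"
    by (intro \<pi>.H.mono_generate) blast
  ultimately show ?thesis using \<pi>.generate_img[OF AK] by simp
qed

end

lemma top_gen_number_le_imp_generators:
  assumes "top_gen_number G T H \<le> enat r"
  obtains X where "finite X" "X \<subseteq> H" "(subtopology T H) closure_of (generate G X) = H" "card X \<le> r"
proof -
  let ?S = "{X. finite X \<and> X \<subseteq> H \<and> (subtopology T H) closure_of (generate G X) = H}"
  have "\<exists>X\<in>?S. card X \<le> r"
  proof (rule ccontr)
    assume "\<not> ?thesis"
    then have "enat (Suc r) \<le> enat (card X)" if "X \<in> ?S" for X using that by (simp add: not_le Suc_le_eq)
    then have "enat (Suc r) \<le> top_gen_number G T H"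
      unfolding top_gen_number_def by (rule INF_greatest)
    then have "enat (Suc r) \<le> enat r" using assms by (rule order_trans)
    then show False by simp
  qed
  then show ?thesis using that by blast
qed

context profinite begin

lemma closedin_quotient_image:
  assumes D: "D \<lhd> G" and J: "subgroup J G" "closedin T J" "D \<subseteq> J"
  shows "closedin (quotient_group_topology G T D) ((\<lambda>x. D #> x) ` J)"
proof -
  have JG: "J \<subseteq> carrier G" using J(1) by (rule subgroup.subset)
  have mem: "D #> x \<in> (\<lambda>x. D #> x) ` J \<longleftrightarrow> x \<in> J" if x: "x \<in> carrier G" for x
  proof
    assume "D #> x \<in> (\<lambda>x. D #> x) ` J"
    then obtain y where y: "y \<in> J" "D #> x = D #> y" by blast
    have yG: "y \<in> carrier G" using y(1) JG by blast
    have "x \<otimes> inv y \<in> J" using quotient_eq_iff[OF D x yG] y(2) J(3) by blast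
    then have "x \<otimes> inv y \<otimes> y \<in> J" using y(1) by (rule subgroup.m_closed[OF J(1)])
    then show "x \<in> J" using x yG by (simp add: m_assoc)
  qed blast
  have top: "topspace (quotient_group_topology G T D) = (\<lambda>x. D #> x) ` carrier G"
    by (simp add: quotient_group_topology_def topspace_quotient_topology topspace_eq)
  have "{x \<in> topspace T. D #> x \<in> (\<lambda>x. D #> x) ` carrier G - (\<lambda>x. D #> x) ` J} = topspace T - J"
    using mem by (auto simp: topspace_eq)
  moreover have "openin T (topspace T - J)" using J(2) by (simp add: closedin_def)
  ultimately have "openin T {x \<in> topspace T. D #> x \<in> (\<lambda>x. D #> x) ` carrier G - (\<lambda>x. D #> x) ` J}"
    by (simp only:)
  then have "openin (quotient_group_topology G T D) ((\<lambda>x. D #> x) ` carrier G - (\<lambda>x. D #> x) ` J)"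
    unfolding quotient_group_topology_def openin_quotient_topology by (auto simp: topspace_eq)
  then show ?thesis using JG by (auto simp: closedin_def top)
qed

text \<open>Let \<open>D\<close> be the closure of \<open>derived G N\<close>, and \<open>J\<close> the closed subgroup generated by \<open>D\<close> and
  representatives of the elements of the finite group \<open>H\<close>. Modulo \<open>D\<close> it is topologically finitely
  generated, hence generated by at most \<open>r\<close> elements. Subgroups that contain \<open>K\<close> are closed. So these
  \<open>r\<close> elements generate \<open>J\<close> modulo the group \<open>D K\<close>, and moreover \<open>D K = derived G N K\<close>. Therefore
  their images generate \<open>H\<close> modulo the image of \<open>derived G N\<close>, and \<open>generators_modulo_normal\<close> moves
  them into \<open>H\<close>.\<close>

lemma quotient_generators_modulo_derived:
  assumes rank: "profinite_rank (G Mod (T closure_of derived G N))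
      (quotient_group_topology G T (T closure_of derived G N)) \<le> enat r"
    and N: "N \<lhd> G" and K: "K \<lhd> G" "openin T K" and H: "subgroup H (G Mod K)"
  shows "\<exists>X\<subseteq>H. finite X \<and> card X \<le> r \<and>
    H \<subseteq> generate (G Mod K) (X \<union> derived (G Mod K) ((\<lambda>x. K #> x) ` N))"
proof -
  define D where "D = T closure_of derived G N"
  let ?\<kappa> = "\<lambda>x. K #> x" and ?\<delta> = "\<lambda>x. D #> x"
  let ?T' = "quotient_group_topology G T D"
  have sN: "subgroup N G" using N by (rule normal_imp_subgroup)
  have NG: "N \<subseteq> carrier G" using sN by (rule subgroup.subset)
  have nN': "derived G N \<lhd> G" using N by (rule derived_is_normal)
  have N'G: "derived G N \<subseteq> carrier G" using NG by (rule derived_in_carrier)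
  have nD: "D \<lhd> G" unfolding D_def using nN' by (rule closure_normal)
  have sD: "subgroup D G" using nD by (rule normal_imp_subgroup)
  have DG: "D \<subseteq> carrier G" using sD by (rule subgroup.subset)
  have KG: "K \<subseteq> carrier G" using subgroup.subset[OF normal_imp_subgroup[OF K(1)]] .
  interpret \<kappa>: group_hom G "G Mod K" ?\<kappa> using K(1) by (rule quotient_hom)
  interpret \<delta>: group_hom G "G Mod D" ?\<delta> using nD by (rule quotient_hom)
  have fin: "finite (carrier (G Mod K))" using finite_quotient[OF K] .
  have HQ: "H \<subseteq> carrier (G Mod K)" using H by (rule subgroup.subset)
  then have finH: "finite H" using fin finite_subset by blast
  have "H \<subseteq> ?\<kappa> ` carrier G" using HQ by (simp add: carrier_FactGroup)
  then obtain Y where Y: "Y \<subseteq> carrier G" "inj_on ?\<kappa> Y" "H = ?\<kappa> ` Y"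
    unfolding subset_image_inj by (elim exE conjE)
  have finY: "finite Y" using finH Y(2,3) by (simp add: finite_image_iff)
  define S where "S = generate G (Y \<union> D)"
  have YD: "Y \<union> D \<subseteq> carrier G" using Y(1) DG by blast
  have sS: "subgroup S G" unfolding S_def using YD by (rule generate_is_subgroup)
  have SG: "S \<subseteq> carrier G" using sS by (rule subgroup.subset)
  have YS: "Y \<subseteq> S" and DS: "D \<subseteq> S" unfolding S_def by (auto intro: generate.incl)
  define J where "J = T closure_of S"
  have sJ: "subgroup J G" unfolding J_def using sS by (rule closure_subgroup)
  have JG: "J \<subseteq> carrier G" using sJ by (rule subgroup.subset)
  have clJ: "closedin T J" unfolding J_def by (rule closedin_closure_of)
  have SJ: "S \<subseteq> J" unfolding J_def using SG by (intro closure_of_subset) (simp add: topspace_eq)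
  define H1 where "H1 = ?\<delta> ` J"
  have sH1: "subgroup H1 (G Mod D)" unfolding H1_def using sJ by (rule \<delta>.subgroup_img_is_subgroup)
  have clH1: "closedin ?T' H1"
    unfolding H1_def using nD sJ clJ SJ DS by (intro closedin_quotient_image) auto
  have cont: "continuous_map T ?T' ?\<delta>"
    unfolding quotient_group_topology_def
    using quotient_map_quotient_topology quotient_imp_continuous_map by blast
  have "top_gen_number (G Mod D) ?T' H1 < \<infinity>"
  proof -
    have \<delta>S: "?\<delta> ` S = generate (G Mod D) (?\<delta> ` Y)"
      unfolding S_def using nD Y(1) by (rule generate_quotient_image)
    have "H1 \<subseteq> ?T' closure_of generate (G Mod D) (?\<delta> ` Y)"
      unfolding H1_def J_def \<delta>S[symmetric] using cont by (rule continuous_map_image_closure_subset)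
    moreover have sub: "generate (G Mod D) (?\<delta> ` Y) \<subseteq> H1"
      unfolding H1_def \<delta>S[symmetric] using SJ by (rule image_mono)
    ultimately have "(subtopology ?T' H1) closure_of generate (G Mod D) (?\<delta> ` Y) = H1"
      by (simp add: closure_of_subtopology Int_absorb1 Int_absorb2)
    moreover have "?\<delta> ` Y \<subseteq> H1" using YS SJ by (auto simp: H1_def)
    ultimately have "top_gen_number (G Mod D) ?T' H1 \<le> enat (card (?\<delta> ` Y))"
      unfolding top_gen_number_def using finY by (intro INF_lower) simp
    then show ?thesis by (rule le_less_trans) simp
  qed
  then have "top_gen_number (G Mod D) ?T' H1 \<le> profinite_rank (G Mod D) ?T'"
    unfolding profinite_rank_def using sH1 clH1 by (intro SUP_upper) simp
  also have "\<dots> \<le> enat r" using rank by (simp add: D_def)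
  finally obtain X0 where X0: "finite X0" "X0 \<subseteq> H1"
    "(subtopology ?T' H1) closure_of (generate (G Mod D) X0) = H1" "card X0 \<le> r"
    by (rule top_gen_number_le_imp_generators)
  obtain X1 where X1: "X1 \<subseteq> J" "inj_on ?\<delta> X1" "X0 = ?\<delta> ` X1"
    using X0(2) unfolding H1_def subset_image_inj by (elim exE conjE)
  have finX1: "finite X1" and cardX1: "card X1 \<le> r"
    using X0(1,4) X1(2,3) by (simp_all add: finite_image_iff card_image)
  have X1G: "X1 \<subseteq> carrier G" using X1(1) JG by blast
  have open_gen: "closedin T (generate G (A \<union> derived G N \<union> K))" "D \<subseteq> generate G (A \<union> derived G N \<union> K)"
    "subgroup (generate G (A \<union> derived G N \<union> K)) G"
    if A: "A \<subseteq> carrier G" for A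
  proof -
    show s: "subgroup (generate G (A \<union> derived G N \<union> K)) G"
      using A N'G KG by (intro generate_is_subgroup) blast
    show cl: "closedin T (generate G (A \<union> derived G N \<union> K))"
      by (rule open_closed_if_contains_open_normal(2)[OF K s]) (auto intro: generate.incl)
    show "D \<subseteq> generate G (A \<union> derived G N \<union> K)"
      unfolding D_def using cl by (intro closure_of_minimal) (auto intro: generate.incl)
  qed
  have \<kappa>_gen: "?\<kappa> ` generate G (A \<union> derived G N \<union> K) = generate (G Mod K) (?\<kappa> ` A \<union> derived (G Mod K) (?\<kappa> ` N))"
    if A: "A \<subseteq> carrier G" for A
    using generate_quotient_image[OF K(1), of "A \<union> derived G N"] A N'G \<kappa>.derived_img[OF NG]
    by (simp add: image_Un)
  define V where "V = generate G (X1 \<union> derived G N \<union> K)"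
  note V = open_gen[OF X1G, folded V_def]
  have "H1 \<subseteq> ?\<delta> ` V"
  proof -
    have "closedin ?T' (?\<delta> ` V)" using nD V(3,1,2) by (rule closedin_quotient_image)
    moreover have "generate (G Mod D) X0 \<subseteq> ?\<delta> ` V"
      unfolding X1(3) \<delta>.generate_img[OF X1G] V_def by (intro image_mono mono_generate) blast
    ultimately have "?T' closure_of generate (G Mod D) X0 \<subseteq> ?\<delta> ` V" by (intro closure_of_minimal)
    moreover have "H1 \<subseteq> ?T' closure_of generate (G Mod D) X0"
      using closure_of_subtopology_subset[of ?T' H1 "generate (G Mod D) X0"] unfolding X0(3) .
    ultimately show ?thesis by (rule order_trans[rotated])
  qed
  then have YV: "Y \<subseteq> V"
  proof -
    assume H1V: "H1 \<subseteq> ?\<delta> ` V"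
    have "y \<in> V" if y: "y \<in> Y" for y
    proof -
      have yG: "y \<in> carrier G" using y Y(1) by blast
      have "?\<delta> y \<in> H1" unfolding H1_def using y YS SJ by blast
      with H1V have "?\<delta> y \<in> ?\<delta> ` V" by (rule subsetD)
      then obtain v where v: "v \<in> V" "?\<delta> y = ?\<delta> v" by blast
      have vG: "v \<in> carrier G" using V(3) v(1) by (rule subgroup.mem_carrier)
      have "y \<otimes> inv v \<in> V" using quotient_eq_iff[OF nD yG vG] v(2) V(2) by blast
      then have "y \<otimes> inv v \<otimes> v \<in> V" using v(1) by (rule subgroup.m_closed[OF V(3)])
      then show ?thesis using yG vG by (simp add: m_assoc)
    qed
    then show ?thesis by blast
  qed
  then have HV: "H \<subseteq> generate (G Mod K) (?\<kappa> ` X1 \<union> derived (G Mod K) (?\<kappa> ` N))"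
    unfolding Y(3) \<kappa>_gen[OF X1G, symmetric] V_def by (rule image_mono)
  define V2 where "V2 = generate G (Y \<union> derived G N \<union> K)"
  note V2 = open_gen[OF Y(1), folded V2_def]
  have "S \<subseteq> V2"
  proof -
    have "Y \<subseteq> V2" unfolding V2_def by (auto intro: generate.incl)
    then show ?thesis unfolding S_def using V2(2) by (intro generate_subgroup_incl V2(3)) blast
  qed
  then have "J \<subseteq> V2" unfolding J_def using V2(1) by (rule closure_of_minimal)
  then have "X1 \<subseteq> V2" using X1(1) by blast
  then have X1H: "?\<kappa> ` X1 \<subseteq> generate (G Mod K) (H \<union> derived (G Mod K) (?\<kappa> ` N))"
    unfolding Y(3) \<kappa>_gen[OF Y(1), symmetric] V2_def by (rule image_mono)
  have "?\<kappa> ` derived G N \<lhd> G Mod K"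
    using normal.surj_hom_normal_subgroup[OF nN' \<kappa>.group_hom_axioms quotient_image_carrier] .
  then have nQ: "derived (G Mod K) (?\<kappa> ` N) \<lhd> G Mod K" using \<kappa>.derived_img[OF NG] by simp
  obtain X where "X \<subseteq> H" "finite X" "card X \<le> card (?\<kappa> ` X1)"
    "H \<subseteq> generate (G Mod K) (X \<union> derived (G Mod K) (?\<kappa> ` N))"
    using \<kappa>.H.generators_modulo_normal[OF nQ H _ X1H HV] finX1 by blast
  moreover have "card (?\<kappa> ` X1) \<le> r" using card_image_le[OF finX1, of ?\<kappa>] cardX1 by linarith
  ultimately show ?thesis by (meson le_trans)
qed

text \<open>For an open normal subgroup \<open>K\<close>, the \<open>r\<close>-tuples in \<open>H\<close> that generate the image of \<open>H\<close> in \<open>G / K\<close>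
  form a nonempty closed subset \<open>C K\<close> of the space of all \<open>r\<close>-tuples, which is compact by Tychonoff's
  theorem. The sets \<open>C K\<close> are directed, so they have a common element, and it generates a dense
  subgroup of \<open>H\<close>.\<close>

lemma profinite_rank_le:
  assumes gens: "\<And>K H. K \<lhd> G \<Longrightarrow> openin T K \<Longrightarrow> subgroup H (G Mod K) \<Longrightarrow>
    \<exists>X. X \<subseteq> H \<and> finite X \<and> card X \<le> r \<and> generate (G Mod K) X = H"
  shows "profinite_rank G T \<le> enat r"
  unfolding profinite_rank_def
proof (rule SUP_least)
  fix H assume "H \<in> {H. subgroup H G \<and> closedin T H \<and> top_gen_number G T H < \<infinity>}"
  then have H: "subgroup H G" "closedin T H" by auto
  have HG: "H \<subseteq> carrier G" using H(1) by (rule subgroup.subset)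
  define X where "X = product_topology (\<lambda>_::nat. subtopology T H) {..<r}"
  have topX: "topspace X = {..<r} \<rightarrow>\<^sub>E H"
    using HG by (simp add: X_def topspace_eq Int_absorb1)
  have compX: "compact_space X"
    unfolding X_def compact_space_product_topology
    using compact_space_subtopology[OF closedin_compact_space[OF compact H(2)]] by blast
  define C where "C K = {t \<in> {..<r} \<rightarrow>\<^sub>E H. (\<lambda>x. K #> x) ` H \<subseteq> generate (G Mod K) ((\<lambda>i. K #> t i) ` {..<r})}" for K
  define \<K> where "\<K> = {K. K \<lhd> G \<and> openin T K}"
  have C_ne: "C K \<noteq> {}" if K: "K \<in> \<K>" for K
  proof -
    have K': "K \<lhd> G" "openin T K" using K by (auto simp: \<K>_def)
    interpret \<pi>: group_hom G "G Mod K" "\<lambda>x. K #> x" using K'(1) by (rule quotient_hom)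
    have sH: "subgroup ((\<lambda>x. K #> x) ` H) (G Mod K)" using H(1) by (rule \<pi>.subgroup_img_is_subgroup)
    obtain Z where Z: "Z \<subseteq> (\<lambda>x. K #> x) ` H" "finite Z" "card Z \<le> r" "generate (G Mod K) Z = (\<lambda>x. K #> x) ` H"
      using gens[OF K' sH] by blast
    obtain u where u: "u ` {..<r} \<subseteq> (\<lambda>x. K #> x) ` H" "generate (G Mod K) (u ` {..<r}) = (\<lambda>x. K #> x) ` H"
      using \<pi>.H.generators_indexed[OF sH Z] by blast
    have "\<forall>i\<in>{..<r}. \<exists>h\<in>H. u i = K #> h" using u(1) by blast
    then obtain v where v: "\<And>i. i < r \<Longrightarrow> v i \<in> H \<and> u i = K #> v i" by (metis lessThan_iff)
    define t where "t = restrict v {..<r}"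
    have "(\<lambda>i. K #> t i) ` {..<r} = u ` {..<r}" using v by (intro image_cong) (auto simp: t_def)
    then have "t \<in> C K" using v u(2) by (auto simp: C_def t_def)
    then show ?thesis by blast
  qed
  have C_mono: "C K \<subseteq> C L" if KL: "K \<in> \<K>" "L \<in> \<K>" "K \<subseteq> L" for K L
  proof
    fix t assume t: "t \<in> C K"
    have nK: "K \<lhd> G" and nL: "L \<lhd> G" using KL by (auto simp: \<K>_def)
    interpret K: group_hom G "G Mod K" "\<lambda>x. K #> x" using nK by (rule quotient_hom)
    interpret L: group_hom G "G Mod L" "\<lambda>x. L #> x" using nL by (rule quotient_hom)
    have tH: "t ` {..<r} \<subseteq> H" using t by (auto simp: C_def)
    then have tG: "t ` {..<r} \<subseteq> carrier G" using HG by blast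
    have gG: "w \<in> carrier G" if "w \<in> generate G (t ` {..<r})" for w using tG that by (rule generate_in_carrier)
    have "L #> h \<in> generate (G Mod L) ((\<lambda>i. L #> t i) ` {..<r})" if h: "h \<in> H" for h
    proof -
      have hG: "h \<in> carrier G" using h HG by blast
      have "K #> h \<in> (\<lambda>x. K #> x) ` generate G (t ` {..<r})"
        using t h K.generate_img[OF tG] by (auto simp: C_def image_image)
      then obtain w where w: "w \<in> generate G (t ` {..<r})" "K #> h = K #> w" by blast
      have "h \<otimes> inv w \<in> L" using quotient_eq_iff[OF nK hG gG[OF w(1)]] w(2) KL(3) by blast
      then have "L #> h = L #> w" using quotient_eq_iff[OF nL hG gG[OF w(1)]] by blast
      then show ?thesis using L.generate_img[OF tG] w(1) by (auto simp: image_image)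
    qed
    then show "t \<in> C L" using t by (auto simp: C_def)
  qed
  have C_closed: "closedin X (C K)" if K: "K \<in> \<K>" for K
  proof -
    have K': "K \<lhd> G" "openin T K" using K by (auto simp: \<K>_def)
    have sK: "subgroup K G" using K'(1) by (rule normal_imp_subgroup)
    have "\<exists>B. openin X B \<and> t \<in> B \<and> B \<subseteq> topspace X - C K" if t: "t \<in> topspace X - C K" for t
    proof -
      have tH: "t i \<in> H" if "i < r" for i using t that unfolding topX by auto
      define B where "B = Pi\<^sub>E {..<r} (\<lambda>i. H \<inter> (K #> t i))"
      have "openin X B"
      proof -
        have "openin (subtopology T H) (H \<inter> (K #> t i))" if "i < r" for i
          using open_coset[OF K', of "t i"] tH[OF that] HG by (auto simp: openin_subtopology_Int2 Int_commute)
        then show ?thesis unfolding X_def B_def by (subst openin_PiE_gen) auto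
      qed
      moreover have "t \<in> B"
        using t tH HG rcos_self[OF _ sK] unfolding topX B_def by (auto simp: PiE_def)
      moreover have "B \<subseteq> topspace X - C K"
      proof
        fix s assume s: "s \<in> B"
        have sH: "s \<in> {..<r} \<rightarrow>\<^sub>E H" using s by (auto simp: B_def PiE_def Pi_def)
        have "K #> s i = K #> t i" if "i < r" for i
        proof -
          have "s i \<in> K #> t i" using s that by (auto simp: B_def PiE_def Pi_def)
          then show ?thesis using repr_independence[OF _ _ sK] tH[OF that] HG by blast
        qed
        then have "(\<lambda>i. K #> s i) ` {..<r} = (\<lambda>i. K #> t i) ` {..<r}" by (intro image_cong) auto
        then show "s \<in> topspace X - C K" using t sH unfolding topX C_def by auto
      qed
      ultimately show ?thesis by blast
    qed
    then have "openin X (topspace X - C K)" by (subst openin_subopen) blast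
    moreover have "C K \<subseteq> topspace X" unfolding topX by (auto simp: C_def)
    ultimately show ?thesis by (simp add: closedin_def)
  qed
  have "\<Inter>(C ` \<K>) \<noteq> {}"
  proof -
    have lower: "\<exists>K\<in>\<K>. \<forall>L\<in>\<F>. K \<subseteq> L" if "finite \<F>" "\<F> \<subseteq> \<K>" for \<F>
      using that
    proof (induction \<F> rule: finite_induct)
      case empty
      have "carrier G \<in> \<K>" using normal_self openin_topspace[of T] by (simp add: \<K>_def topspace_eq)
      then show ?case by blast
    next
      case (insert L \<F>)
      then obtain K where K: "K \<in> \<K>" "\<forall>L\<in>\<F>. K \<subseteq> L" by blast
      have "K \<inter> L \<in> \<K>" using open_normal_Int K(1) insert.prems by (simp add: \<K>_def)
      then show ?case using K(2) by (intro bexI[of _ "K \<inter> L"]) auto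
    qed
    have "\<Inter>\<G> \<noteq> {}" if \<G>: "finite \<G>" "\<G> \<subseteq> C ` \<K>" for \<G>
    proof -
      obtain \<F> where \<F>: "\<F> \<subseteq> \<K>" "finite \<F>" "\<G> = C ` \<F>" using finite_subset_image[OF \<G>] by blast
      obtain K where K: "K \<in> \<K>" "\<forall>L\<in>\<F>. K \<subseteq> L" using lower[OF \<F>(2,1)] by blast
      have "C K \<subseteq> \<Inter>\<G>" unfolding \<F>(3) using C_mono K \<F>(1) by blast
      then show ?thesis using C_ne[OF K(1)] by blast
    qed
    moreover have "\<forall>D\<in>C ` \<K>. closedin X D" using C_closed by blast
    ultimately show ?thesis using compX unfolding compact_space_fip by (metis (no_types, lifting))
  qed
  then obtain t where t: "\<And>K. K \<in> \<K> \<Longrightarrow> t \<in> C K" by blast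
  have "carrier G \<in> \<K>" using normal_self openin_topspace[of T] by (simp add: \<K>_def topspace_eq)
  then have tH: "t ` {..<r} \<subseteq> H" using t[of "carrier G"] by (auto simp: C_def)
  then have tG: "t ` {..<r} \<subseteq> carrier G" using HG by blast
  have genH: "generate G (t ` {..<r}) \<subseteq> H" using tH H(1) by (rule generate_subgroup_incl)
  have genG: "generate G (t ` {..<r}) \<subseteq> carrier G" using genH HG by blast
  have "H \<subseteq> T closure_of generate G (t ` {..<r})"
  proof
    fix h assume h: "h \<in> H"
    have hG: "h \<in> carrier G" using h HG by blast
    show "h \<in> T closure_of generate G (t ` {..<r})"
      unfolding in_closure_iff[OF genG]
    proof (intro conjI hG allI impI)
      fix K assume K: "K \<lhd> G" "openin T K"
      interpret \<pi>: group_hom G "G Mod K" "\<lambda>x. K #> x" using K(1) by (rule quotient_hom)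
      have "K #> h \<in> (\<lambda>x. K #> x) ` generate G (t ` {..<r})"
        using t[of K] K h \<pi>.generate_img[OF tG] by (auto simp: C_def \<K>_def image_image)
      then obtain w where w: "w \<in> generate G (t ` {..<r})" "K #> h = K #> w" by blast
      have wG: "w \<in> carrier G" using w(1) genG by blast
      have "h \<otimes> inv w \<in> K" using quotient_eq_iff[OF K(1) hG wG] w(2) by blast
      then show "\<exists>s\<in>generate G (t ` {..<r}). h \<otimes> inv s \<in> K" using w(1) by blast
    qed
  qed
  then have "(subtopology T H) closure_of generate G (t ` {..<r}) = H"
    using genH by (simp add: closure_of_subtopology Int_absorb1 Int_absorb2)
  then have "top_gen_number G T H \<le> enat (card (t ` {..<r}))"
    unfolding top_gen_number_def using tH by (intro INF_lower) simp
  also have "\<dots> \<le> enat r" using card_image_le[of "{..<r}" t] by simp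
  finally show "top_gen_number G T H \<le> enat r" .
qed

end

text \<open>Solubility and nilpotency come from the finite groups in the inverse systems, one of which
  receives a homomorphism from \<open>G\<close>, or from \<open>N\<close>, with kernel inside \<open>K\<close>.\<close>

lemma open_quotient_solvable_PIG_pair:
  fixes G (structure)
  assumes G: "prosoluble G T" and N: "N \<lhd> G"
    and nil: "pronilpotent (G\<lparr>carrier := N\<rparr>) (subtopology T N)"
    and PIG: "\<And>n. n \<ge> 1 \<Longrightarrow> real (card (carrier ((G Mod K) Mod power_subgroup (G Mod K) n))) \<le> real n powr \<alpha>"
    and rank: "profinite_rank (G Mod (T closure_of derived G N))
      (quotient_group_topology G T (T closure_of derived G N)) \<le> enat r"
    and K: "K \<lhd> G" "openin T K"
  shows "solvable_PIG_pair (nat \<lceil>\<alpha>\<rceil>) r (G Mod K) ((\<lambda>x. K #> x) ` N)"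
proof -
  interpret profinite G T
    using G unfolding prosoluble_def by (rule inverse_limit_of_finite_profinite)
  let ?\<kappa> = "\<lambda>x. K #> x"
  interpret \<kappa>: group_hom G "G Mod K" ?\<kappa> using K(1) by (rule quotient_hom)
  have sK: "subgroup K G" using K(1) by (rule normal_imp_subgroup)
  have sN: "subgroup N G" using N by (rule normal_imp_subgroup)
  have fin: "finite (carrier (G Mod K))" using finite_quotient[OF K] .
  have trivial: "?\<kappa> ` S \<subseteq> {\<one>\<^bsub>G Mod K\<^esub>}" if "S \<subseteq> K" for S
    using that quotient_one_iff[OF K(1)] subgroup.mem_carrier[OF sK] by auto
  have "solvable (G Mod K)"
  proof -
    obtain A :: "nat monoid" and \<pi> where A: "group A" "solvable A" "\<pi> \<in> hom G A"
      "{x \<in> carrier G. \<pi> x = \<one>\<^bsub>A\<^esub>} \<subseteq> K"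
      using inverse_limit_of_finite_small_kernel[OF G[unfolded prosoluble_def] K(2) subgroup.one_closed[OF sK]] by blast
    interpret \<pi>: group_hom G A \<pi> using A(1,3) by (intro group_hom.intro group_hom_axioms.intro is_group)
    obtain n where n: "(derived A ^^ n) (carrier A) = {\<one>\<^bsub>A\<^esub>}"
      using A(2) \<pi>.H.solvable_iff_trivial_derived_seq by blast
    have "\<pi> ` ((derived G ^^ n) (carrier G)) = (derived A ^^ n) (\<pi> ` carrier G)"
      using \<pi>.exp_of_derived_img[of "carrier G" n] by simp
    also have "\<dots> \<subseteq> (derived A ^^ n) (carrier A)" by (intro \<pi>.H.mono_exp_of_derived) auto
    finally have "\<pi> ` ((derived G ^^ n) (carrier G)) \<subseteq> {\<one>\<^bsub>A\<^esub>}" unfolding n .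
    then have "(derived G ^^ n) (carrier G) \<subseteq> K"
      using A(4) exp_of_derived_in_carrier[of "carrier G" n] by blast
    then have "?\<kappa> ` ((derived G ^^ n) (carrier G)) \<subseteq> {\<one>\<^bsub>G Mod K\<^esub>}" by (rule trivial)
    then have "(derived (G Mod K) ^^ n) (carrier (G Mod K)) \<subseteq> {\<one>\<^bsub>G Mod K\<^esub>}"
      using \<kappa>.exp_of_derived_img[of "carrier G" n] quotient_image_carrier by simp
    then have "(derived (G Mod K) ^^ n) (carrier (G Mod K)) = {\<one>\<^bsub>G Mod K\<^esub>}"
      using subgroup.one_closed[OF \<kappa>.H.exp_of_derived_is_subgroup[OF \<kappa>.H.subgroup_self, of n]] by blast
    then show ?thesis using \<kappa>.H.solvable_iff_trivial_derived_seq by blast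
  qed
  moreover have "nilpotent_group ((G Mod K)\<lparr>carrier := ?\<kappa> ` N\<rparr>)"
  proof -
    let ?N = "G\<lparr>carrier := N\<rparr>"
    interpret N: group ?N using sN by (rule subgroup_imp_group)
    interpret \<nu>: group_hom ?N "(G Mod K)\<lparr>carrier := ?\<kappa> ` N\<rparr>" ?\<kappa>
      using K(1) sN by (rule restricted_quotient_hom)
    have "openin (subtopology T N) (K \<inter> N)" using K(2) by (auto simp: openin_subtopology)
    moreover have "\<one>\<^bsub>?N\<^esub> \<in> K \<inter> N" using subgroup.one_closed[OF sK] subgroup.one_closed[OF sN] by simp
    ultimately obtain A :: "nat monoid" and \<pi> where A: "group A" "nilpotent_group A" "\<pi> \<in> hom ?N A"
      "{x \<in> carrier ?N. \<pi> x = \<one>\<^bsub>A\<^esub>} \<subseteq> K \<inter> N"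
      using inverse_limit_of_finite_small_kernel[OF nil[unfolded pronilpotent_def]] by blast
    interpret \<pi>: group_hom ?N A \<pi> using A(1,3) by (intro group_hom.intro group_hom_axioms.intro N.is_group)
    obtain n where n: "lower_central_series A n = {\<one>\<^bsub>A\<^esub>}" using A(2) unfolding nilpotent_group_def by blast
    have "lower_central_series ?N n \<subseteq> carrier ?N"
      using subgroup.subset[OF normal_imp_subgroup[OF N.lower_central_series_normal]] .
    then have "lower_central_series ?N n \<subseteq> K"
      using \<pi>.lower_central_series_image_subset[of n] A(4) unfolding n by blast
    then have "lower_central_series ((G Mod K)\<lparr>carrier := ?\<kappa> ` N\<rparr>) n \<subseteq> {\<one>\<^bsub>G Mod K\<^esub>}"
      using trivial \<nu>.lower_central_series_image[of n] by simp
    moreover have "\<one>\<^bsub>G Mod K\<^esub> \<in> lower_central_series ((G Mod K)\<lparr>carrier := ?\<kappa> ` N\<rparr>) n"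
      using subgroup.one_closed[OF normal_imp_subgroup[OF \<nu>.H.lower_central_series_normal[of n]]] by simp
    ultimately have "lower_central_series ((G Mod K)\<lparr>carrier := ?\<kappa> ` N\<rparr>) n = {\<one>\<^bsub>G Mod K\<^esub>}" by blast
    then show ?thesis unfolding nilpotent_group_def by (intro exI[of _ n]) simp
  qed
  moreover have "card (carrier (G Mod K)) \<le> n ^ nat \<lceil>\<alpha>\<rceil> * card (power_subgroup (G Mod K) n)" if n: "n \<ge> 1" for n
  proof -
    let ?P = "power_subgroup (G Mod K) n"
    have "real n powr \<alpha> \<le> real n powr real (nat \<lceil>\<alpha>\<rceil>)"
      using n by (intro powr_mono) (auto simp: real_nat_ceiling_ge)
    also have "\<dots> = real (n ^ nat \<lceil>\<alpha>\<rceil>)" using n by (simp add: powr_realpow)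
    finally have "card (carrier ((G Mod K) Mod ?P)) \<le> n ^ nat \<lceil>\<alpha>\<rceil>"
      using PIG[OF n] by (metis of_nat_le_iff order_trans)
    then have "card (carrier ((G Mod K) Mod ?P)) * card ?P \<le> n ^ nat \<lceil>\<alpha>\<rceil> * card ?P" by (rule mult_le_mono1)
    then show ?thesis using \<kappa>.H.card_quotient[OF \<kappa>.H.power_subgroup_normal] by simp
  qed
  moreover have "?\<kappa> ` N \<lhd> G Mod K"
    using normal.surj_hom_normal_subgroup[OF N \<kappa>.group_hom_axioms quotient_image_carrier] .
  ultimately show ?thesis
    unfolding solvable_PIG_pair_def
    using \<kappa>.H.is_group fin quotient_generators_modulo_derived[OF rank N K] by blast
qed

theorem corollary1p10:
  fixes G :: "('a, 'b) monoid_scheme" and T :: "'a topology" and N :: "'a set"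
  assumes "prosoluble G T"
    and "has_PIG G T"
    and "N \<lhd> G"
    and "closedin T N"
    and "pronilpotent (G\<lparr>carrier := N\<rparr>) (subtopology T N)"
    and "profinite_rank (G Mod (T closure_of derived G N))
           (quotient_group_topology G T (T closure_of derived G N)) < \<infinity>"
  shows "profinite_rank G T < \<infinity>"
proof -
  interpret profinite G T
    using assms(1) unfolding prosoluble_def by (rule inverse_limit_of_finite_profinite)
  obtain r where r: "profinite_rank (G Mod (T closure_of derived G N))
      (quotient_group_topology G T (T closure_of derived G N)) = enat r"
    using assms(6) by (metis less_infinityE)
  obtain \<alpha> :: real where \<alpha>: "\<And>K n. K \<lhd> G \<Longrightarrow> openin T K \<Longrightarrow> finite (carrier (G Mod K)) \<Longrightarrow> n \<ge> 1 \<Longrightarrow>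
      real (card (carrier ((G Mod K) Mod power_subgroup (G Mod K) n))) \<le> real n powr \<alpha>"
    using assms(2) unfolding has_PIG_def by blast
  have "profinite_rank G T \<le> enat (r + p_rank_bound (r * r) (nat \<lceil>\<alpha>\<rceil>))"
  proof (rule profinite_rank_le)
    fix K H assume K: "K \<lhd> G" "openin T K" and H: "subgroup H (G Mod K)"
    have "solvable_PIG_pair (nat \<lceil>\<alpha>\<rceil>) r (G Mod K) ((\<lambda>x. K #>\<^bsub>G\<^esub> x) ` N)"
      using assms(1,3,5) \<alpha>[OF K finite_quotient[OF K]] eq_refl[OF r] K
      by (rule open_quotient_solvable_PIG_pair)
    then show "\<exists>X. X \<subseteq> H \<and> finite X \<and> card X \<le> r + p_rank_bound (r * r) (nat \<lceil>\<alpha>\<rceil>) \<and> generate (G Mod K) X = H"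
      using H by (rule solvable_PIG_pair_rank)
  qed
  then show ?thesis by (rule le_less_trans) simp
qed

end
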